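(* Let $d\ge1$, $R>0$, $\alpha\in(0,1)$, $t_1,\dots,t_d\ge0$, $s_1,\dots,s_d>0$, and suppose $$b_l^2=\prod_{j=1}^d l_j^{-2t_j},\qquad a_l^2=\sum_{j=1}^d l_j^{2s_j},\qquad l\in\mathbb{N}_*^d .$$ Then: (1) The minimax separation rate $r_\epsilon^\star$ over $\Theta_{a,R}$ satisfies $$r_\epsilon^\star\sim\epsilon^{4/\left(4+\sum_{j=1}^d\frac{1+4t_j}{s_j}\right)}\quad\text{as }\epsilon\to0.$$ (2) If $r_\epsilon=C\epsilon^{4/\left(4+\sum_{j=1}^d\frac{1+4t_j}{s_j}\right)}$ for some positive constant $C$, then $u_\epsilon(r_\epsilon)=\mathcal{O}(1)$ as $\epsilon\to0$ and the following sharp asymptotics hold as $\epsilon\to0$: $\Psi_{\epsilon,H^{(\alpha)}}$ is a level-$\alpha$ test, $\ \beta_\epsilon(\Theta_{a,R}(r_\epsilon),\Psi_{\epsilon,H^{(\alpha)}})=\beta_\epsilon(\Theta_{a,R}(r_\epsilon),\alpha)+o(1)$, and $\beta_\epsilon(\Theta_{a,R}(r_\epsilon),\alpha)=\Phi(H^{(\alpha)}-u_\epsilon(r_\epsilon))+o(1)$.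
   Context: $\mathbb{N}_*=\{1,2,3,\dots\}$. For a noise level $\epsilon>0$ one observes $y=(y_l)_{l\in\mathbb{N}_*^d}$, $y_l=b_l\theta_l+\epsilon\xi_l$, where the $\xi_l$ are i.i.d. standard Gaussian, $b=(b_l)$ is a known sequence and $\theta\in\ell^2(\mathbb{N}_*^d)$ is unknown. $\mathbb{P}_\theta$ is the law of $y$; $\mathbb{P}_0$ corresponds to $\theta=0$. $\|\cdot\|$ is the $\ell^2$ norm. $\Theta_{a,R}=\{\theta\in\ell^2(\mathbb{N}_*^d):\sum_l a_l^2\theta_l^2\le R^2\}$ and $\Theta_{a,R}(r)=\{\theta\in\Theta_{a,R}:\|\theta\|\ge r\}$. All parameters other than $\epsilon$ are fixed. One tests $H_0:\theta=0$ against $\theta\in\Theta_{a,R}(r_\epsilon)$. A test $\psi$ is a measurable function of the data with values in $\{0,1\}$. A level-$\alpha$ test is a test function $\psi_\alpha$ (which may depend on $\epsilon$) satisfying $\mathbb{P}_0(\psi_\alpha=1)\le\alpha+o(1)$ as $\epsilon\to0$. $\beta_\epsilon(\Theta_{a,R}(r_\epsilon),\psi)=\sup_{\theta\in\Theta_{a,R}(r_\epsilon)}\mathbb{P}_\theta(\psi=0)$, and $\beta_\epsilon(\Theta_{a,R}(r_\epsilon),\alpha)=\inf_{\psi_\alpha}\beta_\epsilon(\Theta_{a,R}(r_\epsilon),\psi_\alpha)$, the infimum being over all level-$\alpha$ tests. A family $r^\star_\epsilon$ is a minimax separation rate over $\Theta_{a,R}$ if, as $\epsilon\to0$, $\beta_\epsilon(\Theta_{a,R}(r_\epsilon),\alpha)\to1-\alpha$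 whenever $r_\epsilon/r_\epsilon^\star\to0$, and $\beta_\epsilon(\Theta_{a,R}(r_\epsilon),\alpha)\to0$ whenever $r_\epsilon/r_\epsilon^\star\to\infty$. $v_\epsilon\sim w_\epsilon$ as $\epsilon\to0$ means that there are two positive constants $k_0,k_1$ such that $k_0w_\epsilon\le v_\epsilon\le k_1w_\epsilon$ for all $\epsilon>0$. Extremal problem: $u_\epsilon^2(r_\epsilon)=\frac{1}{2\epsilon^4}\inf_{\theta\in\Theta_{a,R}(r_\epsilon)}\sum_k b_k^4\theta_k^4=\frac1{2\epsilon^4}\sum_k b_k^4\tilde\theta_k^4$, where $\tilde\theta$ is the solution, and $u_\epsilon(r_\epsilon)\ge0$. Filter: $\omega_k=b_k^2\tilde\theta_k^2\big/\sqrt{2\sum_{m}b_m^4\tilde\theta_m^4}$. Test statistic $T=\sum_{k\in\mathbb{N}_*^d}\omega_k\big((y_k/\epsilon)^2-1\big)$ and tests $\Psi_{\epsilon,t}=\mathbf 1_{\{T>t\}}$. $\Phi$ is the standard Gaussian distribution function and $H^{(\alpha)}$ its $(1-\alpha)$-quantile.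
   Formalization: The infimum over level-α tests is taken at each ε over tests with P_0(ψ=1) ≤ α+δ(ε), for every fixed δ(ε)→0 (a literal infimum over all α+o(1) families is 0), and the bounds in r*∼ε^κ are required only for all small ε, not for all ε>0. *)

theory Defs
  imports "HOL-Probability.Probability"
begin

type_synonym multi_index = "nat \<Rightarrow> nat"
type_synonym sequence = "multi_index \<Rightarrow> real"

definition Nstar :: "nat \<Rightarrow> multi_index set" where
  "Nstar d = ({1..d} \<rightarrow>\<^sub>E {1..})"


section \<open>The Gaussian sequence model\<close>

definition obs_space :: "nat \<Rightarrow> sequence measure" where
  "obs_space d = PiM (Nstar d) (\<lambda>_. borel)"

definition noise_law :: "nat \<Rightarrow> sequence measure" where
  "noise_law d = PiM (Nstar d) (\<lambda>_. std_normal_distribution)"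

definition obs_law :: "nat \<Rightarrow> sequence \<Rightarrow> real \<Rightarrow> sequence \<Rightarrow> sequence measure" where
  "obs_law d b \<epsilon> \<theta> =
     distr (noise_law d) (obs_space d) (\<lambda>\<xi>. \<lambda>l\<in>Nstar d. b l * \<theta> l + \<epsilon> * \<xi> l)"

text \<open>The values of a sequence outside of \<^term>\<open>Nstar d\<close> are irrelevant everywhere below.\<close>

definition ell2 :: "nat \<Rightarrow> sequence set" where
  "ell2 d = {\<theta>. (\<lambda>l. (\<theta> l)\<^sup>2) summable_on Nstar d}"

definition ell2_norm :: "nat \<Rightarrow> sequence \<Rightarrow> real" where
  "ell2_norm d \<theta> = sqrt (\<Sum>\<^sub>\<infinity>l\<in>Nstar d. (\<theta> l)\<^sup>2)"

definition ellipsoid :: "nat \<Rightarrow> sequence \<Rightarrow> real \<Rightarrow> sequence set" where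
  "ellipsoid d a R = {\<theta> \<in> ell2 d.
     (\<lambda>l. (a l)\<^sup>2 * (\<theta> l)\<^sup>2) summable_on Nstar d \<and>
     (\<Sum>\<^sub>\<infinity>l\<in>Nstar d. (a l)\<^sup>2 * (\<theta> l)\<^sup>2) \<le> R\<^sup>2}"

definition alternatives :: "nat \<Rightarrow> sequence \<Rightarrow> real \<Rightarrow> real \<Rightarrow> sequence set" where
  "alternatives d a R r = {\<theta> \<in> ellipsoid d a R. r \<le> ell2_norm d \<theta>}"


section \<open>Tests and error probabilities\<close>

definition level_test ::
  "nat \<Rightarrow> sequence \<Rightarrow> real \<Rightarrow> real \<Rightarrow> (sequence \<Rightarrow> nat) \<Rightarrow> bool" where
  "level_test d b \<epsilon> c \<psi> \<longleftrightarrow>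
     \<psi> \<in> measurable (obs_space d) (count_space {0, 1}) \<and>
     measure (obs_law d b \<epsilon> (\<lambda>_. 0)) {y \<in> space (obs_space d). \<psi> y = 1} \<le> c"

text \<open>Level \<open>\<alpha> + o(1)\<close> is a property of a family of tests indexed by the noise level.\<close>

definition asymptotic_level_test ::
  "nat \<Rightarrow> sequence \<Rightarrow> real \<Rightarrow> (real \<Rightarrow> sequence \<Rightarrow> nat) \<Rightarrow> bool" where
  "asymptotic_level_test d b \<alpha> \<psi> \<longleftrightarrow>
     (\<exists>\<delta>. (\<delta> \<longlongrightarrow> 0) (at_right 0) \<and>
        (\<forall>\<^sub>F \<epsilon> in at_right 0. level_test d b \<epsilon> (\<alpha> + \<delta> \<epsilon>) (\<psi> \<epsilon>)))"

text \<open>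
  Inserting \<open>0\<close> only matters for an empty class \<open>\<Theta>\<close> (the radius exceeds that of the
  ellipsoid): it fixes the supremum of no probabilities to be \<open>0\<close>.
\<close>

definition second_kind_error ::
  "nat \<Rightarrow> sequence \<Rightarrow> real \<Rightarrow> sequence set \<Rightarrow> (sequence \<Rightarrow> nat) \<Rightarrow> real" where
  "second_kind_error d b \<epsilon> \<Theta> \<psi> =
     Sup (insert 0
       ((\<lambda>\<theta>. measure (obs_law d b \<epsilon> \<theta>) {y \<in> space (obs_space d). \<psi> y = 0}) ` \<Theta>))"

text \<open>
  The infimum is over the tests of level \<open>c\<close> at the given noise level \<open>\<epsilon>\<close>; below it is used with
  \<open>c = \<alpha> + \<delta> \<epsilon>\<close> for an \<open>o(1)\<close> term \<open>\<delta>\<close>. An infimum taken, at fixed \<open>\<epsilon>\<close>, over all families that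
  are only asymptotically of level \<open>\<alpha>\<close> would be \<open>0\<close>, since a single member of such a family is
  unconstrained.
\<close>

definition minimax_error ::
  "nat \<Rightarrow> sequence \<Rightarrow> real \<Rightarrow> sequence set \<Rightarrow> real \<Rightarrow> real" where
  "minimax_error d b \<epsilon> \<Theta> c =
     Inf {second_kind_error d b \<epsilon> \<Theta> \<psi> |\<psi>. level_test d b \<epsilon> c \<psi>}"

definition minimax_separation_rate ::
  "nat \<Rightarrow> sequence \<Rightarrow> sequence \<Rightarrow> real \<Rightarrow> real \<Rightarrow> (real \<Rightarrow> real) \<Rightarrow> (real \<Rightarrow> real) \<Rightarrow> bool" where
  "minimax_separation_rate d a b R \<alpha> \<delta> rs \<longleftrightarrow>
     (\<forall>\<^sub>F \<epsilon> in at_right 0. 0 < rs \<epsilon>) \<and>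
     (\<forall>r. (\<forall>\<epsilon>>0. 0 < r \<epsilon>) \<longrightarrow> ((\<lambda>\<epsilon>. r \<epsilon> / rs \<epsilon>) \<longlongrightarrow> 0) (at_right 0) \<longrightarrow>
        ((\<lambda>\<epsilon>. minimax_error d b \<epsilon> (alternatives d a R (r \<epsilon>)) (\<alpha> + \<delta> \<epsilon>))
           \<longlongrightarrow> 1 - \<alpha>) (at_right 0)) \<and>
     (\<forall>r. (\<forall>\<epsilon>>0. 0 < r \<epsilon>) \<longrightarrow> filterlim (\<lambda>\<epsilon>. r \<epsilon> / rs \<epsilon>) at_top (at_right 0) \<longrightarrow>
        ((\<lambda>\<epsilon>. minimax_error d b \<epsilon> (alternatives d a R (r \<epsilon>)) (\<alpha> + \<delta> \<epsilon>))
           \<longlongrightarrow> 0) (at_right 0))"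

text \<open>
  The two-sided bound is required for all small noise levels only: a minimax separation rate
  is unconstrained away from \<open>0\<close>.
\<close>

definition same_order :: "(real \<Rightarrow> real) \<Rightarrow> (real \<Rightarrow> real) \<Rightarrow> bool" where
  "same_order v w \<longleftrightarrow>
     (\<exists>k\<^sub>0>0. \<exists>k\<^sub>1>0. \<forall>\<^sub>F \<epsilon> in at_right 0. k\<^sub>0 * w \<epsilon> \<le> v \<epsilon> \<and> v \<epsilon> \<le> k\<^sub>1 * w \<epsilon>)"


section \<open>Extremal problem and associated tests\<close>

definition quartic :: "nat \<Rightarrow> sequence \<Rightarrow> sequence \<Rightarrow> real" where
  "quartic d b \<theta> = (\<Sum>\<^sub>\<infinity>k\<in>Nstar d. (b k)^4 * (\<theta> k)^4)"

definition extremal_value ::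
  "nat \<Rightarrow> sequence \<Rightarrow> sequence \<Rightarrow> real \<Rightarrow> real \<Rightarrow> real \<Rightarrow> real" where
  "extremal_value d a b R \<epsilon> r =
     sqrt (1 / (2 * \<epsilon>^4) * (INF \<theta>\<in>alternatives d a R r. quartic d b \<theta>))"

text \<open>
  The solution is unique up to signs (and up to values outside of \<^term>\<open>Nstar d\<close>), on which
  the filter does not depend.
\<close>

definition extremal_solution ::
  "nat \<Rightarrow> sequence \<Rightarrow> sequence \<Rightarrow> real \<Rightarrow> real \<Rightarrow> sequence" where
  "extremal_solution d a b R r = arg_min (quartic d b) (\<lambda>\<theta>. \<theta> \<in> alternatives d a R r)"

definition test_filter :: "nat \<Rightarrow> sequence \<Rightarrow> sequence \<Rightarrow> real \<Rightarrow> real \<Rightarrow> sequence" where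
  "test_filter d a b R r k =
     (let \<theta> = extremal_solution d a b R r in (b k)\<^sup>2 * (\<theta> k)\<^sup>2 / sqrt (2 * quartic d b \<theta>))"

definition test_statistic ::
  "nat \<Rightarrow> sequence \<Rightarrow> sequence \<Rightarrow> real \<Rightarrow> real \<Rightarrow> real \<Rightarrow> sequence \<Rightarrow> real" where
  "test_statistic d a b R \<epsilon> r y =
     (\<Sum>\<^sub>\<infinity>k\<in>Nstar d. test_filter d a b R r k * ((y k / \<epsilon>)\<^sup>2 - 1))"

definition threshold_test ::
  "nat \<Rightarrow> sequence \<Rightarrow> sequence \<Rightarrow> real \<Rightarrow> real \<Rightarrow> real \<Rightarrow> real \<Rightarrow> sequence \<Rightarrow> nat" where
  "threshold_test d a b R \<epsilon> r t y = of_bool (test_statistic d a b R \<epsilon> r y > t)"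

definition \<Phi> :: "real \<Rightarrow> real" where
  "\<Phi> = cdf std_normal_distribution"

definition upper_quantile :: "real \<Rightarrow> real" where
  "upper_quantile \<alpha> = Inf {x. 1 - \<alpha> \<le> \<Phi> x}"

end

theory Submission
  imports Defs
begin

text \<open>
  The statistic \<open>T\<close> is a weighted sum of centred chi-square variables whose weights become uniformly
  small as \<open>\<epsilon> \<rightarrow> 0\<close>; characteristic functions and Levy's theorem make it asymptotically standard
  normal under \<open>\<theta> = 0\<close>. The extremal problem is convex in the squares \<open>\<theta>\<^sub>l\<^sup>2\<close>, and its first-order
  condition says that the mean of \<open>T\<close> over the alternatives is at least \<open>u\<^sub>\<epsilon>\<close>: this gives the upper
  bound. For the lower bound, flip the signs of the extremal sequence at random. The likelihood
  ratio of this mixture is, up to a factor close to \<open>1\<close>, at least \<open>exp (u\<^sub>\<epsilon> T - u\<^sub>\<epsilon>\<^sup>2 / 2)\<close>, because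
  \<open>cosh x \<ge> exp (x\<^sup>2 / 2 - x^4 / 12)\<close>, and the Neyman-Pearson argument applies. Counting lattice
  points yields \<open>u\<^sub>\<epsilon>\<^sup>2\<close> of order \<open>r\<^sub>\<epsilon>\<close> to the power \<open>4 + \<Sum>\<^sub>j (1 + 4 t\<^sub>j) / s\<^sub>j\<close>, divided by \<open>\<epsilon>^4\<close>;
  the separation rate follows since the minimax error is monotone in the radius.
\<close>

text \<open>Every asymptotic estimate is stated uniformly: for each tolerance there is a bound
  \<open>\<rho>\<close> on the weights below which it holds for all weights, shifts and tests
  concerned. The noise level enters only through \<open>u\<close> and through the radius, since a
  small radius forces small weights. This uniformity is what permits suprema over alternatives and
  infima over tests at a fixed noise level. Two obstacles shape the estimates. The alternatives have
  unbounded mean shifts \<open>m\<close>, so the fluctuations of the statistic are compared with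
  \<open>1 + m\<close> instead of a constant. A competing test may depend on all of the infinitely
  many coordinates, but the extremal sequence has finite support, so the likelihood ratio is a
  finite product. The exponent has two sources: about \<open>M powr E1\<close> indices satisfy
  \<open>a^2 \<le> M\<close>, and \<open>1 / b^4\<close> is at most \<open>M powr E2\<close> there.
  With \<open>M\<close> of order \<open>1 / r^2\<close>, the factor \<open>r^4\<close> becomes
  \<open>r powr (4 + 2 * (E1 + E2))\<close>.\<close>

section \<open>The standard normal distribution function: regularity, quantiles, uniform
  convergence\<close>

lemma sets_std_normal [measurable_cong, simp]: "sets std_normal_distribution = sets borel"
  by simp

lemma Phi_interval: "x \<le> y \<Longrightarrow> \<Phi> y - \<Phi> x = measure std_normal_distribution {x<..y}"
proof -
  interpret real_distribution std_normal_distribution by (rule real_dist_normal_dist)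
  assume "x \<le> y"
  show ?thesis
  proof (cases "x = y")
    case False
    with \<open>x \<le> y\<close> show ?thesis unfolding \<Phi>_def using cdf_diff_eq[of x y] by simp
  qed simp
qed

lemma Phi_mono: "x \<le> y \<Longrightarrow> \<Phi> x \<le> \<Phi> y"
  using Phi_interval[of x y] measure_nonneg[of std_normal_distribution "{x<..y}"] by linarith

lemma std_normal_density_le_1: "std_normal_density x \<le> 1"
proof -
  have "1 \<le> sqrt (2 * pi)" using pi_gt3 by (intro real_le_rsqrt) simp
  hence "1 / sqrt (2 * pi) * exp (- x\<^sup>2 / 2) \<le> 1 * 1"
    by (intro mult_mono) auto
  thus ?thesis by (simp add: std_normal_density_def)
qed

text \<open>The density is at most \<open>1\<close>, so an interval has mass at most its length.
  This converts a small shift of a threshold into a small change of an error probability.\<close>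

lemma Phi_Lipschitz_le: "x \<le> y \<Longrightarrow> \<Phi> y - \<Phi> x \<le> y - x"
proof -
  interpret real_distribution std_normal_distribution by (rule real_dist_normal_dist)
  assume xy: "x \<le> y"
  have "emeasure std_normal_distribution {x<..y} = (\<integral>\<^sup>+z. std_normal_density z * indicator {x<..y} z \<partial>lborel)"
    by (subst emeasure_density) (auto simp: ennreal_mult' ennreal_indicator)
  also have "\<dots> \<le> (\<integral>\<^sup>+z. indicator {x<..y} z \<partial>lborel)"
    by (intro nn_integral_mono) (auto split: split_indicator simp: std_normal_density_le_1)
  also have "\<dots> = ennreal (y - x)" using xy by simp
  finally show ?thesis using Phi_interval[OF xy] xy
    by (simp add: emeasure_eq_measure)
qed

lemma Phi_Lipschitz: "\<bar>\<Phi> y - \<Phi> x\<bar> \<le> \<bar>y - x\<bar>"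
  using Phi_Lipschitz_le[of x y] Phi_Lipschitz_le[of y x] Phi_mono[of x y] Phi_mono[of y x]
  by linarith

text \<open>An interval that is null for the normal law would be Lebesgue null, because the density
  vanishes nowhere.\<close>

lemma Phi_strict_mono: "x < y \<Longrightarrow> \<Phi> x < \<Phi> y"
proof -
  interpret real_distribution std_normal_distribution by (rule real_dist_normal_dist)
  assume xy: "x < y"
  have "{x<..y} \<notin> null_sets std_normal_distribution"
  proof
    assume "{x<..y} \<in> null_sets std_normal_distribution"
    hence "AE z in lborel. z \<in> {x<..y} \<longrightarrow> ennreal (std_normal_density z) = 0"
      by (simp add: null_sets_density_iff)
    hence "AE z in lborel. z \<notin> {x<..y}"
      by eventually_elim (metis ennreal_eq_0_iff normal_density_pos not_le zero_less_one)
    hence "{x<..y} \<in> null_sets lborel" by (subst (asm) AE_iff_null_sets[symmetric]) auto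
    hence "emeasure lborel {x<..y} = 0" by auto
    thus False using xy by simp
  qed
  hence "measure std_normal_distribution {x<..y} \<noteq> 0"
    by (simp add: null_sets_def emeasure_eq_measure)
  moreover have "measure std_normal_distribution {x<..y} \<ge> 0" by simp
  ultimately show ?thesis using Phi_interval[of x y] xy by linarith
qed

lemma isCont_Phi: "isCont \<Phi> x"
  unfolding isCont_def LIM_def dist_real_def using Phi_Lipschitz
  by (metis abs_minus_commute order_le_less_trans)

lemma Phi_nonneg: "0 \<le> \<Phi> x" and Phi_le_1: "\<Phi> x \<le> 1"
proof -
  interpret real_distribution std_normal_distribution by (rule real_dist_normal_dist)
  show "0 \<le> \<Phi> x" "\<Phi> x \<le> 1" by (auto simp: \<Phi>_def cdf_nonneg cdf_bounded_prob)
qed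

lemma Phi_at_bot: "(\<Phi> \<longlongrightarrow> 0) at_bot" and Phi_at_top: "(\<Phi> \<longlongrightarrow> 1) at_top"
proof -
  interpret real_distribution std_normal_distribution by (rule real_dist_normal_dist)
  show "(\<Phi> \<longlongrightarrow> 0) at_bot" "(\<Phi> \<longlongrightarrow> 1) at_top" unfolding \<Phi>_def
    using cdf_lim_at_bot cdf_lim_at_top_prob by auto
qed

lemma ex_Phi_eq: assumes "0 < p" "p < 1" shows "\<exists>x. \<Phi> x = p"
proof -
  obtain l where l: "\<Phi> l < p"
    using order_tendstoD(2)[OF Phi_at_bot assms(1)] by (auto simp: eventually_at_bot_linorder)
  obtain r where r: "\<Phi> r > p"
    using order_tendstoD(1)[OF Phi_at_top assms(2)] by (auto simp: eventually_at_top_linorder)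
  have "l \<le> r" using l r Phi_mono[of r l] by linarith
  thus ?thesis using IVT[of \<Phi> l p r] l r isCont_Phi by auto
qed

text \<open>Strict monotonicity turns the set in \<open>upper_quantile\<close> into a closed
  half-line, whose left end is the solution of \<open>\<Phi> x = 1 - \<alpha>\<close> supplied by
  continuity.\<close>

lemma Phi_upper_quantile: assumes "0 < \<alpha>" "\<alpha> < 1" shows "\<Phi> (upper_quantile \<alpha>) = 1 - \<alpha>"
proof -
  obtain x where x: "\<Phi> x = 1 - \<alpha>" using ex_Phi_eq[of "1 - \<alpha>"] assms by auto
  have "{z. 1 - \<alpha> \<le> \<Phi> z} = {x..}"
    using Phi_mono[of x] Phi_strict_mono[of _ x] unfolding x[symmetric]
    by (auto simp: not_less[symmetric])
  thus ?thesis by (simp add: upper_quantile_def x)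
qed

text \<open>A Polya-type statement: the quantiles of order \<open>i / n\<close> serve as a finite grid.\<close>

lemma weak_conv_imp_uniform_cdf:
  fixes \<mu> :: "nat \<Rightarrow> real measure"
  assumes rd: "\<And>n. real_distribution (\<mu> n)" and conv: "weak_conv_m \<mu> std_normal_distribution"
    and \<eta>: "\<eta> > 0"
  shows "\<forall>\<^sub>F n in sequentially. \<forall>x. \<bar>cdf (\<mu> n) x - \<Phi> x\<bar> \<le> \<eta>"
proof -
  \<comment> \<open>Two errors of size \<open>1 / m\<close> add up: the distance of the distribution
    functions at a quantile, and the increment of \<open>\<Phi>\<close> between neighbouring
    quantiles.\<close>
  obtain m :: nat where m: "m > 0" "2 / real m < \<eta>"
    using reals_Archimedean3[OF \<eta>, rule_format, of 2]
    by (metis \<eta> divide_less_eq gr0I mult.commute mult_zero_left not_numeral_less_zero of_nat_0 of_nat_0_less_iff)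
  have "\<forall>i\<in>{1..<m}. \<exists>x. \<Phi> x = real i / real m" using m by (intro ballI ex_Phi_eq) auto
  then obtain q where q: "\<And>i. i \<in> {1..<m} \<Longrightarrow> \<Phi> (q i) = real i / real m" by metis
  have pt: "(\<lambda>n. cdf (\<mu> n) x) \<longlonglongrightarrow> \<Phi> x" for x
    using conv isCont_Phi[of x] unfolding weak_conv_m_def weak_conv_def \<Phi>_def by auto
  have "\<forall>\<^sub>F n in sequentially. \<bar>cdf (\<mu> n) (q i) - \<Phi> (q i)\<bar> < 1 / real m" for i
    using tendstoD[OF pt[of "q i"], of "1 / real m"] m by (simp add: dist_real_def)
  hence "\<forall>\<^sub>F n in sequentially. \<forall>i\<in>{1..<m}. \<bar>cdf (\<mu> n) (q i) - \<Phi> (q i)\<bar> < 1 / real m"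
    by (intro eventually_ball_finite) auto
  thus ?thesis
  proof eventually_elim
    case (elim n)
    interpret real_distribution "\<mu> n" by (rule rd)
    show ?case
    proof
      fix x
      \<comment> \<open>Now \<open>i / m \<le> \<Phi> x < (i + 1) / m\<close> places
        \<open>x\<close> between two grid points. There are no quantiles of order \<open>0\<close>
        and \<open>1\<close>; at these ends the trivial bounds on a distribution function take
        over.\<close>
      define i where "i = nat \<lfloor>real m * \<Phi> x\<rfloor>"
      have i1: "real i \<le> real m * \<Phi> x" and i2: "real m * \<Phi> x < real i + 1"
        using Phi_nonneg[of x] unfolding i_def by (auto simp: of_nat_nat mult_nonneg_nonneg)
      have i1': "real i / real m \<le> \<Phi> x" and i2': "\<Phi> x < (real i + 1) / real m"
        using i1 i2 m by (auto simp: field_simps)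
      have m2: "2 / real m = 1 / real m + 1 / real m" by simp
      have lo: "\<Phi> x - 2 / real m \<le> cdf (\<mu> n) x"
      proof (cases "i \<in> {1..<m}")
        case True
        have "q i \<le> x" using Phi_strict_mono[of x "q i"] q[OF True] i1' by force
        hence "cdf (\<mu> n) (q i) \<le> cdf (\<mu> n) x" by (rule cdf_nondecreasing)
        moreover have "cdf (\<mu> n) (q i) > real i / real m - 1 / real m"
          using elim[rule_format, OF True] q[OF True] by linarith
        moreover have "(real i + 1) / real m = real i / real m + 1 / real m"
          by (simp add: add_divide_distrib)
        ultimately show ?thesis using i2' m2 by linarith
      next
        case False
        show ?thesis
        proof (cases "i = 0")
          case True
          have "0 \<le> cdf (\<mu> n) x" by (rule cdf_nonneg)
          moreover have "1 / real m > 0" using m by simp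
          ultimately show ?thesis using i2' True m2 by (simp; linarith)
        next
          case i0: False
          \<comment> \<open>This case is void, because \<open>\<Phi>\<close> never attains
            \<open>1\<close>.\<close>
          have im: "i \<ge> m" using False i0 by auto
          have "\<Phi> x \<ge> 1" using i1' im m by (meson divide_le_eq_1_pos le_divide_eq_1_pos less_le_trans of_nat_0_less_iff of_nat_le_iff order_trans)
          hence "\<Phi> x = 1" using Phi_le_1[of x] by linarith
          moreover have "\<Phi> x < \<Phi> (x + 1)" by (rule Phi_strict_mono) simp
          ultimately show ?thesis using Phi_le_1[of "x+1"] by linarith
        qed
      qed
      have hi: "cdf (\<mu> n) x \<le> \<Phi> x + 2 / real m"
      proof (cases "i + 1 < m")
        case True
        hence I: "i + 1 \<in> {1..<m}" by auto
        have "x \<le> q (i + 1)" using Phi_mono[of "q (i+1)" x] q[OF I] i2'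
          by (cases "q (i+1) \<le> x") (auto simp: add.commute)
        hence "cdf (\<mu> n) x \<le> cdf (\<mu> n) (q (i + 1))" by (rule cdf_nondecreasing)
        moreover have "cdf (\<mu> n) (q (i + 1)) < real (i + 1) / real m + 1 / real m"
          using elim[rule_format, OF I] q[OF I] by linarith
        moreover have "real (i + 1) / real m = real i / real m + 1 / real m"
          by (simp add: add_divide_distrib)
        ultimately show ?thesis using i1' m2 by linarith
      next
        case False
        hence "real m \<le> real i + 1" by linarith
        hence "1 \<le> (real i + 1) / real m" using m by simp
        hence "1 - 1 / real m \<le> \<Phi> x" using i1' by (simp add: add_divide_distrib)
        moreover have "cdf (\<mu> n) x \<le> 1" by (rule cdf_bounded_prob)
        moreover have "1 / real m > 0" using m by simp
        ultimately show ?thesis using m2 by linarith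
      qed
      show "\<bar>cdf (\<mu> n) x - \<Phi> x\<bar> \<le> \<eta>" using lo hi m by linarith
    qed
  qed
qed

section \<open>Products of standard normal distributions\<close>

abbreviation gauss :: "'i set \<Rightarrow> ('i \<Rightarrow> real) measure" where
  "gauss I \<equiv> PiM I (\<lambda>_. std_normal_distribution)"

lemma prob_space_std_normal: "prob_space std_normal_distribution"
  by (rule prob_space_normal_density) simp

lemma prob_space_gauss: "prob_space (gauss I)"
  by (intro prob_space_PiM prob_space_std_normal)

lemma sets_gauss: "sets (gauss I) = sets (PiM I (\<lambda>_. borel))"
  by (intro sets_PiM_cong) auto

lemma gauss_component:
  assumes "i \<in> I" shows "distr (gauss I) borel (\<lambda>x. x i) = std_normal_distribution"
proof -
  have "distr (gauss I) borel (\<lambda>x. x i) = distr (gauss I) std_normal_distribution (\<lambda>x. x i)"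
    by (intro distr_cong) auto
  also have "\<dots> = std_normal_distribution"
    by (rule distr_PiM_component[of I "\<lambda>_. std_normal_distribution"]) (use assms prob_space_std_normal in auto)
  finally show ?thesis .
qed

lemma measurable_gauss_component [measurable]:
  "i \<in> I \<Longrightarrow> (\<lambda>x. x i) \<in> borel_measurable (gauss I)"
  using measurable_component_singleton[of i I "\<lambda>_. std_normal_distribution"]
  by (simp only: measurable_cong_sets[OF refl sets_std_normal])

lemma integral_gauss_component:
  fixes g :: "real \<Rightarrow> real"
  assumes "i \<in> I" "g \<in> borel_measurable borel"
  shows "(\<integral>x. g (x i) \<partial>gauss I) = (\<integral>z. g z \<partial>std_normal_distribution)"
    and "integrable (gauss I) (\<lambda>x. g (x i)) \<longleftrightarrow> integrable std_normal_distribution g"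
  using assms integral_distr[of "\<lambda>x. x i" "gauss I" borel g]
    integrable_distr_eq[of "\<lambda>x. x i" "gauss I" borel g]
  by (simp_all add: gauss_component)

lemma nn_integral_gauss_component:
  assumes "i \<in> I" "g \<in> borel_measurable borel"
  shows "(\<integral>\<^sup>+x. g (x i) \<partial>gauss I) = (\<integral>\<^sup>+z. g z \<partial>std_normal_distribution)"
  using assms nn_integral_distr[of "\<lambda>x. x i" "gauss I" borel g] by (simp add: gauss_component)

text \<open>On the product space the restriction map is the identity, so the joint law of the
  coordinates is the product of their marginals, which characterises independence. The criterion
  asks for a nonempty index set, hence the case distinction.\<close>

lemma indep_vars_gauss:
  assumes "K \<subseteq> I" "\<And>i. i \<in> K \<Longrightarrow> g i \<in> borel \<rightarrow>\<^sub>M N i"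
  shows "prob_space.indep_vars (gauss I) N (\<lambda>i x. g i (x i)) K"
proof -
  interpret prob_space "gauss I" by (rule prob_space_gauss)
  have "indep_vars (\<lambda>_. borel) (\<lambda>i x. x i) I"
  proof (cases "I = {}")
    case True
    show ?thesis unfolding indep_vars_def indep_sets_def using True by simp
  next
    case False
    have "distr (gauss I) (PiM I (\<lambda>_. borel)) (\<lambda>x. \<lambda>i\<in>I. x i) = distr (gauss I) (gauss I) (\<lambda>x. x)"
      by (intro distr_cong) (auto simp: sets_gauss space_PiM PiE_iff intro!: ext simp: extensional_def)
    also have "\<dots> = gauss I" by simp
    also have "\<dots> = PiM I (\<lambda>i. distr (gauss I) borel (\<lambda>x. x i))"
      by (intro PiM_cong) (simp_all add: gauss_component)
    finally show ?thesis
      by (subst indep_vars_iff_distr_eq_PiM') (use False in auto)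
  qed
  hence "indep_vars (\<lambda>_. borel) (\<lambda>i x. x i) K" using assms by (rule_tac indep_vars_subset) auto
  from indep_vars_compose2[OF this assms(2)] show ?thesis by simp
qed

text \<open>The square expands into a double sum; independence and the zero means kill its
  off-diagonal terms.\<close>

lemma gauss_second_moment_sum:
  fixes g :: "'i \<Rightarrow> real \<Rightarrow> real"
  assumes K: "finite K" "K \<subseteq> I" and [measurable]: "\<And>k. k \<in> K \<Longrightarrow> g k \<in> borel_measurable borel"
    and sq: "\<And>k. k \<in> K \<Longrightarrow> integrable std_normal_distribution (\<lambda>z. (g k z)\<^sup>2)"
    and mean: "\<And>k. k \<in> K \<Longrightarrow> (\<integral>z. g k z \<partial>std_normal_distribution) = 0"
  shows "integrable (gauss I) (\<lambda>x. (\<Sum>k\<in>K. g k (x k))\<^sup>2)"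
    and "(\<integral>x. (\<Sum>k\<in>K. g k (x k))\<^sup>2 \<partial>gauss I) = (\<Sum>k\<in>K. \<integral>z. (g k z)\<^sup>2 \<partial>std_normal_distribution)"
proof -
  interpret G: prob_space std_normal_distribution by (rule prob_space_std_normal)
  interpret prob_space "gauss I" by (rule prob_space_gauss)
  have int: "integrable std_normal_distribution (g k)" if "k \<in> K" for k
    by (rule G.square_integrable_imp_integrable[OF _ sq[OF that]]) (simp add: assms(3)[OF that])
  have pair: "integrable (gauss I) (\<lambda>x. g i (x i) * g j (x j)) \<and>
    (\<integral>x. g i (x i) * g j (x j) \<partial>gauss I) = (if i = j then \<integral>z. (g i z)\<^sup>2 \<partial>std_normal_distribution else 0)"
    if ij: "i \<in> K" "j \<in> K" for i j
  proof (cases "i = j")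
    case True
    have "i \<in> I" using ij K by auto
    with integral_gauss_component[OF this, of "\<lambda>z. (g i z)\<^sup>2"] sq[OF ij(1)] True ij show ?thesis
      by (simp add: power2_eq_square)
  next
    case False
    have I: "i \<in> I" "j \<in> I" using ij K by auto
    have ind: "indep_vars (\<lambda>_. borel) (\<lambda>k x. g k (x k)) {i, j}"
      using ij K by (intro indep_vars_gauss) auto
    have it: "integrable (gauss I) (\<lambda>x. g k (x k))" if "k \<in> {i, j}" for k
      using that I ij int by (auto simp: integral_gauss_component(2))
    have m0: "(\<integral>x. g i (x i) \<partial>gauss I) = 0"
      using mean[OF ij(1)] I ij by (simp add: integral_gauss_component(1))
    show ?thesis
      using indep_vars_lebesgue_integral[OF _ ind it] indep_vars_integrable[OF _ ind it] m0 False
      by simp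
  qed
  have eq: "(\<Sum>k\<in>K. g k (x k))\<^sup>2 = (\<Sum>i\<in>K. \<Sum>j\<in>K. g i (x i) * g j (x j))" for x
    by (simp add: power2_eq_square sum_product)
  show "integrable (gauss I) (\<lambda>x. (\<Sum>k\<in>K. g k (x k))\<^sup>2)"
    unfolding eq using pair by (intro Bochner_Integration.integrable_sum) auto
  have "(\<integral>x. (\<Sum>k\<in>K. g k (x k))\<^sup>2 \<partial>gauss I) =
    (\<Sum>i\<in>K. \<Sum>j\<in>K. if i = j then \<integral>z. (g i z)\<^sup>2 \<partial>std_normal_distribution else 0)"
    unfolding eq using pair
    by (subst Bochner_Integration.integral_sum) (auto intro!: sum.cong Bochner_Integration.integral_sum)
  thus "(\<integral>x. (\<Sum>k\<in>K. g k (x k))\<^sup>2 \<partial>gauss I) = (\<Sum>k\<in>K. \<integral>z. (g k z)\<^sup>2 \<partial>std_normal_distribution)"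
    using K(1) by (simp add: sum.delta)
qed

lemma gauss_Chebyshev_sum:
  fixes g :: "'i \<Rightarrow> real \<Rightarrow> real"
  assumes K: "finite K" "K \<subseteq> I" and [measurable]: "\<And>k. k \<in> K \<Longrightarrow> g k \<in> borel_measurable borel"
    and sq: "\<And>k. k \<in> K \<Longrightarrow> integrable std_normal_distribution (\<lambda>z. (g k z)\<^sup>2)"
    and mean: "\<And>k. k \<in> K \<Longrightarrow> (\<integral>z. g k z \<partial>std_normal_distribution) = 0" and "\<tau> > 0"
  shows "measure (gauss I) {x \<in> space (gauss I). \<tau> \<le> \<bar>\<Sum>k\<in>K. g k (x k)\<bar>} \<le>
    (\<Sum>k\<in>K. \<integral>z. (g k z)\<^sup>2 \<partial>std_normal_distribution) / \<tau>\<^sup>2"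
proof -
  interpret prob_space "gauss I" by (rule prob_space_gauss)
  have m: "(\<lambda>x. \<Sum>k\<in>K. g k (x k)) \<in> borel_measurable (gauss I)"
    by (rule borel_measurable_sum, rule measurable_compose[OF measurable_gauss_component assms(3)])
      (use K in auto)
  note second_moment_method[OF m gauss_second_moment_sum(1)[OF assms(1-5)] \<open>\<tau> > 0\<close>]
  also note gauss_second_moment_sum(2)[OF assms(1-5)]
  finally show ?thesis .
qed

text \<open>Completing the square: the factor \<open>exp (w * z - w^2 / 2)\<close> translates the
  normal density by \<open>w\<close>.\<close>

lemma std_normal_shift:
  assumes [measurable]: "A \<in> sets borel"
  shows "(\<integral>\<^sup>+z. ennreal (exp (w * z - w\<^sup>2 / 2)) * indicator A z \<partial>std_normal_distribution) =
    emeasure std_normal_distribution {z. z + w \<in> A}"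
proof -
  have dens: "std_normal_density z * exp (w * z - w\<^sup>2 / 2) = std_normal_density (z - w)" for z
  proof -
    have "- z\<^sup>2 / 2 + (w * z - w\<^sup>2 / 2) = - (z - w)\<^sup>2 / 2" by (simp add: power2_eq_square field_simps)
    thus ?thesis by (simp add: std_normal_density_def exp_add[symmetric])
  qed
  have dens': "ennreal (std_normal_density z) * ennreal (exp (w * z - w\<^sup>2 / 2)) =
    ennreal (std_normal_density (z - w))" for z
    by (subst ennreal_mult'[symmetric]) (simp_all only: dens normal_density_nonneg exp_ge_zero)
  have "(\<integral>\<^sup>+z. ennreal (exp (w * z - w\<^sup>2 / 2)) * indicator A z \<partial>std_normal_distribution) =
    (\<integral>\<^sup>+z. ennreal (std_normal_density (z - w)) * indicator A z \<partial>lborel)"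
    by (subst nn_integral_density) (simp_all add: dens' mult.assoc[symmetric])
  also have "\<dots> = (\<integral>\<^sup>+z. ennreal (std_normal_density (z - w)) * indicator A z \<partial>distr lborel borel ((+) w))"
    by (simp add: lborel_distr_plus)
  also have "\<dots> = (\<integral>\<^sup>+z. ennreal (std_normal_density z) * indicator A (w + z) \<partial>lborel)"
    by (subst nn_integral_distr) auto
  also have "\<dots> = emeasure std_normal_distribution {z. z + w \<in> A}"
    by (subst emeasure_density) (auto intro!: nn_integral_cong simp: add.commute split: split_indicator)
  finally show ?thesis .
qed

text \<open>The Cameron-Martin formula for a finitely supported shift. Both measures are finite, so
  it suffices to compare them on cylinders, where independence reduces the claim to one coordinate
  at a time.\<close>

lemma gauss_shift:
  assumes K: "finite K" "K \<subseteq> I" and w0: "\<And>i. i \<in> I - K \<Longrightarrow> w i = 0"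
  shows "distr (gauss I) (gauss I) (\<lambda>x. \<lambda>i\<in>I. x i + w i) =
    density (gauss I) (\<lambda>x. \<Prod>k\<in>K. ennreal (exp (w k * x k - (w k)\<^sup>2 / 2)))" (is "?P = ?Q")
proof (rule measure_eqI_PiM_infinite)
  interpret N: prob_space "gauss I" by (rule prob_space_gauss)
  interpret product_prob_space "\<lambda>_. std_normal_distribution" I
    by (intro product_prob_spaceI prob_space_std_normal)
  have KI: "k \<in> K \<Longrightarrow> k \<in> I" for k using K by auto
  have m: "(\<lambda>x. \<lambda>i\<in>I. x i + w i) \<in> gauss I \<rightarrow>\<^sub>M gauss I"
    by (intro measurable_restrict) simp
  have mK: "(\<lambda>x. \<Prod>k\<in>K. ennreal (exp (w k * x k - (w k)\<^sup>2 / 2))) \<in> borel_measurable (gauss I)"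
    using KI by measurable
  show "finite_measure ?P" using N.prob_space_distr[OF m] by (simp add: prob_space_def)
  fix A J assume J: "finite J" "J \<subseteq> I"
    and A: "\<And>i. i \<in> J \<Longrightarrow> A i \<in> sets std_normal_distribution"
  \<comment> \<open>The cylinder lives on \<open>J\<close> and the density on \<open>K\<close>.
    Trivial constraints outside \<open>J\<close> put both on \<open>J \<union> K\<close>; conversely
    \<open>w\<close> vanishes on \<open>J - K\<close>, so the extra exponential factors are
    \<open>1\<close>.\<close>
  define A' where "A' i = (if i \<in> J then A i else UNIV)" for i
  define f where "f i z = ennreal (exp (w i * z - (w i)\<^sup>2 / 2)) * indicator (A' i) z" for i z
  have A' [measurable]: "A' i \<in> sets borel" for i using A by (auto simp: A'_def)
  have JK: "finite (J \<union> K)" "J \<union> K \<subseteq> I" using J K by auto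
  let ?E = "prod_emb I (\<lambda>_. std_normal_distribution) J (Pi\<^sub>E J A)"
  have E: "?E = {x \<in> space (gauss I). \<forall>i\<in>J\<union>K. x i \<in> A' i}"
    using J by (auto simp: prod_emb_def A'_def space_PiM PiE_iff extensional_def)
  have E_sets [measurable]: "?E \<in> sets (gauss I)"
    by (intro sets_PiM_I) (use J A in auto)
  have "emeasure ?P ?E = emeasure (gauss I) {x \<in> space (gauss I). \<forall>i\<in>J\<union>K. x i \<in> {z. z + w i \<in> A' i}}"
    using measurable_space[OF m] JK
    by (subst emeasure_distr[OF m E_sets]) (auto intro!: arg_cong[where f = "emeasure _"] simp: E)
  also have "\<dots> = (\<Prod>i\<in>J\<union>K. emeasure std_normal_distribution {z. z + w i \<in> A' i})"
    by (intro emeasure_PiM_Collect) (use JK in auto)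
  also have "\<dots> = (\<Prod>i\<in>J\<union>K. \<integral>\<^sup>+z. f i z \<partial>std_normal_distribution)"
    unfolding f_def by (intro prod.cong refl std_normal_shift[symmetric] A')
  also have "\<dots> = (\<Prod>i\<in>J\<union>K. \<integral>\<^sup>+x. f i (x i) \<partial>gauss I)"
    using JK by (intro prod.cong refl nn_integral_gauss_component[symmetric]) (auto simp: f_def)
  also have "\<dots> = (\<integral>\<^sup>+x. (\<Prod>i\<in>J\<union>K. f i (x i)) \<partial>gauss I)"
    using JK by (intro N.indep_vars_nn_integral[symmetric] indep_vars_gauss) (auto simp: f_def)
  also have "\<dots> = (\<integral>\<^sup>+x. (\<Prod>k\<in>K. ennreal (exp (w k * x k - (w k)\<^sup>2 / 2))) * indicator ?E x \<partial>gauss I)"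
  proof (intro nn_integral_cong)
    fix x assume x: "x \<in> space (gauss I)"
    have "(\<Prod>i\<in>J\<union>K. ennreal (exp (w i * x i - (w i)\<^sup>2 / 2))) =
      (\<Prod>k\<in>K. ennreal (exp (w k * x k - (w k)\<^sup>2 / 2)))"
      using JK w0 by (intro prod.mono_neutral_right) auto
    moreover have "(\<Prod>i\<in>J\<union>K. indicator (A' i) (x i)) = (indicator ?E x :: ennreal)"
      using JK x by (auto simp: E indicator_def prod_zero_iff)
    ultimately show "(\<Prod>i\<in>J\<union>K. f i (x i)) =
      (\<Prod>k\<in>K. ennreal (exp (w k * x k - (w k)\<^sup>2 / 2))) * indicator ?E x"
      by (simp add: f_def prod.distrib)
  qed
  also have "\<dots> = emeasure ?Q ?E" by (subst emeasure_density[OF mK E_sets]) simp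
  finally show "emeasure ?P ?E = emeasure ?Q ?E" .
qed auto

text \<open>Averaging the shifted laws over all sign patterns produces the product of the hyperbolic cosines.\<close>

lemma gauss_symmetric_mixture:
  assumes K: "finite K" "K \<subseteq> I" and A [measurable]: "A \<in> sets (gauss I)"
  shows "\<exists>\<sigma>\<in>K \<rightarrow>\<^sub>E {-1, 1::real}.
    (\<integral>\<^sup>+x. ennreal (\<Prod>k\<in>K. exp (- (v k)\<^sup>2 / 2) * cosh (v k * x k)) * indicator A x \<partial>gauss I) \<le>
    emeasure (gauss I) {x \<in> space (gauss I). (\<lambda>i\<in>I. x i + (if i \<in> K then \<sigma> i * v i else 0)) \<in> A}"
proof -
  interpret prob_space "gauss I" by (rule prob_space_gauss)
  have KI: "k \<in> K \<Longrightarrow> k \<in> I" for k using K by auto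
  define S where "S = (K \<rightarrow>\<^sub>E {-1, 1::real})"
  define w where "w \<sigma> i = (if i \<in> K then \<sigma> i * v i else 0)" for \<sigma> i
  define L where "L x = (\<Prod>k\<in>K. exp (- (v k)\<^sup>2 / 2) * cosh (v k * x k))" for x
  define p where "p \<sigma> = measure (gauss I) {x \<in> space (gauss I). (\<lambda>i\<in>I. x i + w \<sigma> i) \<in> A}" for \<sigma>
  have fS: "finite S" unfolding S_def by (intro finite_PiE) (use K in auto)
  have card_S: "card S = 2 ^ card K" by (simp add: S_def card_PiE K numeral_2_eq_2)
  have p_eq: "ennreal (p \<sigma>) = (\<integral>\<^sup>+x. ennreal (\<Prod>k\<in>K. exp (w \<sigma> k * x k - (w \<sigma> k)\<^sup>2 / 2)) * indicator A x \<partial>gauss I)"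
    for \<sigma>
  proof -
    have m: "(\<lambda>x. \<lambda>i\<in>I. x i + w \<sigma> i) \<in> gauss I \<rightarrow>\<^sub>M gauss I"
      by (intro measurable_restrict) simp
    have mK: "(\<lambda>x. \<Prod>k\<in>K. ennreal (exp (w \<sigma> k * x k - (w \<sigma> k)\<^sup>2 / 2))) \<in> borel_measurable (gauss I)"
      using KI by measurable
    have "ennreal (p \<sigma>) = emeasure (distr (gauss I) (gauss I) (\<lambda>x. \<lambda>i\<in>I. x i + w \<sigma> i)) A"
      unfolding p_def emeasure_eq_measure[symmetric]
      by (subst emeasure_distr[OF m A]) (auto intro!: arg_cong[where f = "emeasure _"])
    also have "\<dots> = (\<integral>\<^sup>+x. (\<Prod>k\<in>K. ennreal (exp (w \<sigma> k * x k - (w \<sigma> k)\<^sup>2 / 2))) * indicator A x \<partial>gauss I)"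
    proof -
      have sh: "distr (gauss I) (gauss I) (\<lambda>x. \<lambda>i\<in>I. x i + w \<sigma> i) =
        density (gauss I) (\<lambda>x. \<Prod>k\<in>K. ennreal (exp (w \<sigma> k * x k - (w \<sigma> k)\<^sup>2 / 2)))"
        by (rule gauss_shift[OF K]) (simp add: w_def)
      show ?thesis unfolding sh by (rule emeasure_density[OF mK A])
    qed
    finally show ?thesis by (simp add: prod_ennreal)
  qed
  have "(\<Sum>\<sigma>\<in>S. ennreal (p \<sigma>)) =
    (\<integral>\<^sup>+x. (\<Sum>\<sigma>\<in>S. ennreal (\<Prod>k\<in>K. exp (w \<sigma> k * x k - (w \<sigma> k)\<^sup>2 / 2)) * indicator A x) \<partial>gauss I)"
    unfolding p_eq using KI by (intro nn_integral_sum[symmetric]) measurable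
  also have "\<dots> = (\<integral>\<^sup>+x. 2 ^ card K * (ennreal (L x) * indicator A x) \<partial>gauss I)"
  proof (intro nn_integral_cong)
    fix x
    have "(\<Sum>\<sigma>\<in>S. \<Prod>k\<in>K. exp (w \<sigma> k * x k - (w \<sigma> k)\<^sup>2 / 2)) =
      (\<Sum>\<sigma>\<in>S. \<Prod>k\<in>K. exp (\<sigma> k * v k * x k - (\<sigma> k * v k)\<^sup>2 / 2))"
      by (intro sum.cong prod.cong) (auto simp: w_def)
    also have "\<dots> = (\<Prod>k\<in>K. \<Sum>s\<in>{-1, 1}. exp (s * v k * x k - (s * v k)\<^sup>2 / 2))"
      unfolding S_def using K
      by (subst prod_sum_PiE[where f = "\<lambda>k s. exp (s * v k * x k - (s * v k)\<^sup>2 / 2)"]) auto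
    also have "\<dots> = (\<Prod>k\<in>K. 2 * (exp (- (v k)\<^sup>2 / 2) * cosh (v k * x k)))"
    proof (intro prod.cong refl)
      fix k
      have "exp (v k * x k - (v k)\<^sup>2 / 2) = exp (- (v k)\<^sup>2 / 2) * exp (v k * x k)"
        "exp (- (v k * x k) - (v k)\<^sup>2 / 2) = exp (- (v k)\<^sup>2 / 2) * exp (- (v k * x k))"
        by (simp_all add: exp_add[symmetric])
      thus "(\<Sum>s\<in>{-1, 1}. exp (s * v k * x k - (s * v k)\<^sup>2 / 2)) =
        2 * (exp (- (v k)\<^sup>2 / 2) * cosh (v k * x k))"
        by (simp add: cosh_def field_simps)
    qed
    also have "\<dots> = 2 ^ card K * L x" by (simp add: prod.distrib L_def)
    finally have *: "(\<Sum>\<sigma>\<in>S. \<Prod>k\<in>K. exp (w \<sigma> k * x k - (w \<sigma> k)\<^sup>2 / 2)) = 2 ^ card K * L x" .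
    have "(\<Sum>\<sigma>\<in>S. ennreal (\<Prod>k\<in>K. exp (w \<sigma> k * x k - (w \<sigma> k)\<^sup>2 / 2)) * indicator A x) =
      ennreal (\<Sum>\<sigma>\<in>S. \<Prod>k\<in>K. exp (w \<sigma> k * x k - (w \<sigma> k)\<^sup>2 / 2)) * indicator A x"
      by (subst sum_distrib_right[symmetric], subst sum_ennreal) (auto simp: prod_nonneg)
    also have "\<dots> = 2 ^ card K * (ennreal (L x) * indicator A x)"
      unfolding * by (simp add: ennreal_mult' ennreal_power[symmetric] mult.assoc)
    finally show "(\<Sum>\<sigma>\<in>S. ennreal (\<Prod>k\<in>K. exp (w \<sigma> k * x k - (w \<sigma> k)\<^sup>2 / 2)) * indicator A x) =
      2 ^ card K * (ennreal (L x) * indicator A x)" .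
  qed
  also have "\<dots> = 2 ^ card K * (\<integral>\<^sup>+x. ennreal (L x) * indicator A x \<partial>gauss I)"
    using KI unfolding L_def cosh_def by (intro nn_integral_cmult) measurable
  finally have sum_eq: "(\<Sum>\<sigma>\<in>S. ennreal (p \<sigma>)) = 2 ^ card K * (\<integral>\<^sup>+x. ennreal (L x) * indicator A x \<partial>gauss I)" .
  have pn: "p \<sigma> \<ge> 0" for \<sigma> by (simp add: p_def)
  \<comment> \<open>An average over the \<open>2 ^ card K\<close> sign patterns is at most its
    largest term. This replaces the mixture by a single alternative.\<close>
  have "\<exists>\<sigma>\<in>S. (\<Sum>\<sigma>\<in>S. p \<sigma>) \<le> 2 ^ card K * p \<sigma>"
  proof (rule ccontr)
    assume "\<not> ?thesis"
    hence "(\<Sum>\<sigma>\<in>S. 2 ^ card K * p \<sigma>) < (\<Sum>\<sigma>'\<in>S. (\<Sum>\<sigma>\<in>S. p \<sigma>))"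
      using fS card_S by (intro sum_strict_mono) (auto simp: not_le)
    thus False by (simp add: card_S sum_distrib_left)
  qed
  then obtain \<sigma> where \<sigma>: "\<sigma> \<in> S" "(\<Sum>\<sigma>\<in>S. p \<sigma>) \<le> 2 ^ card K * p \<sigma>" by auto
  have "2 ^ card K * (\<integral>\<^sup>+x. ennreal (L x) * indicator A x \<partial>gauss I) = ennreal (\<Sum>\<sigma>\<in>S. p \<sigma>)"
    using sum_eq pn by (simp add: sum_ennreal)
  also have "\<dots> \<le> ennreal (2 ^ card K * p \<sigma>)" by (rule ennreal_leI[OF \<sigma>(2)])
  also have "\<dots> = 2 ^ card K * ennreal (p \<sigma>)" by (simp add: ennreal_mult' ennreal_power[symmetric])
  finally have "(\<integral>\<^sup>+x. ennreal (L x) * indicator A x \<partial>gauss I) \<le> ennreal (p \<sigma>)"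
    by (subst (asm) ennreal_mult_le_mult_iff) (auto simp: power_eq_top_ennreal)
  thus ?thesis using \<sigma>(1) unfolding S_def L_def p_def w_def emeasure_eq_measure[symmetric] by auto
qed

section \<open>Asymptotic normality of the weighted chi-square statistic\<close>

text \<open>Since \<open>z^2 - 1\<close> has variance \<open>2\<close>, the normalisation
  \<open>1 / 2\<close> gives the weighted chi-square sum variance \<open>1\<close>. The bound
  \<open>\<rho>\<close> plays the part of a Lindeberg condition.\<close>

definition flat_weights :: "'i set \<Rightarrow> real \<Rightarrow> 'i set \<Rightarrow> ('i \<Rightarrow> real) \<Rightarrow> bool" where
  "flat_weights I \<rho> K w \<longleftrightarrow> finite K \<and> K \<subseteq> I \<and> (\<forall>k\<in>K. 0 \<le> w k \<and> w k \<le> \<rho>) \<and> (\<Sum>k\<in>K. (w k)\<^sup>2) = 1 / 2"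

lemma flat_weights_mono: "flat_weights I \<rho> K w \<Longrightarrow> \<rho> \<le> \<rho>' \<Longrightarrow> flat_weights I \<rho>' K w"
  unfolding flat_weights_def by force

lemma std_normal_moments:
  "(\<integral>z. z ^ 2 \<partial>std_normal_distribution) = 1" "(\<integral>z. z ^ 4 \<partial>std_normal_distribution) = 3"
  "(\<integral>z. z ^ 8 \<partial>std_normal_distribution) = 105"
  using std_normal_distribution_even_moments[of 1] std_normal_distribution_even_moments[of 2]
    std_normal_distribution_even_moments[of 4]
  by (simp_all add: fact_numeral)

lemma integrable_std_normal_power [simp]:
  "integrable std_normal_distribution (\<lambda>z. z ^ k)" "integrable std_normal_distribution (\<lambda>z. z)"
  using integrable_std_normal_distribution_moment[of k] integrable_std_normal_distribution_moment[of 1]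
  by simp_all

lemma std_normal_chi_square:
  "(\<integral>z. z\<^sup>2 - 1 \<partial>std_normal_distribution) = 0"
  "integrable std_normal_distribution (\<lambda>z. (z\<^sup>2 - 1)\<^sup>2)"
  "(\<integral>z. (z\<^sup>2 - 1)\<^sup>2 \<partial>std_normal_distribution) = 2"
proof -
  interpret prob_space std_normal_distribution by (rule prob_space_std_normal)
  have i1: "integrable std_normal_distribution (\<lambda>z. 1)" by simp
  show "(\<integral>z. z\<^sup>2 - 1 \<partial>std_normal_distribution) = 0"
    using prob_space by (subst Bochner_Integration.integral_diff) (simp_all only: integrable_std_normal_power i1 std_normal_moments, simp)
  have eq: "(z\<^sup>2 - 1)\<^sup>2 = z ^ 4 - 2 * z ^ 2 + 1" for z :: real by (simp add: power2_eq_square eval_nat_numeral algebra_simps)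
  show "integrable std_normal_distribution (\<lambda>z. (z\<^sup>2 - 1)\<^sup>2)"
    unfolding eq by (intro Bochner_Integration.integrable_add Bochner_Integration.integrable_diff
        integrable_mult_right integrable_std_normal_power i1)
  have "(\<integral>z. z ^ 4 - 2 * z ^ 2 + 1 \<partial>std_normal_distribution) =
    (\<integral>z. z ^ 4 \<partial>std_normal_distribution) - 2 * (\<integral>z. z ^ 2 \<partial>std_normal_distribution) + (\<integral>z. 1 \<partial>std_normal_distribution)"
    by (simp only: Bochner_Integration.integral_add Bochner_Integration.integral_diff
        integral_mult_right_zero integrable_std_normal_power i1 Bochner_Integration.integrable_diff integrable_mult_right)
  also have "\<dots> = 2" using prob_space by (simp only: std_normal_moments, simp)
  finally show "(\<integral>z. (z\<^sup>2 - 1)\<^sup>2 \<partial>std_normal_distribution) = 2" unfolding eq .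
qed

definition chi_third_moment :: real where
  "chi_third_moment = (\<integral>z. \<bar>z\<^sup>2 - 1\<bar> ^ 3 \<partial>std_normal_distribution)"

lemma integrable_chi_third: "integrable std_normal_distribution (\<lambda>z. \<bar>z\<^sup>2 - 1\<bar> ^ 3)"
proof -
  interpret prob_space std_normal_distribution by (rule prob_space_std_normal)
  have i1: "integrable std_normal_distribution (\<lambda>z. 1)" by simp
  have eq: "(z\<^sup>2 + 1) ^ 3 = z ^ 6 + 3 * z ^ 4 + 3 * z ^ 2 + 1" for z :: real
    by (simp add: power2_eq_square eval_nat_numeral algebra_simps)
  have i: "integrable std_normal_distribution (\<lambda>z. (z\<^sup>2 + 1) ^ 3)"
    unfolding eq by (intro Bochner_Integration.integrable_add
        integrable_mult_right integrable_std_normal_power i1)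
  have le: "\<bar>z\<^sup>2 - 1\<bar> ^ 3 \<le> \<bar>(z\<^sup>2 + 1) ^ 3\<bar>" for z :: real
    unfolding power_abs by (intro power_mono) (auto simp: abs_if not_less add_nonneg_nonneg)
  show ?thesis
    by (rule Bochner_Integration.integrable_bound[OF i]) (use le in auto)
qed

text \<open>Third-order Taylor estimate: the mean is \<open>0\<close>, the variance is
  \<open>2 * w^2\<close>, and the remainder is controlled by the third absolute moment. The cubic
  order in \<open>w\<close> matters, because the sum of the cubes is at most \<open>\<rho>\<close>
  times the sum of the squares.\<close>

lemma char_chi_square_approx:
  fixes w t :: real
  assumes "w \<ge> 0"
  shows "cmod (char (distr std_normal_distribution borel (\<lambda>z. w * (z\<^sup>2 - 1))) t - (1 - t\<^sup>2 * w\<^sup>2)) \<le>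
    \<bar>t\<bar> ^ 3 * chi_third_moment / 6 * w ^ 3"
proof -
  interpret prob_space std_normal_distribution by (rule prob_space_std_normal)
  let ?X = "\<lambda>z::real. w * (z\<^sup>2 - 1)"
  have i1: "integrable std_normal_distribution (\<lambda>z. z\<^sup>2 - 1)"
    by (intro Bochner_Integration.integrable_diff integrable_std_normal_power) simp
  have i: "integrable std_normal_distribution ?X" by (rule integrable_mult_right[OF i1])
  have sq: "(?X z)\<^sup>2 = w\<^sup>2 * (z\<^sup>2 - 1)\<^sup>2" for z by (simp add: power_mult_distrib)
  have i2: "integrable std_normal_distribution (\<lambda>z. (?X z)\<^sup>2)"
    unfolding sq by (rule integrable_mult_right[OF std_normal_chi_square(2)])
  have e: "expectation ?X = 0" using std_normal_chi_square(1) by simp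
  have v: "variance ?X = 2 * w\<^sup>2"
    unfolding e by (simp only: diff_0_right sq integral_mult_right_zero std_normal_chi_square(3))
  have c: "\<bar>t\<bar> * \<bar>?X z\<bar> ^ 3 = \<bar>t\<bar> * w ^ 3 * \<bar>z\<^sup>2 - 1\<bar> ^ 3" for z
    using assms by (simp add: abs_mult power_mult_distrib)
  have i3: "integrable std_normal_distribution (\<lambda>z. \<bar>t\<bar> * \<bar>?X z\<bar> ^ 3)"
    unfolding c by (rule integrable_mult_right[OF integrable_chi_third])
  have i6: "integrable std_normal_distribution (\<lambda>z. 6 * (?X z)\<^sup>2)"
    by (rule integrable_mult_right[OF i2])
  have "cmod (char (distr std_normal_distribution borel ?X) t - (1 - t^2 * (2 * w\<^sup>2) / 2)) \<le>
    (t^2 / 6) * expectation (\<lambda>x. min (6 * (?X x)^2) (\<bar>t\<bar> * \<bar>?X x\<bar>^3))"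
    by (rule char_approx3'[OF _ i i2 e v refl]) simp
  also have "\<dots> \<le> (t^2 / 6) * expectation (\<lambda>x. \<bar>t\<bar> * \<bar>?X x\<bar>^3)"
    by (intro mult_left_mono integral_mono Bochner_Integration.integrable_min i3 i6) auto
  also have "\<dots> = (t^2 / 6) * (\<bar>t\<bar> * w ^ 3 * chi_third_moment)"
    unfolding c chi_third_moment_def by (simp only: integral_mult_right_zero)
  also have "\<dots> = \<bar>t\<bar> ^ 3 * chi_third_moment / 6 * w ^ 3"
  proof -
    have "\<bar>t\<bar> ^ 3 = \<bar>t\<bar> * \<bar>t\<bar>\<^sup>2" by (simp only: power3_eq_cube power2_eq_square mult.assoc)
    thus ?thesis by simp
  qed
  finally show ?thesis by simp
qed

lemma abs_exp_minus_approx: fixes y :: real assumes "y \<ge> 0" shows "\<bar>(1 - y) - exp (- y)\<bar> \<le> y\<^sup>2"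
proof -
  \<comment> \<open>From \<open>(1 - y + y^2) * (1 + y) = 1 + y^3\<close> and
    \<open>1 + y \<le> exp y\<close> one gets \<open>1 \<le> (1 - y + y^2) * exp y\<close>, the
    upper half of the claim.\<close>
  have "1 * 1 \<le> (1 + y * y * y)" using assms by simp
  also have "\<dots> = (1 - y + y\<^sup>2) * (1 + y)" by (simp add: power2_eq_square algebra_simps)
  also have "\<dots> \<le> (1 - y + y\<^sup>2) * exp y"
  proof (intro mult_left_mono)
    have "0 \<le> (1 - y / 2)\<^sup>2 + 3 / 4 * y\<^sup>2" by simp
    also have "\<dots> = 1 - y + y\<^sup>2" by (simp add: power2_eq_square algebra_simps)
    finally show "0 \<le> 1 - y + y\<^sup>2" .
  qed (rule exp_ge_add_one_self)
  finally have "exp (- y) \<le> 1 - y + y\<^sup>2" by (simp add: exp_minus field_simps)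
  moreover have "1 - y \<le> exp (- y)" using exp_ge_add_one_self[of "- y"] by simp
  ultimately show ?thesis by linarith
qed

text \<open>As the squared weights sum to \<open>1 / 2\<close>, the normal characteristic function
  \<open>exp (- t^2 / 2)\<close> splits into the factors \<open>exp (- t^2 * (w k)^2)\<close>. Two
  products of numbers of modulus at most \<open>1\<close> differ by at most the sum of the
  differences of their factors, and each difference is of order
  \<open>\<rho> * (w k)^2\<close>.\<close>

lemma char_chi_square_sum_approx:
  assumes fw: "flat_weights I \<rho> K w" and "\<rho> \<le> 1"
  shows "cmod (char (distr (gauss I) borel (\<lambda>x. \<Sum>k\<in>K. w k * ((x k)\<^sup>2 - 1))) t - char std_normal_distribution t) \<le>
    (\<bar>t\<bar> ^ 3 * chi_third_moment / 6 + t ^ 4) * (\<rho> / 2)"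
proof -
  interpret prob_space "gauss I" by (rule prob_space_gauss)
  have K: "finite K" "K \<subseteq> I" and w0: "\<And>k. k \<in> K \<Longrightarrow> 0 \<le> w k" and w1: "\<And>k. k \<in> K \<Longrightarrow> w k \<le> \<rho>"
    and sw: "(\<Sum>k\<in>K. (w k)\<^sup>2) = 1 / 2"
    using fw by (auto simp: flat_weights_def)
  define C where "C = \<bar>t\<bar> ^ 3 * chi_third_moment / 6"
  have C0: "C \<ge> 0" unfolding C_def chi_third_moment_def by simp
  let ?\<mu> = "\<lambda>k. distr (gauss I) borel (\<lambda>x. w k * ((x k)\<^sup>2 - 1))"
  have \<mu>: "?\<mu> k = distr std_normal_distribution borel (\<lambda>z. w k * (z\<^sup>2 - 1))" if "k \<in> K" for k
  proof -
    have "k \<in> I" using that K by auto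
    have "?\<mu> k = distr (distr (gauss I) borel (\<lambda>x. x k)) borel (\<lambda>z. w k * (z\<^sup>2 - 1))"
      using \<open>k \<in> I\<close> by (subst distr_distr) (auto simp: o_def)
    thus ?thesis by (simp only: gauss_component[OF \<open>k \<in> I\<close>])
  qed
  have "char (distr (gauss I) borel (\<lambda>x. \<Sum>k\<in>K. w k * ((x k)\<^sup>2 - 1))) t = (\<Prod>k\<in>K. char (?\<mu> k) t)"
    by (intro char_distr_sum indep_vars_gauss[where g = "\<lambda>k z. w k * (z\<^sup>2 - 1)"]) (use K in auto)
  moreover have "char std_normal_distribution t = (\<Prod>k\<in>K. complex_of_real (exp (- (t\<^sup>2 * (w k)\<^sup>2))))"
  proof -
    have "(\<Prod>k\<in>K. exp (- (t\<^sup>2 * (w k)\<^sup>2))) = exp (- (t\<^sup>2 * (\<Sum>k\<in>K. (w k)\<^sup>2)))"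
      using K by (simp add: exp_sum[symmetric] sum_negf sum_distrib_left)
    thus ?thesis unfolding of_real_prod[symmetric] by (simp add: sw char_std_normal_distribution)
  qed
  ultimately have "cmod (char (distr (gauss I) borel (\<lambda>x. \<Sum>k\<in>K. w k * ((x k)\<^sup>2 - 1))) t - char std_normal_distribution t)
    = cmod ((\<Prod>k\<in>K. char (?\<mu> k) t) - (\<Prod>k\<in>K. complex_of_real (exp (- (t\<^sup>2 * (w k)\<^sup>2)))))" by simp
  also have "\<dots> \<le> (\<Sum>k\<in>K. cmod (char (?\<mu> k) t - complex_of_real (exp (- (t\<^sup>2 * (w k)\<^sup>2)))))"
  proof (intro norm_prod_diff)
    fix k assume "k \<in> K"
    hence k: "k \<in> I" using K by auto
    interpret \<mu>: real_distribution "?\<mu> k" by (rule real_distribution_distr) (use k in measurable)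
    show "cmod (char (?\<mu> k) t) \<le> 1" by (rule \<mu>.cmod_char_le_1)
  qed auto
  also have "\<dots> \<le> (\<Sum>k\<in>K. (C + t ^ 4) * \<rho> * (w k)\<^sup>2)"
  proof (intro sum_mono)
    fix k assume k: "k \<in> K"
    let ?y = "t\<^sup>2 * (w k)\<^sup>2"
    have "cmod (char (?\<mu> k) t - complex_of_real (exp (- ?y))) \<le>
      cmod (char (?\<mu> k) t - (1 - complex_of_real ?y)) + cmod (1 - complex_of_real ?y - complex_of_real (exp (- ?y)))"
      using norm_triangle_ineq[of "char (?\<mu> k) t - (1 - complex_of_real ?y)"
          "1 - complex_of_real ?y - complex_of_real (exp (- ?y))"] by simp
    also have "cmod (char (?\<mu> k) t - (1 - complex_of_real ?y)) \<le> C * w k ^ 3"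
      unfolding \<mu>[OF k] C_def using char_chi_square_approx[of "w k" t] w0[OF k] by simp
    also have "cmod (1 - complex_of_real ?y - complex_of_real (exp (- ?y))) = \<bar>(1 - ?y) - exp (- ?y)\<bar>"
      by (metis norm_of_real of_real_1 of_real_diff)
    also have "\<dots> \<le> ?y\<^sup>2" by (rule abs_exp_minus_approx) simp
    also have "?y\<^sup>2 = t ^ 4 * w k ^ 4" by (simp add: power_mult_distrib flip: power_mult)
    also have "w k ^ 3 = w k * (w k)\<^sup>2" by (simp add: eval_nat_numeral)
    also have "w k ^ 4 = (w k * w k) * (w k)\<^sup>2" by (simp add: eval_nat_numeral)
    also have "C * (w k * (w k)\<^sup>2) + t ^ 4 * (w k * w k * (w k)\<^sup>2) \<le> C * (\<rho> * (w k)\<^sup>2) + t ^ 4 * (\<rho> * (w k)\<^sup>2)"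
    proof (intro add_mono mult_left_mono mult_right_mono C0 w1[OF k])
      have "w k * w k \<le> \<rho> * 1" using w0[OF k] w1[OF k] assms(2) by (intro mult_mono) auto
      thus "w k * w k \<le> \<rho>" by simp
    qed auto
    finally show "cmod (char (?\<mu> k) t - complex_of_real (exp (- ?y))) \<le> (C + t ^ 4) * \<rho> * (w k)\<^sup>2"
      by (simp add: algebra_simps)
  qed
  also have "\<dots> = (C + t ^ 4) * (\<rho> / 2)" by (simp add: sum_distrib_left[symmetric] sw)
  finally show ?thesis by (simp add: C_def)
qed

text \<open>Uniformity in the weights and in the threshold is obtained by contradiction:
  counterexamples for the bounds \<open>1 / (n + 1)\<close> form a sequence to which Levy's theorem
  applies, and uniform convergence of the distribution functions copes with thresholds that vary
  with \<open>n\<close>.\<close>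

theorem chi_square_clt:
  assumes "\<eta> > 0"
  shows "\<exists>\<rho>>0. \<forall>K w. flat_weights I \<rho> K w \<longrightarrow>
    (\<forall>x. \<bar>measure (gauss I) {z \<in> space (gauss I). (\<Sum>k\<in>K. w k * ((z k)\<^sup>2 - 1)) \<le> x} - \<Phi> x\<bar> \<le> \<eta>)"
proof (rule ccontr)
  interpret prob_space "gauss I" by (rule prob_space_gauss)
  let ?T = "\<lambda>K w z. \<Sum>k\<in>K. w k * ((z k)\<^sup>2 - 1)"
  assume neg: "\<not> ?thesis"
  define P where "P n K w x \<longleftrightarrow> flat_weights I (1 / real (Suc n)) K w \<and>
    \<not> \<bar>measure (gauss I) {z \<in> space (gauss I). ?T K w z \<le> x} - \<Phi> x\<bar> \<le> \<eta>" for n K w x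
  have "\<exists>K w x. P n K w x" for n
  proof (rule ccontr)
    assume "\<not> (\<exists>K w x. P n K w x)"
    moreover have "1 / real (Suc n) > 0" by simp
    ultimately show False using neg unfolding P_def by blast
  qed
  then obtain K w x where P: "\<And>n. P n (K n) (w n) (x n)" by metis
  have fw: "\<And>n. flat_weights I (1 / real (Suc n)) (K n) (w n)"
    and bad: "\<And>n. \<not> \<bar>measure (gauss I) {z \<in> space (gauss I). ?T (K n) (w n) z \<le> x n} - \<Phi> (x n)\<bar> \<le> \<eta>"
    using P unfolding P_def by blast+
  define \<mu> where "\<mu> n = distr (gauss I) borel (?T (K n) (w n))" for n
  have m: "?T (K n) (w n) \<in> borel_measurable (gauss I)" for n
    using fw[of n] by (intro borel_measurable_sum) (auto simp: flat_weights_def)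
  have rd: "real_distribution (\<mu> n)" for n unfolding \<mu>_def by (rule real_distribution_distr[OF m])
  have "(\<lambda>n. char (\<mu> n) t) \<longlonglongrightarrow> char std_normal_distribution t" for t
  proof -
    let ?C = "\<bar>t\<bar> ^ 3 * chi_third_moment / 6 + t ^ 4"
    have "\<forall>\<^sub>F n in sequentially. norm (char (\<mu> n) t - char std_normal_distribution t) \<le> ?C / 2 * (1 / real (Suc n))"
    proof (rule always_eventually, rule)
      fix n
      have "1 / real (Suc n) \<le> 1" by simp
      from char_chi_square_sum_approx[OF fw this, of t]
      show "norm (char (\<mu> n) t - char std_normal_distribution t) \<le> ?C / 2 * (1 / real (Suc n))"
        by (simp add: \<mu>_def mult.commute)
    qed
    moreover have "(\<lambda>n. ?C / 2 * (1 / real (Suc n))) \<longlonglongrightarrow> ?C / 2 * 0"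
      using LIMSEQ_inverse_real_of_nat by (intro tendsto_mult tendsto_const) (simp add: inverse_eq_divide)
    hence "(\<lambda>n. ?C / 2 * (1 / real (Suc n))) \<longlonglongrightarrow> 0" by simp
    ultimately have "(\<lambda>n. char (\<mu> n) t - char std_normal_distribution t) \<longlonglongrightarrow> 0"
      by (rule Lim_null_comparison)
    thus ?thesis by (simp add: LIM_zero_iff)
  qed
  hence "weak_conv_m \<mu> std_normal_distribution"
    by (intro levy_continuity rd real_dist_normal_dist)
  from weak_conv_imp_uniform_cdf[OF rd this assms] obtain n where
    n: "\<forall>x. \<bar>cdf (\<mu> n) x - \<Phi> x\<bar> \<le> \<eta>" by (auto simp: eventually_sequentially)
  have "cdf (\<mu> n) (x n) = measure (gauss I) {z \<in> space (gauss I). ?T (K n) (w n) z \<le> x n}"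
    unfolding cdf_def \<mu>_def by (subst measure_distr[OF m]) (auto intro!: arg_cong[where f = "measure _"])
  with n[rule_format, of "x n"] bad[of n] show False by simp
qed

section \<open>Error probabilities of the weighted chi-square test\<close>

text \<open>The shift turns the statistic \<open>T\<close> into \<open>T + W + m\<close> with a mean
  \<open>m \<ge> 0\<close> and a linear term \<open>W\<close> of variance at most
  \<open>4 * \<rho> * m\<close>. By Chebyshev \<open>W\<close> rarely exceeds
  \<open>\<tau> * (1 + m)\<close>. For moderate \<open>m\<close> such a displacement changes
  \<open>\<Phi>\<close> little; for large \<open>m\<close> the probability is already
  negligible.\<close>

lemma shifted_chi_square_upper_bound:
  assumes "\<eta> > 0"
  shows "\<exists>\<rho>>0. \<forall>K w v h. flat_weights I \<rho> K w \<longrightarrow> \<bar>h\<bar> \<le> B \<longrightarrow>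
    measure (gauss I) {z \<in> space (gauss I). (\<Sum>k\<in>K. w k * ((z k + v k)\<^sup>2 - 1)) \<le> h} \<le>
      \<Phi> (h - (\<Sum>k\<in>K. w k * (v k)\<^sup>2)) + \<eta>"
proof -
  interpret N: prob_space "gauss I" by (rule prob_space_gauss)
  obtain x0 where x0: "\<Phi> x0 < \<eta> / 3"
    using order_tendstoD(2)[OF Phi_at_bot, of "\<eta> / 3"] assms by (auto simp: eventually_at_bot_linorder)
  \<comment> \<open>With \<open>\<tau> \<le> 1 / 2\<close>, the displaced threshold
    \<open>h - m + \<tau> * (1 + m)\<close> is at most \<open>B + 1 - m / 2\<close>, hence at most
    \<open>x0\<close> as soon as \<open>m\<close> exceeds \<open>m0\<close>.\<close>
  define m0 where "m0 = max 0 (2 * (B + 1 - x0))"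
  define \<tau> where "\<tau> = min (1 / 2) (\<eta> / (3 * (1 + m0)))"
  have "2 * (B + 1 - x0) \<le> m0" by (simp add: m0_def)
  moreover have "m0 \<ge> 0" by (simp add: m0_def)
  ultimately have m0: "m0 \<ge> 0" "B + 1 - m0 / 2 \<le> x0" by auto
  have \<tau>: "\<tau> > 0" "\<tau> \<le> 1 / 2" "\<tau> * (1 + m0) \<le> \<eta> / 3"
  proof -
    show "\<tau> > 0" using assms m0 by (auto simp: \<tau>_def)
    show "\<tau> \<le> 1 / 2" unfolding \<tau>_def by (rule min.cobounded1)
    have "\<tau> * (1 + m0) \<le> \<eta> / (3 * (1 + m0)) * (1 + m0)"
      using m0 by (intro mult_right_mono) (auto simp: \<tau>_def)
    also have "\<dots> = \<eta> / 3" using m0 by (simp add: divide_simps)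
    finally show "\<tau> * (1 + m0) \<le> \<eta> / 3" .
  qed
  obtain \<rho>1 where \<rho>1: "\<rho>1 > 0" "\<And>K w x. flat_weights I \<rho>1 K w \<Longrightarrow>
    \<bar>N.prob {z \<in> space (gauss I). (\<Sum>k\<in>K. w k * ((z k)\<^sup>2 - 1)) \<le> x} - \<Phi> x\<bar> \<le> \<eta> / 3"
    using chi_square_clt[of "\<eta> / 3" I] assms by fastforce
  \<comment> \<open>The \<open>12\<close> makes the Chebyshev bound
    \<open>4 * \<rho> / \<tau>^2\<close> for the linear term at most
    \<open>\<eta> / 3\<close>.\<close>
  define \<rho> where "\<rho> = min \<rho>1 (\<eta> * \<tau>\<^sup>2 / 12)"
  have \<rho>: "\<rho> > 0" "\<rho> \<le> \<rho>1" "\<rho> \<le> \<eta> * \<tau>\<^sup>2 / 12" using \<rho>1 assms \<tau> by (auto simp: \<rho>_def)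
  show ?thesis
  proof (intro exI conjI allI impI)
    show "\<rho> > 0" by fact
    fix K w v and h :: real assume fw: "flat_weights I \<rho> K w" and h: "\<bar>h\<bar> \<le> B"
    have K: "finite K" "K \<subseteq> I" and w0: "\<And>k. k \<in> K \<Longrightarrow> 0 \<le> w k" and w1: "\<And>k. k \<in> K \<Longrightarrow> w k \<le> \<rho>"
      using fw by (auto simp: flat_weights_def)
    define m where "m = (\<Sum>k\<in>K. w k * (v k)\<^sup>2)"
    have m: "m \<ge> 0" unfolding m_def using w0 by (intro sum_nonneg) auto
    let ?T = "\<lambda>z. \<Sum>k\<in>K. w k * ((z k)\<^sup>2 - 1)"
    let ?g = "\<lambda>k z. 2 * w k * v k * z"
    let ?W = "\<lambda>z. \<Sum>k\<in>K. ?g k (z k)"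
    define \<tau>' where "\<tau>' = \<tau> * (1 + m)"
    have \<tau>': "\<tau>' > 0" using \<tau> m by (auto simp: \<tau>'_def intro!: mult_pos_pos)
    have KI: "k \<in> K \<Longrightarrow> k \<in> I" for k using K by auto
    have mT: "?T \<in> borel_measurable (gauss I)" and mW: "?W \<in> borel_measurable (gauss I)"
      using KI by measurable
    have sets: "{z \<in> space (gauss I). ?T z \<le> x} \<in> N.events" "{z \<in> space (gauss I). \<tau>' \<le> \<bar>?W z\<bar>} \<in> N.events" for x
      by (rule borel_measurable_le[OF mT borel_measurable_const],
          rule borel_measurable_le[OF borel_measurable_const borel_measurable_abs[OF mW]])
    have T_eq: "(\<Sum>k\<in>K. w k * ((z k + v k)\<^sup>2 - 1)) = ?T z + ?W z + m" for z
      unfolding m_def sum.distrib[symmetric]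
      by (intro sum.cong) (auto simp: power2_eq_square algebra_simps)
    have Wsq: "(\<lambda>z::real. (?g k z)\<^sup>2) = (\<lambda>z. 4 * (w k)\<^sup>2 * (v k)\<^sup>2 * z ^ 2)" for k
      by (simp add: power_mult_distrib)
    have "N.prob {z \<in> space (gauss I). \<tau>' \<le> \<bar>?W z\<bar>} \<le>
      (\<Sum>k\<in>K. \<integral>z. (?g k z)\<^sup>2 \<partial>std_normal_distribution) / \<tau>'\<^sup>2"
    proof (rule gauss_Chebyshev_sum[OF K _ _ _ \<tau>'])
      fix k
      show "integrable std_normal_distribution (\<lambda>z. (?g k z)\<^sup>2)"
        unfolding Wsq by (intro integrable_mult_right integrable_std_normal_power)
      show "(\<integral>z. ?g k z \<partial>std_normal_distribution) = 0"
        using integral_std_normal_distribution_moment_odd[of 1] by simp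
    qed simp
    also have "(\<Sum>k\<in>K. \<integral>z. (?g k z)\<^sup>2 \<partial>std_normal_distribution) = (\<Sum>k\<in>K. 4 * (w k)\<^sup>2 * (v k)\<^sup>2)"
      unfolding Wsq by (simp only: integral_mult_right_zero std_normal_moments mult_1_right)
    also have "\<dots> \<le> (\<Sum>k\<in>K. 4 * \<rho> * (w k * (v k)\<^sup>2))"
    proof (intro sum_mono)
      fix k assume k: "k \<in> K"
      have "w k * (4 * (w k * (v k)\<^sup>2)) \<le> \<rho> * (4 * (w k * (v k)\<^sup>2))"
        using w0[OF k] w1[OF k] by (intro mult_right_mono) auto
      thus "4 * (w k)\<^sup>2 * (v k)\<^sup>2 \<le> 4 * \<rho> * (w k * (v k)\<^sup>2)"
        by (simp add: power2_eq_square mult_ac)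
    qed
    also have "\<dots> = 4 * \<rho> * m" by (simp add: m_def sum_distrib_left)
    also have "4 * \<rho> * m / \<tau>'\<^sup>2 \<le> 4 * \<rho> / \<tau>\<^sup>2"
    proof -
      have "m \<le> (1 + m)\<^sup>2" using m by (simp add: power2_eq_square algebra_simps)
      hence "4 * \<rho> / \<tau>\<^sup>2 * (m / (1 + m)\<^sup>2) \<le> 4 * \<rho> / \<tau>\<^sup>2 * 1"
        using \<rho> m by (intro mult_left_mono) (auto simp: divide_le_eq_1)
      thus ?thesis by (simp add: \<tau>'_def power_mult_distrib)
    qed
    also have "\<dots> \<le> \<eta> / 3" using \<rho>(3) \<tau>(1) by (simp add: field_simps)
    finally have W: "N.prob {z \<in> space (gauss I). \<tau>' \<le> \<bar>?W z\<bar>} \<le> \<eta> / 3"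
      by (simp add: divide_right_mono)
    have "N.prob {z \<in> space (gauss I). (\<Sum>k\<in>K. w k * ((z k + v k)\<^sup>2 - 1)) \<le> h} \<le>
      N.prob ({z \<in> space (gauss I). ?T z \<le> h - m + \<tau>'} \<union> {z \<in> space (gauss I). \<tau>' \<le> \<bar>?W z\<bar>})"
    proof (rule N.finite_measure_mono)
      have "t \<le> h - m + \<tau>' \<or> \<tau>' \<le> \<bar>r\<bar>" if "t + r + m \<le> h" for t r
        using that by linarith
      thus "{z \<in> space (gauss I). (\<Sum>k\<in>K. w k * ((z k + v k)\<^sup>2 - 1)) \<le> h} \<subseteq>
        {z \<in> space (gauss I). ?T z \<le> h - m + \<tau>'} \<union> {z \<in> space (gauss I). \<tau>' \<le> \<bar>?W z\<bar>}"
        unfolding T_eq by blast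
    qed (rule sets.Un[OF sets])
    also have "\<dots> \<le> N.prob {z \<in> space (gauss I). ?T z \<le> h - m + \<tau>'} + N.prob {z \<in> space (gauss I). \<tau>' \<le> \<bar>?W z\<bar>}"
      by (rule measure_Un_le[OF sets])
    also have "\<dots> \<le> (\<Phi> (h - m + \<tau>') + \<eta> / 3) + \<eta> / 3"
      using \<rho>1(2)[OF flat_weights_mono[OF fw \<rho>(2)], of "h - m + \<tau>'"] W by linarith
    also have "\<Phi> (h - m + \<tau>') \<le> \<Phi> (h - m) + \<eta> / 3"
    proof (cases "m \<le> m0")
      case True
      hence "\<tau>' \<le> \<tau> * (1 + m0)" using \<tau> by (simp add: \<tau>'_def)
      thus ?thesis using Phi_Lipschitz_le[of "h - m" "h - m + \<tau>'"] \<tau> \<tau>' by simp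
    next
      case False
      have "\<tau> * (1 + m) \<le> 1 / 2 * (1 + m)" using \<tau> m by (intro mult_right_mono) auto
      hence "h - m + \<tau>' \<le> B + 1 - m0 / 2" using abs_le_D1[OF h] False unfolding \<tau>'_def by argo
      hence "\<Phi> (h - m + \<tau>') \<le> \<Phi> x0" using m0 by (intro Phi_mono) simp
      thus ?thesis using x0 Phi_nonneg[of "h - m"] by linarith
    qed
    finally show "N.prob {z \<in> space (gauss I). (\<Sum>k\<in>K. w k * ((z k + v k)\<^sup>2 - 1)) \<le> h} \<le>
      \<Phi> (h - (\<Sum>k\<in>K. w k * (v k)\<^sup>2)) + \<eta>" by (simp add: m_def)
  qed
qed

text \<open>Layer-cake comparison: the superlevel sets of the integrand are intervals.\<close>

lemma truncated_exp_integral_lower_bound: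
  assumes "real_distribution \<nu>" and close: "\<And>x. \<bar>cdf \<nu> x - \<Phi> x\<bar> \<le> \<eta>" and u: "u \<ge> 0"
  shows "ennreal (\<Phi> (H - u)) \<le>
    (\<integral>\<^sup>+x. ennreal (exp (u * x - u\<^sup>2 / 2)) * indicator {..H} x \<partial>\<nu>) + ennreal (2 * \<eta> * exp (u * H - u\<^sup>2 / 2))"
proof -
  define c where "c = exp (u * H - u\<^sup>2 / 2)"
  \<comment> \<open>Under the standard normal law \<open>g\<close> integrates to
    \<open>\<Phi> (H - u)\<close> by \<open>std_normal_shift\<close>. The claim is therefore that
    passing to \<open>\<nu>\<close> costs at most \<open>2 * \<eta>\<close> times the maximum
    \<open>c\<close> of \<open>g\<close>.\<close>
  define g where "g x = exp (u * x - u\<^sup>2 / 2) * indicator {..H} x" for x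
  have [measurable]: "g \<in> borel_measurable borel" unfolding g_def by measurable
  have gs: "{x. s < g x} \<in> sets borel" for s
  proof -
    have "{x \<in> space borel. s < g x} \<in> sets borel"
      by (rule borel_measurable_less[OF borel_measurable_const \<open>g \<in> borel_measurable borel\<close>])
    thus ?thesis by (simp only: space_borel UNIV_I simp_thms)
  qed
  interpret \<nu>: real_distribution \<nu> by fact
  interpret G: real_distribution std_normal_distribution by (rule real_dist_normal_dist)
  have g_le: "g x \<le> c" for x
    using u by (auto simp: g_def c_def indicator_def intro: mult_left_mono)
  have g0: "0 \<le> g x" for x by (simp add: g_def)
  have \<eta>0: "\<eta> \<ge> 0" using close[of 0] by linarith
  have cake: "(\<integral>\<^sup>+x. ennreal (g x) \<partial>\<mu>) = (\<integral>\<^sup>+s. emeasure \<mu> {x. s < g x} * indicator {0<..<c} s \<partial>lborel)"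
    if "real_distribution \<mu>" for \<mu>
  proof -
    interpret \<mu>: real_distribution \<mu> by fact
    interpret pair_sigma_finite \<mu> lborel ..
    have "ennreal (g x) = (\<integral>\<^sup>+s. indicator {s. s < g x} s * indicator {0<..<c} s \<partial>lborel)" for x
    proof -
      have "(\<integral>\<^sup>+s. indicator {s. s < g x} s * indicator {0<..<c} s \<partial>lborel) = (\<integral>\<^sup>+s. indicator {0<..<g x} s \<partial>lborel)"
        using g_le[of x] by (intro nn_integral_cong) (auto simp: indicator_def)
      also have "\<dots> = ennreal (g x)" using g0[of x] by simp
      finally show ?thesis by simp
    qed
    hence "(\<integral>\<^sup>+x. ennreal (g x) \<partial>\<mu>) = (\<integral>\<^sup>+x. \<integral>\<^sup>+s. indicator {s. s < g x} s * indicator {0<..<c} s \<partial>lborel \<partial>\<mu>)"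
      by simp
    also have "\<dots> = (\<integral>\<^sup>+s. \<integral>\<^sup>+x. indicator {s. s < g x} s * indicator {0<..<c} s \<partial>\<mu> \<partial>lborel)"
    proof (rule Fubini'[symmetric])
      show "(\<lambda>(x, s). indicator {s. s < g x} s * indicator {0<..<c} s :: ennreal) \<in> borel_measurable (\<mu> \<Otimes>\<^sub>M lborel)"
      proof -
        let ?P = "\<mu> \<Otimes>\<^sub>M lborel"
        have g1: "(\<lambda>p. g (fst p)) \<in> borel_measurable ?P"
          by (rule measurable_compose[OF measurable_fst]) (use \<open>g \<in> borel_measurable borel\<close> in \<open>simp only: measurable_cong_sets[OF \<mu>.events_eq_borel refl]\<close>)
        have s1: "snd \<in> borel_measurable ?P"
          using measurable_snd[of \<mu> lborel] by (simp only: measurable_cong_sets[OF refl sets_lborel])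
        have A: "{p \<in> space ?P. snd p < g (fst p)} \<in> sets ?P" by (rule borel_measurable_less[OF s1 g1])
        have B: "(\<lambda>p. indicator {0<..<c} (snd p) :: ennreal) \<in> borel_measurable ?P"
          by (rule measurable_compose[OF s1]) simp
        have "(\<lambda>p. indicator {p \<in> space ?P. snd p < g (fst p)} p * indicator {0<..<c} (snd p) :: ennreal)
          \<in> borel_measurable ?P"
          by (rule borel_measurable_times_ennreal[OF borel_measurable_indicator[OF A] B])
        thus ?thesis by (rule measurable_cong[THEN iffD1, rotated]) (auto simp: indicator_def)
      qed
    qed
    also have "\<dots> = (\<integral>\<^sup>+s. emeasure \<mu> {x. s < g x} * indicator {0<..<c} s \<partial>lborel)"
    proof (intro nn_integral_cong)
      fix s
      have "(\<integral>\<^sup>+x. indicator {s. s < g x} s * indicator {0<..<c} s \<partial>\<mu>) =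
        (\<integral>\<^sup>+x. indicator {x. s < g x} x * indicator {0<..<c} s \<partial>\<mu>)"
        by (intro nn_integral_cong) (auto simp: indicator_def)
      also have "\<dots> = emeasure \<mu> {x. s < g x} * indicator {0<..<c} s"
        using gs[of s] unfolding \<mu>.events_eq_borel[symmetric]
        by (simp only: nn_integral_multc borel_measurable_indicator nn_integral_indicator)
      finally show "(\<integral>\<^sup>+x. indicator {s. s < g x} s * indicator {0<..<c} s \<partial>\<mu>) =
        emeasure \<mu> {x. s < g x} * indicator {0<..<c} s" .
    qed
    finally show ?thesis .
  qed
  \<comment> \<open>The probability of an interval involves two values of the distribution function,
    hence \<open>2 * \<eta>\<close>. For \<open>u = 0\<close> the integrand is constant on its
    half-line and only one value occurs.\<close>
  have level: "measure std_normal_distribution {x. s < g x} \<le> measure \<nu> {x. s < g x} + 2 * \<eta>" if s: "s \<in> {0<..<c}" for s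
  proof (cases "u = 0")
    case True
    have eq: "{x. s < g x} = {..H}" using s True by (auto simp: g_def c_def indicator_def)
    show ?thesis using close[of H] \<eta>0 unfolding eq \<Phi>_def cdf_def by linarith
  next
    case False
    define x0 where "x0 = (ln s + u\<^sup>2 / 2) / u"
    have iff: "s < exp (u * x - u\<^sup>2 / 2) \<longleftrightarrow> x0 < x" for x
    proof -
      have "s < exp (u * x - u\<^sup>2 / 2) \<longleftrightarrow> ln s < u * x - u\<^sup>2 / 2"
        using s by (metis exp_less_cancel_iff exp_ln greaterThanLessThan_iff)
      also have "\<dots> \<longleftrightarrow> x0 < x" using u False by (auto simp: x0_def field_simps)
      finally show ?thesis .
    qed
    have "s < g x \<longleftrightarrow> x0 < x \<and> x \<le> H" for x
      by (cases "x \<le> H") (use iff[of x] s in \<open>simp_all add: g_def\<close>)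
    hence eq: "{x. s < g x} = {x0<..H}" by (simp add: set_eq_iff)
    have "x0 < H" using s iff[of H] by (simp add: c_def)
    have 1: "measure std_normal_distribution {x0<..H} = \<Phi> H - \<Phi> x0"
      using Phi_interval[of x0 H] \<open>x0 < H\<close> by simp
    have 2: "measure \<nu> {x0<..H} = cdf \<nu> H - cdf \<nu> x0"
      using \<nu>.cdf_diff_eq[of x0 H] \<open>x0 < H\<close> by simp
    show ?thesis unfolding eq 1 2 using close[of H] close[of x0] by linarith
  qed
  have "(\<integral>\<^sup>+x. ennreal (g x) \<partial>std_normal_distribution) = emeasure std_normal_distribution {z. z + u \<in> {..H}}"
    by (subst std_normal_shift[symmetric], simp, intro nn_integral_cong) (simp add: g_def indicator_def)
  also have "{z. z + u \<in> {..H}} = {..H - u}" by auto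
  also have "emeasure std_normal_distribution {..H - u} = ennreal (\<Phi> (H - u))"
    by (simp add: G.emeasure_eq_measure \<Phi>_def cdf_def)
  finally have "ennreal (\<Phi> (H - u)) = (\<integral>\<^sup>+s. emeasure std_normal_distribution {x. s < g x} * indicator {0<..<c} s \<partial>lborel)"
    by (simp add: cake[OF real_dist_normal_dist])
  also have "\<dots> \<le> (\<integral>\<^sup>+s. emeasure \<nu> {x. s < g x} * indicator {0<..<c} s + ennreal (2 * \<eta>) * indicator {0<..<c} s \<partial>lborel)"
  proof (intro nn_integral_mono)
    fix s
    have "s \<in> {0<..<c} \<Longrightarrow> emeasure std_normal_distribution {x. s < g x} \<le> emeasure \<nu> {x. s < g x} + ennreal (2 * \<eta>)"
      using ennreal_leI[OF level[of s]] \<eta>0 unfolding G.emeasure_eq_measure \<nu>.emeasure_eq_measure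
      by (subst (asm) ennreal_plus) auto
    thus "emeasure std_normal_distribution {x. s < g x} * indicator {0<..<c} s \<le>
      emeasure \<nu> {x. s < g x} * indicator {0<..<c} s + ennreal (2 * \<eta>) * indicator {0<..<c} s"
      by (simp add: indicator_def)
  qed
  also have "\<dots> = (\<integral>\<^sup>+s. emeasure \<nu> {x. s < g x} * indicator {0<..<c} s \<partial>lborel) +
     (\<integral>\<^sup>+s. ennreal (2 * \<eta>) * indicator {0<..<c} s \<partial>lborel)"
  proof (rule nn_integral_add)
    \<comment> \<open>Measurability in the height \<open>s\<close> comes from monotonicity:
      superlevel sets shrink as \<open>s\<close> grows.\<close>
    have "mono (\<lambda>s. - measure \<nu> {x. s < g x})"
    proof (rule monoI)
      fix s s' :: real assume "s \<le> s'"
      hence "{x. s' < g x} \<subseteq> {x. s < g x}" by (intro Collect_mono) simp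
      moreover have "{x. s < g x} \<in> \<nu>.events" using gs by (simp only: \<nu>.events_eq_borel)
      ultimately have "measure \<nu> {x. s' < g x} \<le> measure \<nu> {x. s < g x}"
        by (rule \<nu>.finite_measure_mono)
      thus "- measure \<nu> {x. s < g x} \<le> - measure \<nu> {x. s' < g x}" by (rule le_imp_neg_le)
    qed
    from borel_measurable_uminus[OF borel_measurable_mono[OF this]]
    have "(\<lambda>s. measure \<nu> {x. s < g x}) \<in> borel_measurable borel" by (simp only: minus_minus)
    hence "(\<lambda>s. ennreal (measure \<nu> {x. s < g x})) \<in> borel_measurable borel"
      by (rule measurable_compose[OF _ measurable_ennreal])
    moreover have "indicator {0<..<c} \<in> borel_measurable borel"
      by (rule borel_measurable_indicator) simp
    ultimately show "(\<lambda>s. emeasure \<nu> {x. s < g x} * indicator {0<..<c} s) \<in> borel_measurable lborel"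
      unfolding \<nu>.emeasure_eq_measure measurable_lborel2 by (rule borel_measurable_times_ennreal)
    have "(\<lambda>s. ennreal (2 * \<eta>) * indicator {0<..<c} s) \<in> borel_measurable borel"
      by (intro borel_measurable_times_ennreal borel_measurable_const borel_measurable_indicator) simp
    thus "(\<lambda>s. ennreal (2 * \<eta>) * indicator {0<..<c} s) \<in> borel_measurable lborel"
      unfolding measurable_lborel2 .
  qed
  also have "(\<integral>\<^sup>+s. ennreal (2 * \<eta>) * indicator {0<..<c} s \<partial>lborel) = ennreal (2 * \<eta> * c)"
    using \<eta>0 by (simp add: nn_integral_cmult_indicator c_def ennreal_mult)
  finally have "ennreal (\<Phi> (H - u)) \<le> (\<integral>\<^sup>+x. ennreal (g x) \<partial>\<nu>) + ennreal (2 * \<eta> * c)"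
    by (simp add: cake[OF assms(1)])
  also have "(\<integral>\<^sup>+x. ennreal (g x) \<partial>\<nu>) = (\<integral>\<^sup>+x. ennreal (exp (u * x - u\<^sup>2 / 2)) * indicator {..H} x \<partial>\<nu>)"
    by (intro nn_integral_cong) (auto simp: g_def indicator_def)
  finally show ?thesis by (simp add: c_def)
qed

text \<open>The exponent is the Taylor polynomial of \<open>ln (cosh x)\<close> to fourth order. Its
  error is monotone for \<open>x \<ge> 0\<close>: the derivative of \<open>ln cosh\<close> is
  \<open>tanh\<close>, and \<open>tanh y \<ge> y - y^3 / 3\<close> follows from
  \<open>(tanh y)^2 \<le> y^2\<close> by comparing derivatives once more. Evenness covers negative
  \<open>x\<close>.\<close>

lemma exp_le_cosh: "exp (x\<^sup>2 / 2 - x ^ 4 / 12) \<le> cosh (x::real)"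
proof -
  define p where "p y = tanh y - y + y ^ 3 / 3" for y :: real
  define q where "q y = ln (cosh y) - y\<^sup>2 / 2 + y ^ 4 / 12" for y :: real
  have tanh_le: "(tanh y)\<^sup>2 \<le> y\<^sup>2" if "y \<ge> 0" for y :: real
  proof -
    have "(\<lambda>y. y - tanh y) 0 \<le> y - tanh y"
    proof (rule DERIV_nonneg_imp_nondecreasing[OF that])
      fix x :: real
      have "((\<lambda>y. y - tanh y) has_real_derivative (tanh x)\<^sup>2) (at x)"
        by (auto intro!: derivative_eq_intros)
      thus "\<exists>D. ((\<lambda>y. y - tanh y) has_real_derivative D) (at x) \<and> 0 \<le> D" by (intro exI conjI) auto
    qed
    thus ?thesis using that by (intro power_mono) auto
  qed
  have p0: "p y \<ge> 0" if "y \<ge> 0" for y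
  proof -
    have "p 0 \<le> p y"
    proof (rule DERIV_nonneg_imp_nondecreasing[OF that])
      fix x :: real assume "0 \<le> x"
      have "(p has_real_derivative (x\<^sup>2 - (tanh x)\<^sup>2)) (at x)"
        unfolding p_def[abs_def] by (auto intro!: derivative_eq_intros)
      thus "\<exists>D. (p has_real_derivative D) (at x) \<and> 0 \<le> D"
        using tanh_le[OF \<open>0 \<le> x\<close>] by (intro exI conjI) auto
    qed
    thus ?thesis by (simp add: p_def)
  qed
  have q0: "q y \<ge> 0" if "y \<ge> 0" for y
  proof -
    have "q 0 \<le> q y"
    proof (rule DERIV_nonneg_imp_nondecreasing[OF that])
      fix x :: real assume "0 \<le> x"
      have "(q has_real_derivative p x) (at x)"
        unfolding p_def q_def[abs_def] tanh_def
        by (auto intro!: derivative_eq_intros simp: cosh_real_pos field_simps)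
      thus "\<exists>D. (q has_real_derivative D) (at x) \<and> 0 \<le> D"
        using p0[OF \<open>0 \<le> x\<close>] by (intro exI conjI) auto
    qed
    thus ?thesis by (simp add: q_def)
  qed
  have "q \<bar>x\<bar> \<ge> 0" by (rule q0) simp
  moreover have "cosh \<bar>x\<bar> = cosh x" by (cases "x \<ge> 0") (auto simp: abs_if)
  ultimately have "x\<^sup>2 / 2 - x ^ 4 / 12 \<le> ln (cosh x)" by (simp add: q_def)
  thus ?thesis using cosh_real_pos[of x] by (metis exp_le_cancel_iff exp_ln)
qed

text \<open>Controls the fluctuation of the quartic term in the lower bound for \<open>cosh\<close>.
  The constant is \<open>105 - 6 * 3 + 9 = 96\<close>, from the moments of order eight and
  four.\<close>

lemma std_normal_fourth_power:
  "(\<integral>z. c * (z ^ 4 - 3) \<partial>std_normal_distribution) = 0"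
  "integrable std_normal_distribution (\<lambda>z. (c * (z ^ 4 - 3))\<^sup>2)"
  "(\<integral>z. (c * (z ^ 4 - 3))\<^sup>2 \<partial>std_normal_distribution) = 96 * c\<^sup>2"
proof -
  interpret prob_space std_normal_distribution by (rule prob_space_std_normal)
  have i1: "integrable std_normal_distribution (\<lambda>z. k)" for k :: real by simp
  have c1: "(\<integral>z. k \<partial>std_normal_distribution) = k" for k :: real using prob_space by simp
  show "(\<integral>z. c * (z ^ 4 - 3) \<partial>std_normal_distribution) = 0"
    by (simp only: integral_mult_right_zero Bochner_Integration.integral_diff integrable_std_normal_power i1
        std_normal_moments c1) simp
  have eq: "(c * (z ^ 4 - 3))\<^sup>2 = c\<^sup>2 * (z ^ 8 - 6 * z ^ 4 + 9)" for z :: real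
    by (simp add: power2_eq_square eval_nat_numeral algebra_simps)
  show "integrable std_normal_distribution (\<lambda>z. (c * (z ^ 4 - 3))\<^sup>2)"
    unfolding eq by (intro Bochner_Integration.integrable_add Bochner_Integration.integrable_diff
        integrable_mult_right integrable_std_normal_power i1)
  show "(\<integral>z. (c * (z ^ 4 - 3))\<^sup>2 \<partial>std_normal_distribution) = 96 * c\<^sup>2"
    unfolding eq
    by (simp only: integral_mult_right_zero Bochner_Integration.integral_diff Bochner_Integration.integral_add
        Bochner_Integration.integrable_diff integrable_mult_right integrable_std_normal_power i1
        std_normal_moments c1) simp
qed

text \<open>
  The likelihood ratio of the symmetric mixture is bounded below by \<open>exp (u T - u\<^sup>2 / 2 - D)\<close> with
  \<open>D\<close> small in probability; the rest is the Neyman-Pearson argument for the statistic \<open>T\<close>.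
\<close>

lemma symmetric_mixture_lower_bound:
  assumes "\<eta> > 0" and "B \<ge> 0"
  shows "\<exists>\<rho>>0. \<forall>K w v u A. flat_weights I \<rho> K w \<longrightarrow> 0 \<le> u \<longrightarrow> u \<le> B \<longrightarrow>
    (\<forall>k\<in>K. (v k)\<^sup>2 = 2 * u * w k) \<longrightarrow> A \<in> sets (gauss I) \<longrightarrow> \<Phi> H - \<rho> \<le> measure (gauss I) A \<longrightarrow>
    ennreal (\<Phi> (H - u) - \<eta>) \<le>
      (\<integral>\<^sup>+x. ennreal (\<Prod>k\<in>K. exp (- (v k)\<^sup>2 / 2) * cosh (v k * x k)) * indicator A x \<partial>gauss I)"
proof -
  interpret N: prob_space "gauss I" by (rule prob_space_gauss)
  \<comment> \<open>Dominates \<open>exp (u * H - u^2 / 2)\<close> for all \<open>u\<close> between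
    \<open>0\<close> and \<open>B\<close>, whatever the sign of \<open>H\<close>.\<close>
  define c0 where "c0 = exp (B * \<bar>H\<bar>)"
  define \<tau> where "\<tau> = \<eta> / 2"
  \<comment> \<open>Five errors of size \<open>\<eta>1\<close> are collected below: two from the
    layer-cake comparison, two in the probability of \<open>S\<close> and one in that of
    \<open>C\<close>. Each is multiplied by at most \<open>c0\<close>, so together they cost
    \<open>\<eta> / 2 = \<tau>\<close>.\<close>
  define \<eta>1 where "\<eta>1 = \<eta> / (10 * c0)"
  have pos: "c0 > 0" "\<tau> > 0" "\<eta>1 > 0" using assms by (auto simp: c0_def \<tau>_def \<eta>1_def)
  obtain \<rho>1 where \<rho>1: "\<rho>1 > 0" "\<And>K w x. flat_weights I \<rho>1 K w \<Longrightarrow>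
    \<bar>N.prob {z \<in> space (gauss I). (\<Sum>k\<in>K. w k * ((z k)\<^sup>2 - 1)) \<le> x} - \<Phi> x\<bar> \<le> \<eta>1"
    using chi_square_clt[OF pos(3), of I] by blast
  have B4: "6 * B ^ 4 + 1 > 0" using assms by (intro add_nonneg_pos mult_nonneg_nonneg) auto
  \<comment> \<open>The summand \<open>1\<close> in the denominator keeps it positive when
    \<open>B = 0\<close>.\<close>
  define \<rho> where "\<rho> = Min {\<rho>1, 1, \<eta>1, \<eta>1 * \<tau>\<^sup>2 / (6 * B ^ 4 + 1)}"
  have \<rho>: "\<rho> > 0" "\<rho> \<le> \<rho>1" "\<rho> \<le> 1" "\<rho> \<le> \<eta>1" "\<rho> \<le> \<eta>1 * \<tau>\<^sup>2 / (6 * B ^ 4 + 1)"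
    using \<rho>1(1) pos B4 by (simp_all add: \<rho>_def)
  have \<rho>B: "6 * B ^ 4 * \<rho> / \<tau>\<^sup>2 \<le> \<eta>1"
  proof -
    have "6 * B ^ 4 * \<rho> \<le> (6 * B ^ 4 + 1) * \<rho>" using \<rho>(1) by (intro mult_right_mono) auto
    also have "\<dots> \<le> \<eta>1 * \<tau>\<^sup>2" using \<rho>(5) B4 by (simp add: pos_le_divide_eq mult.commute)
    finally show ?thesis using pos(2) by (simp add: pos_divide_le_eq)
  qed
  show ?thesis
  proof (intro exI[of _ \<rho>] conjI allI impI)
    show "\<rho> > 0" by fact
    fix K w v u A
    assume fw: "flat_weights I \<rho> K w" and u: "0 \<le> u" "u \<le> B" and v: "\<forall>k\<in>K. (v k)\<^sup>2 = 2 * u * w k"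
      and A: "A \<in> sets (gauss I)" and PA: "\<Phi> H - \<rho> \<le> N.prob A"
    have K: "finite K" "K \<subseteq> I" and w0: "\<And>k. k \<in> K \<Longrightarrow> 0 \<le> w k" and w1: "\<And>k. k \<in> K \<Longrightarrow> w k \<le> \<rho>"
      and sw: "(\<Sum>k\<in>K. (w k)\<^sup>2) = 1 / 2"
      using fw by (auto simp: flat_weights_def)
    have KI: "k \<in> K \<Longrightarrow> k \<in> I" for k using K by auto
    have v4: "(v k) ^ 4 = 4 * u\<^sup>2 * (w k)\<^sup>2" if "k \<in> K" for k
    proof -
      have "(v k) ^ 4 = ((v k)\<^sup>2)\<^sup>2" by (simp flip: power_mult)
      thus ?thesis using v that by (simp add: power_mult_distrib)
    qed
    define T where "T x = (\<Sum>k\<in>K. w k * ((x k)\<^sup>2 - 1))" for x :: "'a \<Rightarrow> real"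
    \<comment> \<open>The fourth powers are centred at their mean \<open>3\<close>. As
      \<open>(v k) ^ 4 = 4 * u^2 * (w k)^2\<close>, the centring contributes the sum of the
      \<open>u^2 * (w k)^2\<close>, which is \<open>u^2 / 2\<close>: exactly the normalising term of
      \<open>exp (u * T - u^2 / 2)\<close>.\<close>
    define D where "D x = (\<Sum>k\<in>K. (v k) ^ 4 / 12 * ((x k) ^ 4 - 3))" for x :: "'a \<Rightarrow> real"
    define c where "c = exp (u * H - u\<^sup>2 / 2)"
    have mT: "T \<in> borel_measurable (gauss I)" unfolding T_def using KI by measurable
    have mD: "D \<in> borel_measurable (gauss I)" unfolding D_def using KI by measurable
    have c_le: "c \<le> c0" and c_pos: "c > 0"
    proof -
      have "u * H \<le> u * \<bar>H\<bar>" using u by (intro mult_left_mono) auto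
      also have "\<dots> \<le> B * \<bar>H\<bar>" using u by (intro mult_right_mono) auto
      moreover have "0 \<le> u\<^sup>2 / 2" by simp
      ultimately show "c \<le> c0" unfolding c_def c0_def exp_le_cancel_iff by linarith
    qed (simp add: c_def)
    define C where "C = {x \<in> space (gauss I). T x \<le> H}"
    define E where "E = {x \<in> space (gauss I). \<tau> \<le> \<bar>D x\<bar>}"
    define S where "S = A - E"
    have C: "C \<in> sets (gauss I)" unfolding C_def by (rule borel_measurable_le[OF mT borel_measurable_const])
    have E: "E \<in> sets (gauss I)" unfolding E_def
      by (rule borel_measurable_le[OF borel_measurable_const borel_measurable_abs[OF mD]])
    have S: "S \<in> sets (gauss I)" unfolding S_def by (rule sets.Diff[OF A E])
    have PC: "N.prob C \<le> \<Phi> H + \<eta>1"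
      using \<rho>1(2)[OF flat_weights_mono[OF fw \<rho>(2)], of H] unfolding C_def T_def by linarith
    have "N.prob E \<le> (\<Sum>k\<in>K. \<integral>z. ((v k) ^ 4 / 12 * (z ^ 4 - 3))\<^sup>2 \<partial>std_normal_distribution) / \<tau>\<^sup>2"
      unfolding E_def D_def
      by (rule gauss_Chebyshev_sum[OF K _ _ _ pos(2)]) (simp_all only: std_normal_fourth_power, simp)
    also have "(\<Sum>k\<in>K. \<integral>z. ((v k) ^ 4 / 12 * (z ^ 4 - 3))\<^sup>2 \<partial>std_normal_distribution) =
      (\<Sum>k\<in>K. 96 * ((v k) ^ 4 / 12)\<^sup>2)"
      by (simp only: std_normal_fourth_power)
    also have "\<dots> \<le> (\<Sum>k\<in>K. 12 * B ^ 4 * \<rho> * (w k)\<^sup>2)"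
    proof (intro sum_mono)
      fix k assume k: "k \<in> K"
      \<comment> \<open>Here \<open>96 * (4 / 12)^2 = 32 / 3\<close> is rounded up to
        \<open>12\<close>, so that the squared weights with sum \<open>1 / 2\<close> leave the
        factor \<open>6\<close>.\<close>
      have "96 * ((v k) ^ 4 / 12)\<^sup>2 = 32 / 3 * u ^ 4 * (w k * w k) * (w k)\<^sup>2"
        unfolding v4[OF k] by (simp add: power2_eq_square eval_nat_numeral)
      also have "\<dots> \<le> 12 * B ^ 4 * \<rho> * (w k)\<^sup>2"
      proof (intro mult_right_mono mult_mono power_mono)
        have "w k * w k \<le> \<rho> * 1" using w0[OF k] w1[OF k] \<rho>(3) by (intro mult_mono) auto
        thus "w k * w k \<le> \<rho>" by simp
      qed (use u w0[OF k] \<rho>(1) in auto)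
      finally show "96 * ((v k) ^ 4 / 12)\<^sup>2 \<le> 12 * B ^ 4 * \<rho> * (w k)\<^sup>2" .
    qed
    also have "\<dots> = 6 * B ^ 4 * \<rho>" by (simp add: sum_distrib_left[symmetric] sw)
    finally have PE: "N.prob E \<le> \<eta>1" using \<rho>B by (simp add: divide_right_mono)
    have PS: "\<Phi> H - 2 * \<eta>1 \<le> N.prob S"
    proof -
      have "N.prob A \<le> N.prob (S \<union> E)"
        by (rule N.finite_measure_mono[OF _ sets.Un[OF S E]]) (auto simp: S_def)
      also have "\<dots> \<le> N.prob S + N.prob E" by (rule measure_Un_le[OF S E])
      finally show ?thesis using PA PE \<rho>(4) by linarith
    qed
    define f where "f x = exp (u * T x - u\<^sup>2 / 2)" for x
    have mf: "f \<in> borel_measurable (gauss I)"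
      unfolding f_def
      by (rule measurable_compose[OF _ borel_measurable_exp])
        (intro borel_measurable_diff borel_measurable_times mT borel_measurable_const)
    \<comment> \<open>\<open>c\<close> is the value of \<open>f\<close> on the boundary
      \<open>T x = H\<close> of \<open>C\<close>. Truncating there makes the integrand bounded
      without disturbing the comparison that follows.\<close>
    define f' where "f' x = min (f x) c * indicator S x" for x
    define g where "g x = f x * indicator C x" for x
    have fC: "f x \<le> c" if "x \<in> C" for x
      using that u by (auto simp: f_def c_def C_def intro: mult_left_mono)
    have f_ge: "c \<le> f x" if "x \<notin> C" "x \<in> space (gauss I)" for x
      using that u by (auto simp: f_def c_def C_def intro: mult_left_mono)
    have f_pos: "0 < f x" for x by (simp add: f_def)
    have g0: "0 \<le> g x" and f'0: "0 \<le> f' x" for x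
      using f_pos[of x] c_pos by (simp_all add: g_def f'_def)
    have intf': "integrable (gauss I) f'"
    proof (rule N.integrable_const_bound[of _ c])
      show "AE x in gauss I. norm (f' x) \<le> c"
        using f_pos c_pos by (intro AE_I2) (auto simp: f'_def indicator_def less_imp_le min_def)
      show "f' \<in> borel_measurable (gauss I)" unfolding f'_def
        by (intro borel_measurable_times borel_measurable_min mf borel_measurable_const borel_measurable_indicator S)
    qed
    have intg: "integrable (gauss I) g"
    proof (rule N.integrable_const_bound[of _ c])
      show "AE x in gauss I. norm (g x) \<le> c"
        using fC f_pos c_pos by (intro AE_I2) (auto simp: g_def indicator_def less_imp_le)
      show "g \<in> borel_measurable (gauss I)" unfolding g_def
        by (intro borel_measurable_times mf borel_measurable_indicator C)
    qed
    have ind: "integrable (gauss I) (\<lambda>x. c * indicator X x)" "(\<integral>x. c * indicator X x \<partial>gauss I) = c * N.prob X"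
      if "X \<in> sets (gauss I)" for X
      by (intro integrable_mult_right integrable_real_indicator that, simp add: N.emeasure_eq_measure)
        (simp only: integral_mult_right_zero Bochner_Integration.integral_indicator sets.Int_space_eq2[OF that])
    \<comment> \<open>Neyman-Pearson in pointwise form: \<open>f\<close> is at most \<open>c\<close>
      on \<open>C\<close> and at least \<open>c\<close> off \<open>C\<close>, so trading mass of
      \<open>C\<close> for mass of \<open>S\<close> outside \<open>C\<close> cannot lower the
      integral of \<open>f\<close> at equal null probability.\<close>
    have "(\<integral>x. g x + c * indicator S x \<partial>gauss I) \<le> (\<integral>x. f' x + c * indicator C x \<partial>gauss I)"
    proof (rule integral_mono)
      fix x assume "x \<in> space (gauss I)"
      thus "g x + c * indicator S x \<le> f' x + c * indicator C x"
        using fC[of x] f_ge[of x] f_pos[of x] c_pos by (auto simp: g_def f'_def indicator_def)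
    qed (rule Bochner_Integration.integrable_add[OF intg ind(1)[OF S]],
         rule Bochner_Integration.integrable_add[OF intf' ind(1)[OF C]])
    hence NP: "(\<integral>x. g x \<partial>gauss I) + c * N.prob S \<le> (\<integral>x. f' x \<partial>gauss I) + c * N.prob C"
      by (simp only: Bochner_Integration.integral_add[OF intg ind(1)[OF S]]
          Bochner_Integration.integral_add[OF intf' ind(1)[OF C]] ind(2)[OF S] ind(2)[OF C])
    have "ennreal (\<Phi> (H - u)) \<le> (\<integral>\<^sup>+y. ennreal (exp (u * y - u\<^sup>2 / 2)) * indicator {..H} y \<partial>distr (gauss I) borel T) +
      ennreal (2 * \<eta>1 * exp (u * H - u\<^sup>2 / 2))"
    proof (rule truncated_exp_integral_lower_bound[OF N.real_distribution_distr[OF mT] _ u(1)])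
      fix x
      have "cdf (distr (gauss I) borel T) x = N.prob {z \<in> space (gauss I). T z \<le> x}"
        unfolding cdf_def by (subst measure_distr[OF mT]) (auto intro!: arg_cong[where f = "measure _"])
      thus "\<bar>cdf (distr (gauss I) borel T) x - \<Phi> x\<bar> \<le> \<eta>1"
        using \<rho>1(2)[OF flat_weights_mono[OF fw \<rho>(2)], of x] unfolding T_def by simp
    qed
    also have "(\<integral>\<^sup>+y. ennreal (exp (u * y - u\<^sup>2 / 2)) * indicator {..H} y \<partial>distr (gauss I) borel T) =
      (\<integral>\<^sup>+x. ennreal (g x) \<partial>gauss I)"
      by (subst nn_integral_distr[OF mT]) (auto intro!: nn_integral_cong simp: g_def f_def C_def indicator_def)
    also have "\<dots> = ennreal (\<integral>x. g x \<partial>gauss I)"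
      by (rule nn_integral_eq_integral[OF intg]) (use g0 in auto)
    also have "\<dots> + ennreal (2 * \<eta>1 * exp (u * H - u\<^sup>2 / 2)) = ennreal ((\<integral>x. g x \<partial>gauss I) + 2 * \<eta>1 * c)"
      unfolding c_def using pos
      by (intro ennreal_plus[symmetric] Bochner_Integration.integral_nonneg g0) simp
    finally have Eg: "\<Phi> (H - u) \<le> (\<integral>x. g x \<partial>gauss I) + 2 * \<eta>1 * c"
      by (subst (asm) ennreal_le_iff)
        (use pos c_pos in \<open>simp_all add: g0 Bochner_Integration.integral_nonneg\<close>)
    define X where "X = (\<integral>x. f' x \<partial>gauss I)"
    have X0: "X \<ge> 0" unfolding X_def by (intro Bochner_Integration.integral_nonneg f'0)
    have "c * (\<Phi> H - 2 * \<eta>1) \<le> c * N.prob S" "c * N.prob C \<le> c * (\<Phi> H + \<eta>1)"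
      using PS PC c_pos by (intro mult_left_mono; simp)+
    hence "\<Phi> (H - u) - c * (5 * \<eta>1) \<le> X"
      using NP Eg unfolding X_def by (simp add: algebra_simps)
    moreover have "c * (5 * \<eta>1) \<le> c0 * (5 * \<eta>1)" using c_le pos by (intro mult_right_mono) auto
    moreover have "c0 * (5 * \<eta>1) = \<tau>" using pos by (simp add: \<eta>1_def \<tau>_def)
    ultimately have X: "\<Phi> (H - u) - \<tau> \<le> X" by linarith
    \<comment> \<open>The factor \<open>exp (- \<tau>)\<close> pays for
      \<open>D x \<le> \<tau>\<close>. As the quantity it multiplies can be cut down to at most
      \<open>1\<close>, it costs another \<open>\<tau>\<close>, and
      \<open>2 * \<tau> = \<eta>\<close>.\<close>
    have "\<Phi> (H - u) - \<eta> \<le> exp (- \<tau>) * X"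
    proof -
      define p where "p = max 0 (\<Phi> (H - u) - \<tau>)"
      have p: "0 \<le> p" "p \<le> X" "p \<le> 1" "\<Phi> (H - u) - \<tau> \<le> p"
        using X X0 Phi_le_1[of "H - u"] pos by (auto simp: p_def)
      have "\<Phi> (H - u) - \<eta> \<le> p - \<tau> * 1" using p(4) by (simp add: \<tau>_def)
      also have "\<dots> \<le> p - \<tau> * p" using p pos by (intro diff_left_mono mult_left_mono) auto
      also have "\<dots> = (1 - \<tau>) * p" by (simp add: algebra_simps)
      also have "\<dots> \<le> exp (- \<tau>) * p" using p exp_ge_add_one_self[of "- \<tau>"] by (intro mult_right_mono) auto
      also have "\<dots> \<le> exp (- \<tau>) * X" using p by (intro mult_left_mono) auto
      finally show ?thesis .
    qed
    hence "ennreal (\<Phi> (H - u) - \<eta>) \<le> ennreal (exp (- \<tau>) * X)" by (rule ennreal_leI)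
    also have "\<dots> = (\<integral>\<^sup>+x. ennreal (exp (- \<tau>) * f' x) \<partial>gauss I)"
      unfolding X_def
      by (subst nn_integral_eq_integral[OF integrable_mult_right[OF intf']]) (simp_all add: f'0)
    also have "\<dots> \<le> (\<integral>\<^sup>+x. ennreal (\<Prod>k\<in>K. exp (- (v k)\<^sup>2 / 2) * cosh (v k * x k)) * indicator A x \<partial>gauss I)"
    proof (intro nn_integral_mono)
      fix x assume x: "x \<in> space (gauss I)"
      show "ennreal (exp (- \<tau>) * f' x) \<le>
        ennreal (\<Prod>k\<in>K. exp (- (v k)\<^sup>2 / 2) * cosh (v k * x k)) * indicator A x"
      proof (cases "x \<in> S")
        case False
        thus ?thesis by (simp add: f'_def)
      next
        case True
        hence xA: "x \<in> A" and D: "D x \<le> \<tau>" using x by (auto simp: S_def E_def)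
        have "(\<Sum>k\<in>K. - (v k)\<^sup>2 / 2 + ((v k * x k)\<^sup>2 / 2 - (v k * x k) ^ 4 / 12)) =
          (\<Sum>k\<in>K. u * (w k * ((x k)\<^sup>2 - 1)) - (v k) ^ 4 / 12 * ((x k) ^ 4 - 3) - u\<^sup>2 * (w k)\<^sup>2)"
        proof (intro sum.cong refl)
          fix k assume k: "k \<in> K"
          have "(v k * x k)\<^sup>2 / 2 = u * w k * (x k)\<^sup>2" "(v k)\<^sup>2 / 2 = u * w k"
            using v k by (simp_all add: power_mult_distrib)
          moreover have "(v k * x k) ^ 4 / 12 = (v k) ^ 4 / 12 * ((x k) ^ 4 - 3) + u\<^sup>2 * (w k)\<^sup>2"
            using v4[OF k] by (simp add: power_mult_distrib field_simps)
          ultimately show "- (v k)\<^sup>2 / 2 + ((v k * x k)\<^sup>2 / 2 - (v k * x k) ^ 4 / 12) =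
            u * (w k * ((x k)\<^sup>2 - 1)) - (v k) ^ 4 / 12 * ((x k) ^ 4 - 3) - u\<^sup>2 * (w k)\<^sup>2"
            by (simp add: algebra_simps)
        qed
        also have "\<dots> = u * T x - D x - u\<^sup>2 / 2"
          by (simp add: sum_subtractf sum_distrib_left[symmetric] T_def D_def sw)
        finally have eq: "(\<Sum>k\<in>K. - (v k)\<^sup>2 / 2 + ((v k * x k)\<^sup>2 / 2 - (v k * x k) ^ 4 / 12)) = u * T x - D x - u\<^sup>2 / 2" .
        have "exp (- \<tau>) * f' x \<le> exp (- \<tau>) * f x" using True by (simp add: f'_def)
        also have "\<dots> = exp (u * T x - \<tau> - u\<^sup>2 / 2)" by (simp add: f_def exp_add[symmetric] algebra_simps)
        also have "\<dots> \<le> exp (u * T x - D x - u\<^sup>2 / 2)" using D by simp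
        also have "\<dots> = (\<Prod>k\<in>K. exp (- (v k)\<^sup>2 / 2) * exp ((v k * x k)\<^sup>2 / 2 - (v k * x k) ^ 4 / 12))"
          unfolding eq[symmetric] exp_sum[OF K(1)] exp_add ..
        also have "\<dots> \<le> (\<Prod>k\<in>K. exp (- (v k)\<^sup>2 / 2) * cosh (v k * x k))"
          by (intro prod_mono conjI mult_left_mono exp_le_cosh) auto
        finally show ?thesis using xA by (simp add: ennreal_leI)
      qed
    qed
    finally show "ennreal (\<Phi> (H - u) - \<eta>) \<le>
      (\<integral>\<^sup>+x. ennreal (\<Prod>k\<in>K. exp (- (v k)\<^sup>2 / 2) * cosh (v k * x k)) * indicator A x \<partial>gauss I)" .
  qed
qed

section \<open>Level sets of the anisotropic ellipsoid\<close>

text \<open>What the extremal problem uses of the weights. By \<open>card_level\<close> and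
  \<open>b_level\<close> the sum of \<open>1 / b^4\<close> over the indices with
  \<open>a^2 \<le> M\<close> is at most \<open>M powr (E1 + E2)\<close>; by \<open>box\<close> this
  order is attained, on a set where \<open>1 / b^4\<close> is uniformly large.\<close>

locale power_ellipsoid =
  fixes d :: nat and a b :: sequence and R E1 E2 :: real
  assumes R_pos: "R > 0" and E1_pos: "E1 > 0" and E2_nonneg: "E2 \<ge> 0"
    and b_pos: "l \<in> Nstar d \<Longrightarrow> 0 < (b l)\<^sup>2" and b_le_1: "l \<in> Nstar d \<Longrightarrow> (b l)\<^sup>2 \<le> 1"
    and a_pos: "l \<in> Nstar d \<Longrightarrow> 0 < (a l)\<^sup>2"
    and a_unbounded: "\<exists>l\<in>Nstar d. M \<le> (a l)\<^sup>2"
    and finite_level: "finite {l \<in> Nstar d. (a l)\<^sup>2 \<le> M}"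
    and card_level: "M > 0 \<Longrightarrow> real (card {l \<in> Nstar d. (a l)\<^sup>2 \<le> M}) \<le> M powr E1"
    and b_level: "l \<in> Nstar d \<Longrightarrow> (a l)\<^sup>2 \<le> M \<Longrightarrow> 1 \<le> (b l) ^ 4 * M powr E2"
    and box: "\<exists>c>0. \<exists>M0>0. \<forall>M\<ge>M0. \<exists>Q. finite Q \<and> Q \<subseteq> Nstar d \<and>
      (\<forall>l\<in>Q. (a l)\<^sup>2 \<le> M \<and> (b l) ^ 4 * M powr E2 \<le> 1 / c) \<and> c * M powr E1 \<le> real (card Q)"

lemma powr_sum_exponents:
  assumes "M > 0" "finite J" shows "M powr (\<Sum>j\<in>J. e j) = (\<Prod>j\<in>J. M powr (e j :: real))"
  using assms(2) by induction (use assms(1) in \<open>simp_all add: powr_add\<close>)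

text \<open>The condition \<open>a^2 \<le> M\<close> forces
  \<open>l j \<le> M powr (1 / (2 * s j))\<close> for every \<open>j\<close>, and is implied by
  \<open>l j \<le> (M / d) powr (1 / (2 * s j))\<close> for all \<open>j\<close>. Level sets thus
  lie between two boxes whose volumes have a ratio independent of \<open>M\<close>.\<close>

lemma power_ellipsoid_powr:
  fixes t s :: "nat \<Rightarrow> real"
  assumes d: "d \<ge> 1" and R: "R > 0"
    and t: "\<And>j. j \<in> {1..d} \<Longrightarrow> t j \<ge> 0" and s: "\<And>j. j \<in> {1..d} \<Longrightarrow> s j > 0"
    and b: "\<And>l. l \<in> Nstar d \<Longrightarrow> (b l)\<^sup>2 = (\<Prod>j=1..d. real (l j) powr (- 2 * t j))"
    and a: "\<And>l. l \<in> Nstar d \<Longrightarrow> (a l)\<^sup>2 = (\<Sum>j=1..d. real (l j) powr (2 * s j))"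
  shows "power_ellipsoid d a b R (\<Sum>j=1..d. 1 / (2 * s j)) (\<Sum>j=1..d. 2 * t j / s j)"
proof
  define E1 where "E1 = (\<Sum>j=1..d. 1 / (2 * s j))"
  define E2 where "E2 = (\<Sum>j=1..d. 2 * t j / s j)"
  show "R > 0" by fact
  show "(\<Sum>j=1..d. 1 / (2 * s j)) > 0" using d s by (intro sum_pos) auto
  show "(\<Sum>j=1..d. 2 * t j / s j) \<ge> 0" using t s by (intro sum_nonneg) (auto simp: less_imp_le)
  have l_ge: "1 \<le> real (l j)" if "l \<in> Nstar d" "j \<in> {1..d}" for l j
    using that by (force simp: Nstar_def PiE_iff)
  show "0 < (b l)\<^sup>2" if "l \<in> Nstar d" for l
    unfolding b[OF that] using l_ge[OF that] by (intro prod_pos) force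
  show "(b l)\<^sup>2 \<le> 1" if "l \<in> Nstar d" for l
    unfolding b[OF that]
  proof (intro prod_le_1 conjI)
    fix j assume j: "j \<in> {1..d}"
    have "real (l j) powr (- 2 * t j) \<le> real (l j) powr 0"
      using l_ge[OF that j] t[OF j] by (intro powr_mono) auto
    thus "real (l j) powr (- 2 * t j) \<le> 1" using l_ge[OF that j] by simp
  qed simp
  show "0 < (a l)\<^sup>2" if "l \<in> Nstar d" for l
    unfolding a[OF that] using l_ge[OF that] d by (intro sum_pos) force+
  have coord: "real (l j) \<le> M powr (1 / (2 * s j))" if l: "l \<in> Nstar d" "(a l)\<^sup>2 \<le> M" and j: "j \<in> {1..d}" for l M j
  proof -
    have "real (l j) powr (2 * s j) \<le> (\<Sum>j=1..d. real (l j) powr (2 * s j))"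
      using j by (intro member_le_sum) auto
    also have "\<dots> \<le> M" using l by (simp add: a)
    finally have "(real (l j) powr (2 * s j)) powr (1 / (2 * s j)) \<le> M powr (1 / (2 * s j))"
      using s[OF j] by (intro powr_mono2) auto
    thus ?thesis using s[OF j] l_ge[OF l(1) j] by (simp add: powr_powr)
  qed
  show "\<exists>l\<in>Nstar d. M \<le> (a l)\<^sup>2" for M
  proof -
    obtain n :: nat where n: "real n > M powr (1 / (2 * s 1))" using reals_Archimedean2 by blast
    define l where "l = (\<lambda>j\<in>{1..d}. n + 1)"
    have l: "l \<in> Nstar d" by (auto simp: l_def Nstar_def)
    moreover have "M \<le> (a l)\<^sup>2"
    proof (rule ccontr)
      assume "\<not> M \<le> (a l)\<^sup>2"
      hence "real (l 1) \<le> M powr (1 / (2 * s 1))" using coord[OF l, of M 1] d by simp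
      thus False using n d by (simp add: l_def)
    qed
    ultimately show ?thesis by blast
  qed
  have sub: "{l \<in> Nstar d. (a l)\<^sup>2 \<le> M} \<subseteq> (\<Pi>\<^sub>E j\<in>{1..d}. {1..nat \<lfloor>M powr (1 / (2 * s j))\<rfloor>})" for M
  proof
    fix l assume l: "l \<in> {l \<in> Nstar d. (a l)\<^sup>2 \<le> M}"
    have "l j \<in> {1..nat \<lfloor>M powr (1 / (2 * s j))\<rfloor>}" if "j \<in> {1..d}" for j
      using coord[of l M j] l_ge[of l j] l that by (auto simp: le_nat_floor)
    thus "l \<in> (\<Pi>\<^sub>E j\<in>{1..d}. {1..nat \<lfloor>M powr (1 / (2 * s j))\<rfloor>})"
      using l by (auto simp: Nstar_def PiE_iff)
  qed
  have fin: "finite (\<Pi>\<^sub>E j\<in>{1..d}. {1..nat \<lfloor>M powr (1 / (2 * s j))\<rfloor>})" for M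
    by (intro finite_PiE) auto
  show "finite {l \<in> Nstar d. (a l)\<^sup>2 \<le> M}" for M by (rule finite_subset[OF sub fin])
  have E1_prod: "M powr E1 = (\<Prod>j=1..d. M powr (1 / (2 * s j)))" if "M > 0" for M
    unfolding E1_def by (intro powr_sum_exponents that) simp
  show "real (card {l \<in> Nstar d. (a l)\<^sup>2 \<le> M}) \<le> M powr (\<Sum>j=1..d. 1 / (2 * s j))" if "M > 0" for M
  proof -
    have "real (card {l \<in> Nstar d. (a l)\<^sup>2 \<le> M}) \<le> real (card (\<Pi>\<^sub>E j\<in>{1..d}. {1..nat \<lfloor>M powr (1 / (2 * s j))\<rfloor>}))"
      by (intro of_nat_mono card_mono[OF fin sub])
    also have "\<dots> = (\<Prod>j=1..d. real (nat \<lfloor>M powr (1 / (2 * s j))\<rfloor>))" by (simp add: card_PiE)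
    also have "\<dots> \<le> (\<Prod>j=1..d. M powr (1 / (2 * s j)))" by (intro prod_mono) (simp add: of_nat_floor)
    finally show ?thesis using E1_prod[OF that] by (simp add: E1_def)
  qed
  \<comment> \<open>In terms of the side lengths of the outer box: every ratio is at least
    \<open>1\<close> on the level set, and bounded where the coordinates are comparable to the
    sides.\<close>
  have b4: "(b l) ^ 4 * M powr E2 = (\<Prod>j=1..d. (M powr (1 / (2 * s j)) / real (l j)) powr (4 * t j))"
    if l: "l \<in> Nstar d" and M: "M > 0" for l M
  proof -
    have "(b l) ^ 4 = ((b l)\<^sup>2)\<^sup>2" by (simp flip: power_mult)
    also have "\<dots> = (\<Prod>j=1..d. (real (l j) powr (- 2 * t j))\<^sup>2)" by (simp add: b[OF l] prod_power_distrib)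
    finally have "(b l) ^ 4 * M powr E2 = (\<Prod>j=1..d. (real (l j) powr (- 2 * t j))\<^sup>2 * M powr (2 * t j / s j))"
      unfolding E2_def using M by (simp add: powr_sum_exponents prod.distrib)
    also have "\<dots> = (\<Prod>j=1..d. (M powr (1 / (2 * s j)) / real (l j)) powr (4 * t j))"
    proof (intro prod.cong refl)
      fix j assume j: "j \<in> {1..d}"
      have "(real (l j) powr (- 2 * t j))\<^sup>2 = real (l j) powr (- (4 * t j))"
        using l_ge[OF l j] by (simp add: power2_eq_square flip: powr_add)
      moreover have "M powr (2 * t j / s j) = (M powr (1 / (2 * s j))) powr (4 * t j)"
        using s[OF j] by (simp add: powr_powr field_simps)
      ultimately show "(real (l j) powr (- 2 * t j))\<^sup>2 * M powr (2 * t j / s j) =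
        (M powr (1 / (2 * s j)) / real (l j)) powr (4 * t j)"
        using l_ge[OF l j] by (simp add: powr_divide powr_minus_divide)
    qed
    finally show ?thesis .
  qed
  show "1 \<le> (b l) ^ 4 * M powr (\<Sum>j=1..d. 2 * t j / s j)" if l: "l \<in> Nstar d" "(a l)\<^sup>2 \<le> M" for l M
  proof -
    have "0 < (a l)\<^sup>2" unfolding a[OF l(1)] using l_ge[OF l(1)] d by (intro sum_pos) force+
    hence M: "M > 0" using l by linarith
    have "1 \<le> (\<Prod>j=1..d. (M powr (1 / (2 * s j)) / real (l j)) powr (4 * t j))"
    proof (intro prod_ge_1)
      fix j assume j: "j \<in> {1..d}"
      have "1 \<le> M powr (1 / (2 * s j)) / real (l j)" using coord[OF l j] l_ge[OF l(1) j] by simp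
      thus "1 \<le> (M powr (1 / (2 * s j)) / real (l j)) powr (4 * t j)"
        using t[OF j] by (intro ge_one_powr_ge_zero) auto
    qed
    thus ?thesis using b4[OF l(1) M] by (simp add: E2_def)
  qed
  define c1 where "c1 = (\<Prod>j=1..d. (1 / real d) powr (1 / (2 * s j)) / 4)"
  define C2 where "C2 = (\<Prod>j=1..d. (4 * real d powr (1 / (2 * s j))) powr (4 * t j))"
  have c1: "c1 > 0" unfolding c1_def using d by (intro prod_pos) auto
  have C2: "C2 > 0" unfolding C2_def using d by (intro prod_pos) auto
  define c where "c = min c1 (1 / C2)"
  \<comment> \<open>For \<open>M \<ge> M0\<close> every side \<open>n j\<close> below is at least
    \<open>2\<close>, so that the floor of \<open>n j / 2\<close> loses at most a factor of
    two.\<close>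
  define M0 where "M0 = (\<Sum>j=1..d. real d * 2 powr (2 * s j))"
  have c: "c > 0" "c \<le> c1" "C2 \<le> 1 / c"
  proof -
    show "c > 0" "c \<le> c1" using c1 C2 by (auto simp: c_def)
    have "c \<le> 1 / C2" by (simp add: c_def)
    thus "C2 \<le> 1 / c" using \<open>c > 0\<close> C2 by (simp add: field_simps)
  qed
  have M0: "M0 > 0" unfolding M0_def using d by (intro sum_pos) auto
  have "\<exists>Q. finite Q \<and> Q \<subseteq> Nstar d \<and> (\<forall>l\<in>Q. (a l)\<^sup>2 \<le> M \<and> (b l) ^ 4 * M powr E2 \<le> 1 / c) \<and> c * M powr E1 \<le> real (card Q)"
    if M: "M \<ge> M0" for M
  proof -
    have Mpos: "M > 0" using M M0 by linarith
    define n where "n j = (M / real d) powr (1 / (2 * s j))" for j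
    define p where "p j = nat \<lfloor>n j / 2\<rfloor>" for j
    have n2: "2 \<le> n j" if j: "j \<in> {1..d}" for j
    proof -
      have "real d * 2 powr (2 * s j) \<le> M0"
        unfolding M0_def using j by (intro member_le_sum) auto
      hence "2 powr (2 * s j) \<le> M / real d" using M d by (simp add: field_simps)
      hence "(2 powr (2 * s j)) powr (1 / (2 * s j)) \<le> n j"
        unfolding n_def using s[OF j] by (intro powr_mono2) auto
      thus ?thesis using s[OF j] by (simp add: powr_powr)
    qed
    have p: "n j / 4 \<le> real (p j)" "real (p j) \<le> n j / 2" if j: "j \<in> {1..d}" for j
    proof -
      have "real (p j) = of_int \<lfloor>n j / 2\<rfloor>" unfolding p_def using n2[OF j] by simp
      moreover have "of_int \<lfloor>n j / 2\<rfloor> \<ge> (1::real)" using n2[OF j] by (simp add: le_floor_iff)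
      ultimately show "n j / 4 \<le> real (p j)" "real (p j) \<le> n j / 2" by linarith+
    qed
    \<comment> \<open>The dyadic block keeps each coordinate at least \<open>n j / 4\<close>, which
      bounds \<open>b^4\<close> from above; the lower end \<open>p j + 1\<close> makes it contain
      exactly \<open>p j\<close> values.\<close>
    define Q where "Q = (\<Pi>\<^sub>E j\<in>{1..d}. {p j + 1..2 * p j})"
    have Q: "Q \<subseteq> Nstar d" unfolding Q_def Nstar_def by (intro PiE_mono) auto
    have lQ: "n j / 4 \<le> real (l j) \<and> real (l j) \<le> n j" if "l \<in> Q" and j: "j \<in> {1..d}" for l j
    proof -
      have "l j \<in> {p j + 1..2 * p j}" using that by (auto simp: Q_def PiE_iff)
      hence "real (p j) \<le> real (l j)" "real (l j) \<le> 2 * real (p j)" by auto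
      thus ?thesis using p[OF j] by linarith
    qed
    have "(a l)\<^sup>2 \<le> M" if l: "l \<in> Q" for l
    proof -
      have "(a l)\<^sup>2 = (\<Sum>j=1..d. real (l j) powr (2 * s j))" using l Q by (intro a) auto
      also have "\<dots> \<le> (\<Sum>j=1..d. M / real d)"
      proof (intro sum_mono)
        fix j assume j: "j \<in> {1..d}"
        have "real (l j) powr (2 * s j) \<le> n j powr (2 * s j)"
          using lQ[OF l j] s[OF j] by (intro powr_mono2) auto
        also have "\<dots> = M / real d" unfolding n_def using s[OF j] Mpos d by (simp add: powr_powr)
        finally show "real (l j) powr (2 * s j) \<le> M / real d" .
      qed
      also have "\<dots> = M" using d by simp
      finally show ?thesis .
    qed
    moreover have "(b l) ^ 4 * M powr E2 \<le> 1 / c" if l: "l \<in> Q" for l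
    proof -
      have lN: "l \<in> Nstar d" using l Q by auto
      have "(b l) ^ 4 * M powr E2 = (\<Prod>j=1..d. (M powr (1 / (2 * s j)) / real (l j)) powr (4 * t j))"
        by (rule b4[OF lN Mpos])
      also have "\<dots> \<le> C2" unfolding C2_def
      proof (intro prod_mono conjI powr_mono2)
        fix j assume j: "j \<in> {1..d}"
        have "M powr (1 / (2 * s j)) = n j * real d powr (1 / (2 * s j))"
          unfolding n_def using Mpos d by (simp add: powr_divide)
        also have "\<dots> \<le> (4 * real (l j)) * real d powr (1 / (2 * s j))"
          using lQ[OF l j] by (intro mult_right_mono) auto
        finally show "M powr (1 / (2 * s j)) / real (l j) \<le> 4 * real d powr (1 / (2 * s j))"
          using l_ge[OF lN j] by (simp add: field_simps)
        show "0 \<le> 4 * t j" using t[OF j] by simp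
      qed auto
      also have "\<dots> \<le> 1 / c" by (rule c(3))
      finally show ?thesis .
    qed
    moreover have "c * M powr E1 \<le> real (card Q)"
    proof -
      have "c * M powr E1 \<le> c1 * M powr E1" using c by (intro mult_right_mono) auto
      also have "\<dots> = (\<Prod>j=1..d. n j / 4)"
        unfolding E1_prod[OF Mpos] c1_def n_def using Mpos d
        by (simp add: powr_divide flip: prod.distrib)
      also have "\<dots> \<le> (\<Prod>j=1..d. real (p j))" by (intro prod_mono) (use p in \<open>auto simp: n_def\<close>)
      also have "\<dots> = real (card Q)" by (simp add: Q_def card_PiE)
      finally show ?thesis .
    qed
    moreover have "finite Q" unfolding Q_def by (intro finite_PiE) auto
    ultimately show ?thesis using Q by blast
  qed
  thus "\<exists>c>0. \<exists>M0>0. \<forall>M\<ge>M0. \<exists>Q. finite Q \<and> Q \<subseteq> Nstar d \<and>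
      (\<forall>l\<in>Q. (a l)\<^sup>2 \<le> M \<and> (b l) ^ 4 * M powr (\<Sum>j=1..d. 2 * t j / s j) \<le> 1 / c) \<and>
      c * M powr (\<Sum>j=1..d. 1 / (2 * s j)) \<le> real (card Q)"
    using c(1) M0 unfolding E1_def E2_def by blast
qed

section \<open>The extremal problem\<close>

lemma has_sum_finite_support:
  fixes f :: "'i \<Rightarrow> real"
  assumes "finite K" "K \<subseteq> I" "\<And>x. x \<in> I - K \<Longrightarrow> f x = 0"
  shows "(f has_sum sum f K) I"
proof -
  have "(f has_sum sum f K) I \<longleftrightarrow> (f has_sum sum f K) K"
    by (rule has_sum_cong_neutral) (use assms in auto)
  thus ?thesis using assms by simp
qed

context power_ellipsoid
begin

abbreviation "alts \<equiv> alternatives d a R"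
abbreviation "quart \<equiv> quartic d b"
abbreviation "extremal \<equiv> extremal_value d a b R"
abbreviation "threshold \<equiv> threshold_test d a b R"
abbreviation "error2 \<equiv> second_kind_error d b"
abbreviation "minimax \<equiv> minimax_error d b"

lemma b_nz: "l \<in> Nstar d \<Longrightarrow> b l \<noteq> 0"
  using b_pos[of l] by auto

lemma alternativesD:
  assumes "\<theta> \<in> alts r" "r > 0"
  shows "(\<lambda>l. (\<theta> l)\<^sup>2) summable_on Nstar d" "(\<lambda>l. (a l)\<^sup>2 * (\<theta> l)\<^sup>2) summable_on Nstar d"
    "(\<Sum>\<^sub>\<infinity>l\<in>Nstar d. (a l)\<^sup>2 * (\<theta> l)\<^sup>2) \<le> R\<^sup>2" "r\<^sup>2 \<le> (\<Sum>\<^sub>\<infinity>l\<in>Nstar d. (\<theta> l)\<^sup>2)"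
proof -
  show "(\<lambda>l. (\<theta> l)\<^sup>2) summable_on Nstar d" "(\<lambda>l. (a l)\<^sup>2 * (\<theta> l)\<^sup>2) summable_on Nstar d"
    "(\<Sum>\<^sub>\<infinity>l\<in>Nstar d. (a l)\<^sup>2 * (\<theta> l)\<^sup>2) \<le> R\<^sup>2"
    using assms by (auto simp: alternatives_def ellipsoid_def ell2_def)
  have "r \<le> sqrt (\<Sum>\<^sub>\<infinity>l\<in>Nstar d. (\<theta> l)\<^sup>2)"
    using assms by (auto simp: alternatives_def ell2_norm_def)
  hence "r\<^sup>2 \<le> (sqrt (\<Sum>\<^sub>\<infinity>l\<in>Nstar d. (\<theta> l)\<^sup>2))\<^sup>2" using assms by (intro power_mono) auto
  thus "r\<^sup>2 \<le> (\<Sum>\<^sub>\<infinity>l\<in>Nstar d. (\<theta> l)\<^sup>2)" by (simp add: infsum_nonneg)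
qed

text \<open>Each square is at most the total \<open>S\<close>, so the fourth powers are dominated by
  \<open>S\<close> times the squares. Otherwise \<open>quartic\<close> could be the default value
  \<open>0\<close> of a divergent sum.\<close>

lemma quartic_summable:
  assumes s: "(\<lambda>l. (\<theta> l)\<^sup>2) summable_on Nstar d"
  shows "(\<lambda>k. (b k) ^ 4 * (\<theta> k) ^ 4) summable_on Nstar d"
proof -
  define S where "S = (\<Sum>\<^sub>\<infinity>l\<in>Nstar d. (\<theta> l)\<^sup>2)"
  have "(\<lambda>l. S * (\<theta> l)\<^sup>2) summable_on Nstar d" by (rule summable_on_cmult_right[OF s])
  thus ?thesis
  proof (rule summable_on_comparison_test)
    fix k assume k: "k \<in> Nstar d"
    have "(\<Sum>l\<in>{k}. (\<theta> l)\<^sup>2) \<le> S" unfolding S_def by (rule finite_sum_le_infsum[OF s]) (use k in auto)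
    hence le: "(\<theta> k)\<^sup>2 \<le> S" by simp
    have "(b k) ^ 4 * (\<theta> k) ^ 4 = ((b k)\<^sup>2)\<^sup>2 * ((\<theta> k)\<^sup>2 * (\<theta> k)\<^sup>2)" by (simp add: eval_nat_numeral)
    also have "\<dots> \<le> 1 * (S * (\<theta> k)\<^sup>2)"
    proof (intro mult_mono mult_right_mono le)
      show "((b k)\<^sup>2)\<^sup>2 \<le> 1" by (rule power_le_one[OF _ b_le_1[OF k]]) simp
    qed (use order_trans[OF zero_le_power2 le] in auto)
    finally show "(b k) ^ 4 * (\<theta> k) ^ 4 \<le> S * (\<theta> k)\<^sup>2" by simp
  qed simp
qed

text \<open>The support of the optimum when \<open>A\<close> is the ratio of the two Lagrange
  multipliers; finite for \<open>A > 0\<close>.\<close>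

definition level_set :: "real \<Rightarrow> multi_index set" where
  "level_set A = {l \<in> Nstar d. A * (a l)\<^sup>2 < 1}"

lemma level_set_subset: "level_set A \<subseteq> Nstar d"
  by (auto simp: level_set_def)

lemma level_set_le: "A > 0 \<Longrightarrow> level_set A \<subseteq> {l \<in> Nstar d. (a l)\<^sup>2 \<le> 1 / A}"
  by (auto simp: level_set_def field_simps)

lemma finite_level_set: "A > 0 \<Longrightarrow> finite (level_set A)"
  by (rule finite_subset[OF level_set_le finite_level])

text \<open>The radius constraint minus \<open>A\<close> times the ellipsoid constraint; the indices
  dropped on the right carry a nonpositive factor \<open>1 - A * a^2\<close>.\<close>

lemma level_sum_lower:
  assumes \<theta>: "\<theta> \<in> alts r" "r > 0" and A: "A > 0"
  shows "r\<^sup>2 - A * R\<^sup>2 \<le> (\<Sum>l\<in>level_set A. (1 - A * (a l)\<^sup>2) * (\<theta> l)\<^sup>2)"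
proof -
  note D = alternativesD[OF \<theta>]
  have "((\<lambda>l. (\<theta> l)\<^sup>2 + (- A) * ((a l)\<^sup>2 * (\<theta> l)\<^sup>2)) has_sum
    (\<Sum>\<^sub>\<infinity>l\<in>Nstar d. (\<theta> l)\<^sup>2) + (- A) * (\<Sum>\<^sub>\<infinity>l\<in>Nstar d. (a l)\<^sup>2 * (\<theta> l)\<^sup>2)) (Nstar d)"
    by (intro has_sum_add has_sum_cmult_right has_sum_infsum D)
  hence hs: "((\<lambda>l. (1 - A * (a l)\<^sup>2) * (\<theta> l)\<^sup>2) has_sum
    (\<Sum>\<^sub>\<infinity>l\<in>Nstar d. (\<theta> l)\<^sup>2) + (- A) * (\<Sum>\<^sub>\<infinity>l\<in>Nstar d. (a l)\<^sup>2 * (\<theta> l)\<^sup>2)) (Nstar d)"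
    by (simp add: algebra_simps)
  have "A * (\<Sum>\<^sub>\<infinity>l\<in>Nstar d. (a l)\<^sup>2 * (\<theta> l)\<^sup>2) \<le> A * R\<^sup>2" using A D(3) by (intro mult_left_mono) auto
  hence "r\<^sup>2 - A * R\<^sup>2 \<le> (\<Sum>\<^sub>\<infinity>l\<in>Nstar d. (\<theta> l)\<^sup>2) + (- A) * (\<Sum>\<^sub>\<infinity>l\<in>Nstar d. (a l)\<^sup>2 * (\<theta> l)\<^sup>2)"
    using D(4) by simp
  also have "\<dots> \<le> (\<Sum>l\<in>level_set A. (1 - A * (a l)\<^sup>2) * (\<theta> l)\<^sup>2)"
    by (rule has_sum_mono_neutral[OF hs has_sum_finite[OF finite_level_set[OF A]]])
      (auto simp: level_set_def intro!: mult_nonpos_nonneg)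
  finally show ?thesis .
qed

text \<open>With \<open>A = r^2 / (2 * R^2)\<close> the indices with
  \<open>a^2 < 2 * R^2 / r^2\<close> carry at least half of \<open>r^2\<close>. Cauchy-Schwarz,
  applied to \<open>b^2 * \<theta>^2\<close> and \<open>1 / b^2\<close> on these indices, bounds the
  quartic sum by the count of the level set.\<close>

lemma quartic_lower_bound:
  assumes \<theta>: "\<theta> \<in> alts r" "r > 0"
  shows "r ^ 4 / 4 * (2 * R\<^sup>2 / r\<^sup>2) powr (- (E1 + E2)) \<le> quart \<theta>"
proof -
  define A where "A = r\<^sup>2 / (2 * R\<^sup>2)"
  define M where "M = 2 * R\<^sup>2 / r\<^sup>2"
  have A: "A > 0" and M: "M > 0" and AM: "1 / A = M" using R_pos \<theta>(2) by (auto simp: A_def M_def)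
  let ?K = "level_set A"
  have fin: "finite ?K" by (rule finite_level_set[OF A])
  have lvl: "?K \<subseteq> {l \<in> Nstar d. (a l)\<^sup>2 \<le> M}" using level_set_le[OF A] AM by simp
  have "r\<^sup>2 / 2 = r\<^sup>2 - A * R\<^sup>2" using R_pos by (simp add: A_def)
  also have "\<dots> \<le> (\<Sum>l\<in>?K. (1 - A * (a l)\<^sup>2) * (\<theta> l)\<^sup>2)" by (rule level_sum_lower[OF \<theta> A])
  also have "\<dots> \<le> (\<Sum>l\<in>?K. (b l)\<^sup>2 * (\<theta> l)\<^sup>2 * (1 / (b l)\<^sup>2))"
  proof (intro sum_mono)
    fix l assume "l \<in> ?K"
    hence "b l \<noteq> 0" using b_nz level_set_subset by blast
    have "(1 - A * (a l)\<^sup>2) * (\<theta> l)\<^sup>2 \<le> 1 * (\<theta> l)\<^sup>2" using A by (intro mult_right_mono) auto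
    thus "(1 - A * (a l)\<^sup>2) * (\<theta> l)\<^sup>2 \<le> (b l)\<^sup>2 * (\<theta> l)\<^sup>2 * (1 / (b l)\<^sup>2)" using \<open>b l \<noteq> 0\<close> by simp
  qed
  finally have "(r\<^sup>2 / 2)\<^sup>2 \<le> (\<Sum>l\<in>?K. (b l)\<^sup>2 * (\<theta> l)\<^sup>2 * (1 / (b l)\<^sup>2))\<^sup>2" by (intro power_mono) auto
  also have "\<dots> \<le> (\<Sum>l\<in>?K. ((b l)\<^sup>2 * (\<theta> l)\<^sup>2)\<^sup>2) * (\<Sum>l\<in>?K. (1 / (b l)\<^sup>2)\<^sup>2)"
    by (rule Cauchy_Schwarz_ineq_sum)
  also have "\<dots> \<le> quart \<theta> * M powr (E1 + E2)"
  proof (intro mult_mono)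
    have "(\<Sum>l\<in>?K. ((b l)\<^sup>2 * (\<theta> l)\<^sup>2)\<^sup>2) = (\<Sum>l\<in>?K. (b l) ^ 4 * (\<theta> l) ^ 4)"
      by (simp add: power_mult_distrib flip: power_mult)
    also have "\<dots> \<le> quart \<theta>" unfolding quartic_def
      by (rule finite_sum_le_infsum[OF quartic_summable[OF alternativesD(1)[OF \<theta>]] fin level_set_subset]) simp
    finally show "(\<Sum>l\<in>?K. ((b l)\<^sup>2 * (\<theta> l)\<^sup>2)\<^sup>2) \<le> quart \<theta>" .
    have "(\<Sum>l\<in>?K. (1 / (b l)\<^sup>2)\<^sup>2) \<le> (\<Sum>l\<in>?K. M powr E2)"
    proof (intro sum_mono)
      fix l assume "l \<in> ?K"
      hence l: "l \<in> Nstar d" "(a l)\<^sup>2 \<le> M" using lvl by auto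
      have "(1 / (b l)\<^sup>2)\<^sup>2 = 1 / (b l) ^ 4" by (simp add: power_divide flip: power_mult)
      also have "\<dots> \<le> M powr E2" using b_level[OF l] b_nz[OF l(1)]
        by (simp add: field_simps zero_less_power_eq)
      finally show "(1 / (b l)\<^sup>2)\<^sup>2 \<le> M powr E2" .
    qed
    also have "\<dots> = real (card ?K) * M powr E2" by simp
    also have "\<dots> \<le> M powr E1 * M powr E2"
    proof (intro mult_right_mono)
      have "real (card ?K) \<le> real (card {l \<in> Nstar d. (a l)\<^sup>2 \<le> M})"
        by (intro of_nat_mono card_mono finite_level lvl)
      thus "real (card ?K) \<le> M powr E1" using card_level[OF M] by linarith
    qed simp
    finally show "(\<Sum>l\<in>?K. (1 / (b l)\<^sup>2)\<^sup>2) \<le> M powr (E1 + E2)" by (simp add: powr_add)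
    show "0 \<le> quart \<theta>" unfolding quartic_def by (intro infsum_nonneg) simp
  qed (simp add: sum_nonneg)
  finally have "(r\<^sup>2 / 2)\<^sup>2 * M powr (- (E1 + E2)) \<le> quart \<theta> * M powr (E1 + E2) * M powr (- (E1 + E2))"
    by (intro mult_right_mono) auto
  also have "\<dots> = quart \<theta>" using M by (simp add: mult.assoc flip: powr_add)
  also have "(r\<^sup>2 / 2)\<^sup>2 = r ^ 4 / 4" by (simp add: power_divide flip: power_mult)
  finally show ?thesis by (simp add: M_def)
qed

text \<open>Only the squares of \<open>\<theta>\<close> are prescribed, so every choice of signs is
  covered.\<close>

lemma finite_support_alternative:
  assumes K: "finite K" "K \<subseteq> Nstar d" and q: "\<And>l. l \<in> Nstar d \<Longrightarrow> (\<theta> l)\<^sup>2 = q l"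
    and q0: "\<And>l. l \<in> Nstar d - K \<Longrightarrow> q l = 0"
    and r: "r > 0" "(\<Sum>l\<in>K. q l) = r\<^sup>2" and R: "(\<Sum>l\<in>K. (a l)\<^sup>2 * q l) \<le> R\<^sup>2"
  shows "\<theta> \<in> alts r" "quart \<theta> = (\<Sum>l\<in>K. (b l) ^ 4 * (q l)\<^sup>2)"
proof -
  have z: "(\<theta> l)\<^sup>2 = 0" if "l \<in> Nstar d - K" for l using q q0 that by simp
  have 1: "((\<lambda>l. (\<theta> l)\<^sup>2) has_sum (\<Sum>l\<in>K. (\<theta> l)\<^sup>2)) (Nstar d)"
    by (rule has_sum_finite_support[OF K z])
  have 2: "((\<lambda>l. (a l)\<^sup>2 * (\<theta> l)\<^sup>2) has_sum (\<Sum>l\<in>K. (a l)\<^sup>2 * (\<theta> l)\<^sup>2)) (Nstar d)"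
    by (rule has_sum_finite_support[OF K]) (simp only: z mult_zero_right)
  have 3: "((\<lambda>l. (b l) ^ 4 * (\<theta> l) ^ 4) has_sum (\<Sum>l\<in>K. (b l) ^ 4 * (\<theta> l) ^ 4)) (Nstar d)"
    by (rule has_sum_finite_support[OF K]) (use z in simp)
  have s1: "(\<Sum>l\<in>K. (\<theta> l)\<^sup>2) = (\<Sum>l\<in>K. q l)" by (intro sum.cong refl q) (use K in auto)
  have s2: "(\<Sum>l\<in>K. (a l)\<^sup>2 * (\<theta> l)\<^sup>2) = (\<Sum>l\<in>K. (a l)\<^sup>2 * q l)"
    by (intro sum.cong refl arg_cong2[where f = "(*)"] q) (use K in auto)
  have s3: "(\<Sum>l\<in>K. (b l) ^ 4 * (\<theta> l) ^ 4) = (\<Sum>l\<in>K. (b l) ^ 4 * (q l)\<^sup>2)"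
  proof (intro sum.cong refl)
    fix l assume "l \<in> K"
    hence "l \<in> Nstar d" using K by auto
    have "(\<theta> l) ^ 4 = ((\<theta> l)\<^sup>2)\<^sup>2" by (simp flip: power_mult)
    also have "\<dots> = (q l)\<^sup>2" by (simp only: q[OF \<open>l \<in> Nstar d\<close>])
    finally show "(b l) ^ 4 * (\<theta> l) ^ 4 = (b l) ^ 4 * (q l)\<^sup>2" by simp
  qed
  show "\<theta> \<in> alts r"
    unfolding alternatives_def ellipsoid_def ell2_def ell2_norm_def
    using has_sum_imp_summable[OF 1] has_sum_imp_summable[OF 2] r R
    by (simp add: infsumI[OF 1] infsumI[OF 2] s1 s2)
  show "quart \<theta> = (\<Sum>l\<in>K. (b l) ^ 4 * (q l)\<^sup>2)"
    unfolding quartic_def infsumI[OF 3] s3 ..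
qed

text \<open>Spread \<open>r^2\<close> evenly over the set \<open>Q\<close> from \<open>box\<close>
  with \<open>M = R^2 / r^2\<close>: since \<open>a^2 \<le> M\<close> on \<open>Q\<close>, the
  ellipsoid constraint holds. The radius \<open>R / sqrt M0\<close> guarantees
  \<open>M \<ge> M0\<close>.\<close>

lemma ex_small_quartic:
  "\<exists>C>0. \<exists>r0>0. \<forall>r. 0 < r \<longrightarrow> r \<le> r0 \<longrightarrow>
    (\<exists>\<theta>\<in>alts r. quart \<theta> \<le> C * (r ^ 4 * (R\<^sup>2 / r\<^sup>2) powr (- (E1 + E2))))"
proof -
  obtain c M0 where c: "c > 0" "M0 > 0" and box': "\<And>M. M \<ge> M0 \<Longrightarrow> \<exists>Q. finite Q \<and> Q \<subseteq> Nstar d \<and>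
      (\<forall>l\<in>Q. (a l)\<^sup>2 \<le> M \<and> (b l) ^ 4 * M powr E2 \<le> 1 / c) \<and> c * M powr E1 \<le> real (card Q)"
    using box by blast
  define r0 where "r0 = R / sqrt M0"
  have r0: "r0 > 0" using R_pos c by (simp add: r0_def)
  have "\<exists>\<theta>\<in>alts r. quart \<theta> \<le> 1 / c\<^sup>2 * (r ^ 4 * (R\<^sup>2 / r\<^sup>2) powr (- (E1 + E2)))"
    if r: "0 < r" "r \<le> r0" for r
  proof -
    define M where "M = R\<^sup>2 / r\<^sup>2"
    have M: "M > 0" using R_pos r by (simp add: M_def)
    have "r\<^sup>2 \<le> r0\<^sup>2" using r by (intro power_mono) auto
    also have "\<dots> = R\<^sup>2 / M0" using c by (simp add: r0_def power_divide)
    finally have "M0 \<le> M" using c r by (simp add: M_def field_simps)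
    from box'[OF this] obtain Q where Q: "finite Q" "Q \<subseteq> Nstar d"
      and Qa: "\<And>l. l \<in> Q \<Longrightarrow> (a l)\<^sup>2 \<le> M" and Qb: "\<And>l. l \<in> Q \<Longrightarrow> (b l) ^ 4 * M powr E2 \<le> 1 / c"
      and Qc: "c * M powr E1 \<le> real (card Q)" by blast
    define N where "N = real (card Q)"
    have N: "N > 0" using Qc c M unfolding N_def by (smt (verit) mult_pos_pos powr_gt_zero)
    define q where "q l = (if l \<in> Q then r\<^sup>2 / N else 0)" for l
    define \<theta> where "\<theta> l = sqrt (q l)" for l
    have q0: "q l \<ge> 0" for l using N by (simp add: q_def)
    have sq: "(\<Sum>l\<in>Q. q l) = r\<^sup>2" using N by (simp add: q_def N_def)
    have "(\<Sum>l\<in>Q. (a l)\<^sup>2 * q l) \<le> (\<Sum>l\<in>Q. M * q l)"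
      using Qa q0 by (intro sum_mono mult_right_mono) auto
    also have "\<dots> = M * r\<^sup>2" by (simp only: sum_distrib_left[symmetric] sq)
    also have "\<dots> = R\<^sup>2" using r by (simp add: M_def)
    finally have sa: "(\<Sum>l\<in>Q. (a l)\<^sup>2 * q l) \<le> R\<^sup>2" .
    have th: "(\<theta> l)\<^sup>2 = q l" for l using q0 by (simp add: \<theta>_def)
    have qz: "q l = 0" if "l \<in> Nstar d - Q" for l using that by (simp add: q_def)
    have alt: "\<theta> \<in> alts r" and qq: "quart \<theta> = (\<Sum>l\<in>Q. (b l) ^ 4 * (q l)\<^sup>2)"
      using finite_support_alternative[OF Q th qz r(1) sq sa] by auto
    have "(\<Sum>l\<in>Q. (b l) ^ 4 * (q l)\<^sup>2) \<le> (\<Sum>l\<in>Q. (1 / c * M powr (- E2)) * (r ^ 4 / N\<^sup>2))"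
    proof (intro sum_mono)
      fix l assume l: "l \<in> Q"
      have "(b l) ^ 4 * M powr E2 * M powr (- E2) \<le> 1 / c * M powr (- E2)"
        using Qb[OF l] by (intro mult_right_mono) auto
      hence "(b l) ^ 4 \<le> 1 / c * M powr (- E2)" using M by (simp add: mult.assoc flip: powr_add)
      moreover have "(q l)\<^sup>2 = r ^ 4 / N\<^sup>2" using l by (simp add: q_def power_divide flip: power_mult)
      ultimately show "(b l) ^ 4 * (q l)\<^sup>2 \<le> (1 / c * M powr (- E2)) * (r ^ 4 / N\<^sup>2)"
        by (simp only:) (intro mult_right_mono, auto)
    qed
    also have "\<dots> = 1 / c * M powr (- E2) * r ^ 4 * (1 / N)"
      using N by (simp add: N_def power2_eq_square)
    also have "\<dots> \<le> 1 / c * M powr (- E2) * r ^ 4 * (1 / (c * M powr E1))"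
      using Qc c M r N by (intro mult_left_mono divide_left_mono mult_nonneg_nonneg mult_pos_pos) (auto simp: N_def)
    also have "\<dots> = 1 / c\<^sup>2 * (r ^ 4 * M powr (- (E1 + E2)))"
      by (simp add: power2_eq_square powr_diff powr_minus_divide field_simps powr_add)
    finally show ?thesis unfolding qq[symmetric] M_def by (intro bexI[OF _ alt])
  qed
  thus ?thesis using c r0 by (intro exI[of _ "1 / c\<^sup>2"] conjI exI[of _ r0]) auto
qed

text \<open>In \<open>q = (\<theta> l)^2\<close>, this minimises
  \<open>b^4 * q^2 / 2 - z * (1 - A * a^2) * q\<close> over \<open>q \<ge> 0\<close>:
  \<open>z\<close> is the multiplier of the radius constraint and \<open>z * A\<close> that of the
  ellipsoid constraint.\<close>

definition optimum :: "real \<Rightarrow> real \<Rightarrow> multi_index \<Rightarrow> real" where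
  "optimum A z l = z * max 0 (1 - A * (a l)\<^sup>2) / (b l) ^ 4"

text \<open>The Karush-Kuhn-Tucker conditions; the extremal problem is convex in the squares \<open>(\<theta> l)\<^sup>2\<close>.\<close>

definition saddle :: "real \<Rightarrow> real \<Rightarrow> real \<Rightarrow> bool" where
  "saddle r A z \<longleftrightarrow> A > 0 \<and> z > 0 \<and> (\<Sum>l\<in>level_set A. optimum A z l) = r\<^sup>2 \<and>
    (\<Sum>l\<in>level_set A. (a l)\<^sup>2 * optimum A z l) = R\<^sup>2"

text \<open>Both constraints are linear in \<open>z\<close>, so their ratio is an equation
  \<open>F A = 0\<close> for \<open>A\<close> alone. At \<open>A = 1 / \<rho>\<close> only indices
  with \<open>a^2 < \<rho>\<close> survive and \<open>F\<close> is nonpositive; for small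
  \<open>A\<close> one far index outweighs all negative terms. A zero lies between, and
  \<open>z\<close> is found by scaling.\<close>

lemma ex_saddle:
  assumes r: "r > 0" and l0: "l0 \<in> Nstar d" "(a l0)\<^sup>2 * r\<^sup>2 < R\<^sup>2"
  shows "\<exists>A z. saddle r A z"
proof -
  define \<rho> where "\<rho> = R\<^sup>2 / r\<^sup>2"
  have \<rho>: "\<rho> > 0" using R_pos r by (simp add: \<rho>_def)
  have l0': "(a l0)\<^sup>2 < \<rho>" using l0 r by (simp add: \<rho>_def field_simps)
  \<comment> \<open>Bounds the total negative contribution to \<open>F A\<close>, for every
    \<open>A \<ge> 0\<close>.\<close>
  define Bd where "Bd = (\<Sum>l\<in>{l \<in> Nstar d. (a l)\<^sup>2 \<le> \<rho>}. \<rho> / (b l) ^ 4)"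
  have Bd: "Bd \<ge> 0" unfolding Bd_def using \<rho> by (intro sum_nonneg) auto
  obtain l1 where l1: "l1 \<in> Nstar d" "\<rho> + 2 * Bd + 1 \<le> (a l1)\<^sup>2" using a_unbounded by blast
  \<comment> \<open>Chosen so that \<open>1 - A0 * (a l1)^2 = 1 / 2\<close>. Since
    \<open>(a l1)^2 - \<rho>\<close> exceeds \<open>2 * Bd\<close> and \<open>b^4 \<le> 1\<close>,
    the index \<open>l1\<close> alone contributes at least \<open>Bd\<close>.\<close>
  define A0 where "A0 = 1 / (2 * (a l1)\<^sup>2)"
  have al1: "(a l1)\<^sup>2 > 0" by (rule a_pos[OF l1(1)])
  have A0: "A0 > 0" "A0 \<le> 1 / \<rho>" "1 / A0 = 2 * (a l1)\<^sup>2" "A0 * (a l1)\<^sup>2 = 1 / 2"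
  proof -
    show "A0 \<le> 1 / \<rho>" unfolding A0_def using l1(2) \<rho> Bd by (intro divide_left_mono mult_pos_pos) auto
  qed (use al1 in \<open>auto simp: A0_def\<close>)
  \<comment> \<open>One finite index set containing \<open>level_set A\<close> for all
    \<open>A \<ge> A0\<close>, so that \<open>F\<close> is a fixed finite sum of continuous
    functions.\<close>
  define L where "L = {l \<in> Nstar d. (a l)\<^sup>2 \<le> 1 / A0}"
  have L: "finite L" unfolding L_def by (rule finite_level)
  define g where "g A l = ((a l)\<^sup>2 - \<rho>) * (max 0 (1 - A * (a l)\<^sup>2) / (b l) ^ 4)" for A l
  define F where "F A = (\<Sum>l\<in>L. g A l)" for A
  have "F (1 / \<rho>) \<le> 0"
    unfolding F_def
  proof (intro sum_nonpos)
    fix l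
    show "g (1 / \<rho>) l \<le> 0"
    proof (cases "(a l)\<^sup>2 \<le> \<rho>")
      case True
      thus ?thesis unfolding g_def by (intro mult_nonpos_nonneg) auto
    next
      case False
      hence "1 - 1 / \<rho> * (a l)\<^sup>2 \<le> 0" using \<rho> by (simp add: field_simps)
      thus ?thesis by (simp add: g_def max_def)
    qed
  qed
  moreover have "0 \<le> F A0"
  proof -
    have b4: "(b l) ^ 4 > 0" "(b l) ^ 4 \<le> 1" if "l \<in> Nstar d" for l
    proof -
      have "(b l) ^ 4 = ((b l)\<^sup>2)\<^sup>2" by (simp flip: power_mult)
      thus "(b l) ^ 4 > 0" "(b l) ^ 4 \<le> 1"
        using b_pos[OF that] b_le_1[OF that] power_le_one[of "(b l)\<^sup>2" 2] by auto
    qed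
    have l1L: "l1 \<in> L" using l1 A0(3) by (simp add: L_def)
    have "(\<Sum>l\<in>L. if (a l)\<^sup>2 \<le> \<rho> then \<rho> / (b l) ^ 4 else 0) = (\<Sum>l\<in>{l \<in> L. (a l)\<^sup>2 \<le> \<rho>}. \<rho> / (b l) ^ 4)"
      by (simp only: sum.inter_filter[OF L])
    also have "\<dots> \<le> Bd" unfolding Bd_def L_def using \<rho> by (intro sum_mono2 finite_level) auto
    finally have 1: "(\<Sum>l\<in>L. if (a l)\<^sup>2 \<le> \<rho> then \<rho> / (b l) ^ 4 else 0) \<le> Bd" .
    have 2: "(\<Sum>l\<in>L. if l = l1 then Bd else 0) = Bd" using L l1L by simp
    have "0 \<le> (\<Sum>l\<in>L. (if l = l1 then Bd else 0) - (if (a l)\<^sup>2 \<le> \<rho> then \<rho> / (b l) ^ 4 else 0))"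
      unfolding sum_subtractf 2 using 1 by simp
    also have "\<dots> \<le> F A0" unfolding F_def
    proof (intro sum_mono)
      fix l assume "l \<in> L"
      hence l: "l \<in> Nstar d" by (simp add: L_def)
      define x where "x = max 0 (1 - A0 * (a l)\<^sup>2) / (b l) ^ 4"
      have x: "0 \<le> x" "x \<le> 1 / (b l) ^ 4"
        using A0(1) b4[OF l] by (auto simp: x_def intro!: divide_right_mono)
      have gx: "g A0 l = ((a l)\<^sup>2 - \<rho>) * x" by (simp add: g_def x_def)
      show "(if l = l1 then Bd else 0) - (if (a l)\<^sup>2 \<le> \<rho> then \<rho> / (b l) ^ 4 else 0) \<le> g A0 l"
      proof (cases "(a l)\<^sup>2 \<le> \<rho>")
        case True
        have "\<rho> * x \<le> \<rho> * (1 / (b l) ^ 4)" using x \<rho> by (intro mult_left_mono) auto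
        moreover have "0 \<le> (a l)\<^sup>2 * x" using x by simp
        moreover have "l \<noteq> l1" using True l1 Bd by auto
        ultimately show ?thesis using True by (simp add: gx left_diff_distrib)
      next
        case False
        show ?thesis
        proof (cases "l = l1")
          case True
          have "1 / 2 \<le> x" unfolding x_def True A0(4) using b4[OF l1(1)] by (simp add: field_simps)
          moreover have "2 * Bd \<le> (a l)\<^sup>2 - \<rho>" using l1 True by simp
          ultimately have "2 * Bd * (1 / 2) \<le> ((a l)\<^sup>2 - \<rho>) * x" using Bd by (intro mult_mono) auto
          thus ?thesis unfolding gx using True False by simp
        next
          case l: False
          show ?thesis using l False x by (simp add: gx)
        qed
      qed
    qed
    finally show ?thesis .
  qed
  moreover have "\<forall>x. A0 \<le> x \<and> x \<le> 1 / \<rho> \<longrightarrow> isCont F x"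
  proof (intro allI impI)
    fix x
    have "isCont (\<lambda>A. g A l) x" if "l \<in> L" for l
    proof -
      have "(b l) ^ 4 \<noteq> 0" using that b_nz by (simp add: L_def)
      thus ?thesis unfolding g_def by (intro continuous_intros) auto
    qed
    thus "isCont F x" unfolding F_def by (intro continuous_sum) auto
  qed
  ultimately obtain A where A: "A0 \<le> A" "A \<le> 1 / \<rho>" "F A = 0"
    using IVT2[of F "1 / \<rho>" 0 A0] A0(2) by auto
  have Apos: "A > 0" using A A0 by linarith
  have KL: "level_set A \<subseteq> L"
  proof
    fix l assume l: "l \<in> level_set A"
    have "A0 * (a l)\<^sup>2 \<le> A * (a l)\<^sup>2" using A by (intro mult_right_mono) auto
    thus "l \<in> L" using l A0(1) by (auto simp: level_set_def L_def field_simps)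
  qed
  have g0: "optimum A z l = 0" if "l \<in> Nstar d" "l \<notin> level_set A" for l z
    using that by (auto simp: optimum_def level_set_def max_def)
  \<comment> \<open>Positive because \<open>A \<le> 1 / \<rho>\<close> puts \<open>l0\<close> into
    \<open>level_set A\<close>; this is where \<open>(a l0)^2 * r^2 < R^2\<close> enters.\<close>
  define P where "P = (\<Sum>l\<in>level_set A. max 0 (1 - A * (a l)\<^sup>2) / (b l) ^ 4)"
  have P: "P > 0" unfolding P_def
  proof (rule sum_pos2[OF finite_level_set[OF Apos]])
    have "A * (a l0)\<^sup>2 \<le> 1 / \<rho> * (a l0)\<^sup>2" using A by (intro mult_right_mono) auto
    also have "\<dots> < 1" using l0' \<rho> by (simp add: field_simps)
    finally have *: "A * (a l0)\<^sup>2 < 1" .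
    thus "l0 \<in> level_set A" using l0 by (simp add: level_set_def)
    show "0 < max 0 (1 - A * (a l0)\<^sup>2) / (b l0) ^ 4" using * b_nz[OF l0(1)] by (simp add: zero_less_power_eq)
  qed auto
  define z where "z = r\<^sup>2 / P"
  have z: "z > 0" using P r by (simp add: z_def)
  have opt: "optimum A z l = z * (max 0 (1 - A * (a l)\<^sup>2) / (b l) ^ 4)" for l by (simp add: optimum_def)
  have s1: "(\<Sum>l\<in>level_set A. optimum A z l) = r\<^sup>2"
    unfolding opt sum_distrib_left[symmetric] P_def[symmetric] using P by (simp add: z_def)
  have "(\<Sum>l\<in>level_set A. ((a l)\<^sup>2 - \<rho>) * optimum A z l) = (\<Sum>l\<in>L. ((a l)\<^sup>2 - \<rho>) * optimum A z l)"
    by (rule sum.mono_neutral_left[OF L KL]) (use g0 in \<open>auto simp: L_def\<close>)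
  also have "\<dots> = z * F A" unfolding F_def g_def opt by (simp add: sum_distrib_left mult_ac)
  finally have "(\<Sum>l\<in>level_set A. (a l)\<^sup>2 * optimum A z l) = \<rho> * (\<Sum>l\<in>level_set A. optimum A z l)"
    using A(3) by (simp add: left_diff_distrib sum_subtractf sum_distrib_left)
  also have "\<dots> = R\<^sup>2" unfolding s1 \<rho>_def using r by simp
  finally show ?thesis using s1 z Apos unfolding saddle_def by blast
qed

end

section \<open>Optimality of the saddle point, flatness of the filter and order of the extremal
  value\<close>

context power_ellipsoid
begin

definition optimal_value :: "real \<Rightarrow> real \<Rightarrow> real" where
  "optimal_value A z = (\<Sum>l\<in>level_set A. (b l) ^ 4 * (optimum A z l)\<^sup>2)"

lemma optimum_eq: "l \<in> level_set A \<Longrightarrow> (b l) ^ 4 * optimum A z l = z * (1 - A * (a l)\<^sup>2)"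
  using b_nz[of l] by (auto simp: optimum_def level_set_def)

lemma optimum_zero: "l \<in> Nstar d - level_set A \<Longrightarrow> optimum A z l = 0"
  by (auto simp: optimum_def level_set_def max_def)

lemma optimum_nonneg: "saddle r A z \<Longrightarrow> optimum A z l \<ge> 0"
  by (simp add: optimum_def saddle_def)

text \<open>At the optimum both sides of \<open>level_sum_lower\<close> coincide, because both
  constraints are active; multiplying by \<open>z\<close> turns its right-hand side into the pairing
  with \<open>b^4 * optimum\<close>. After normalisation this says that the mean of the test
  statistic is smallest at the extremal sequence.\<close>

lemma saddle_variational:
  assumes sd: "saddle r A z" and \<theta>: "\<theta> \<in> alts r" "r > 0"
  shows "optimal_value A z \<le> (\<Sum>l\<in>level_set A. (b l) ^ 4 * optimum A z l * (\<theta> l)\<^sup>2)"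
proof -
  have A: "A > 0" and z: "z > 0" and s1: "(\<Sum>l\<in>level_set A. optimum A z l) = r\<^sup>2"
    and s2: "(\<Sum>l\<in>level_set A. (a l)\<^sup>2 * optimum A z l) = R\<^sup>2"
    using sd by (auto simp: saddle_def)
  have "optimal_value A z = (\<Sum>l\<in>level_set A. z * (optimum A z l - A * ((a l)\<^sup>2 * optimum A z l)))"
    unfolding optimal_value_def
  proof (intro sum.cong refl)
    fix l assume "l \<in> level_set A"
    from optimum_eq[OF this, of z]
    have "(b l) ^ 4 * optimum A z l * optimum A z l = z * (1 - A * (a l)\<^sup>2) * optimum A z l" by simp
    thus "(b l) ^ 4 * (optimum A z l)\<^sup>2 = z * (optimum A z l - A * ((a l)\<^sup>2 * optimum A z l))"
      by (simp add: power2_eq_square algebra_simps)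
  qed
  also have "\<dots> = z * (r\<^sup>2 - A * R\<^sup>2)"
    unfolding sum_distrib_left[symmetric] sum_subtractf s1 s2 ..
  also have "\<dots> \<le> z * (\<Sum>l\<in>level_set A. (1 - A * (a l)\<^sup>2) * (\<theta> l)\<^sup>2)"
    using z by (intro mult_left_mono level_sum_lower[OF \<theta> A]) auto
  also have "\<dots> = (\<Sum>l\<in>level_set A. (b l) ^ 4 * optimum A z l * (\<theta> l)\<^sup>2)"
    unfolding sum_distrib_left by (intro sum.cong refl) (simp add: optimum_eq mult.assoc)
  finally show ?thesis .
qed

text \<open>The nonnegative sum of \<open>b^4 * ((\<theta> l)^2 - optimum)^2\<close> equals the
  quartic value minus \<open>2 * X\<close> plus the optimal value, and \<open>X\<close> is at least
  the optimal value. Equality forces every summand to vanish, so the squares of a minimiser are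
  unique.\<close>

lemma quartic_ge_optimal:
  assumes sd: "saddle r A z" and \<theta>: "\<theta> \<in> alts r" "r > 0"
  shows "optimal_value A z \<le> quart \<theta>"
    and "quart \<theta> = optimal_value A z \<Longrightarrow> l \<in> Nstar d \<Longrightarrow> (\<theta> l)\<^sup>2 = optimum A z l"
proof -
  have A: "A > 0" using sd by (auto simp: saddle_def)
  let ?q = "optimum A z" and ?K = "level_set A"
  define X where "X = (\<Sum>l\<in>?K. (b l) ^ 4 * ?q l * (\<theta> l)\<^sup>2)"
  have h1: "((\<lambda>l. (b l) ^ 4 * (\<theta> l) ^ 4) has_sum quart \<theta>) (Nstar d)"
    unfolding quartic_def by (rule has_sum_infsum[OF quartic_summable[OF alternativesD(1)[OF \<theta>]]])
  have h2: "((\<lambda>l. (b l) ^ 4 * ?q l * (\<theta> l)\<^sup>2) has_sum X) (Nstar d)"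
    unfolding X_def by (rule has_sum_finite_support[OF finite_level_set[OF A] level_set_subset])
      (simp only: optimum_zero mult_zero_left mult_zero_right)
  have h3: "((\<lambda>l. (b l) ^ 4 * (?q l)\<^sup>2) has_sum optimal_value A z) (Nstar d)"
    unfolding optimal_value_def by (rule has_sum_finite_support[OF finite_level_set[OF A] level_set_subset])
      (simp add: optimum_zero)
  have hs: "((\<lambda>l. (b l) ^ 4 * ((\<theta> l)\<^sup>2 - ?q l)\<^sup>2) has_sum
    quart \<theta> + ((- 2) * X + optimal_value A z)) (Nstar d)"
  proof -
    have eq: "(b l) ^ 4 * ((\<theta> l)\<^sup>2 - ?q l)\<^sup>2 =
      (b l) ^ 4 * (\<theta> l) ^ 4 + ((- 2) * ((b l) ^ 4 * ?q l * (\<theta> l)\<^sup>2) + (b l) ^ 4 * (?q l)\<^sup>2)" for l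
      by (simp add: eval_nat_numeral algebra_simps)
    show ?thesis unfolding eq by (intro has_sum_add has_sum_cmult_right h1 h2 h3)
  qed
  have ge: "0 \<le> quart \<theta> + ((- 2) * X + optimal_value A z)"
    by (rule has_sum_nonneg[OF hs]) simp
  have X: "optimal_value A z \<le> X" unfolding X_def by (rule saddle_variational[OF sd \<theta>])
  show "optimal_value A z \<le> quart \<theta>" using ge X by linarith
  assume "quart \<theta> = optimal_value A z" and l: "l \<in> Nstar d"
  hence "quart \<theta> + ((- 2) * X + optimal_value A z) \<le> 0" using X by linarith
  hence "(b l) ^ 4 * ((\<theta> l)\<^sup>2 - ?q l)\<^sup>2 = 0"
    by (rule nonneg_has_sum_le_0D[OF hs]) (use l in auto)
  thus "(\<theta> l)\<^sup>2 = ?q l" using b_nz[OF l] by simp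
qed

lemma optimum_attained:
  assumes sd: "saddle r A z" "r > 0" and q: "\<And>l. l \<in> Nstar d \<Longrightarrow> (\<theta> l)\<^sup>2 = optimum A z l"
  shows "\<theta> \<in> alts r" "quart \<theta> = optimal_value A z"
  using finite_support_alternative[OF finite_level_set level_set_subset q optimum_zero sd(2)] sd(1)
  by (auto simp: saddle_def optimal_value_def)

text \<open>\<open>extremal_solution\<close> is an arbitrary choice among minimisers. The square
  roots of \<open>optimum\<close> show that a minimiser exists, and uniqueness of the squares
  identifies the chosen one up to signs.\<close>

lemma extremal_solution_square:
  assumes sd: "saddle r A z" "r > 0"
  shows "l \<in> Nstar d \<Longrightarrow> (extremal_solution d a b R r l)\<^sup>2 = optimum A z l"
    and "quart (extremal_solution d a b R r) = optimal_value A z"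
    and "(INF \<theta>\<in>alts r. quart \<theta>) = optimal_value A z"
proof -
  define \<theta>0 where "\<theta>0 l = sqrt (optimum A z l)" for l
  have "(\<theta>0 l)\<^sup>2 = optimum A z l" for l using optimum_nonneg[OF sd(1)] by (simp add: \<theta>0_def)
  note at = optimum_attained[OF sd this]
  have "is_arg_min quart (\<lambda>\<theta>. \<theta> \<in> alts r) \<theta>0"
    unfolding is_arg_min_def using at quartic_ge_optimal(1)[OF sd(1) _ sd(2)] by (auto simp: not_less)
  hence "is_arg_min quart (\<lambda>\<theta>. \<theta> \<in> alts r) (extremal_solution d a b R r)"
    unfolding extremal_solution_def arg_min_def
    by (rule someI[of "is_arg_min quart (\<lambda>\<theta>. \<theta> \<in> alts r)"])
  hence es: "extremal_solution d a b R r \<in> alts r"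
    and "\<not> quart \<theta>0 < quart (extremal_solution d a b R r)"
    using at(1) unfolding is_arg_min_def by auto
  hence "quart (extremal_solution d a b R r) \<le> optimal_value A z" using at(2) by simp
  with quartic_ge_optimal(1)[OF sd(1) es sd(2)]
  show eq: "quart (extremal_solution d a b R r) = optimal_value A z" by simp
  show "l \<in> Nstar d \<Longrightarrow> (extremal_solution d a b R r l)\<^sup>2 = optimum A z l"
    by (rule quartic_ge_optimal(2)[OF sd(1) es sd(2) eq])
  show "(INF \<theta>\<in>alts r. quart \<theta>) = optimal_value A z"
  proof (rule cInf_eq_minimum)
    show "optimal_value A z \<in> quart ` alts r"
      unfolding at(2)[symmetric] by (rule imageI[OF at(1)])
  qed (use quartic_ge_optimal(1)[OF sd(1) _ sd(2)] in auto)
qed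

lemma optimal_value_pos:
  assumes sd: "saddle r A z" "r > 0" shows "optimal_value A z > 0"
proof -
  define \<theta>0 where "\<theta>0 l = sqrt (optimum A z l)" for l
  have "(\<theta>0 l)\<^sup>2 = optimum A z l" for l using optimum_nonneg[OF sd(1)] by (simp add: \<theta>0_def)
  note at = optimum_attained[OF sd this]
  have "0 < r ^ 4 / 4 * (2 * R\<^sup>2 / r\<^sup>2) powr (- (E1 + E2))"
    using sd(2) R_pos by (intro mult_pos_pos) auto
  thus ?thesis using quartic_lower_bound[OF at(1) sd(2)] at(2) by linarith
qed

definition weight :: "real \<Rightarrow> real \<Rightarrow> multi_index \<Rightarrow> real" where
  "weight A z k = (b k)\<^sup>2 * optimum A z k / sqrt (2 * optimal_value A z)"

text \<open>The active ellipsoid constraint gives \<open>R^2 \<le> M * r^2\<close> for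
  \<open>M = 1 / A\<close>, so \<open>M\<close> is large when \<open>r\<close> is small. A single
  term of the optimal value is at most \<open>z^2 * M powr E2\<close>, whereas the whole is at least
  a constant times \<open>z^2 * M powr (E1 + E2)\<close>; squared weights are of order
  \<open>M powr (- E1)\<close>.\<close>

lemma weight_small:
  assumes \<rho>: "\<rho> > 0"
  shows "\<exists>r0>0. \<forall>r A z. 0 < r \<longrightarrow> r \<le> r0 \<longrightarrow> saddle r A z \<longrightarrow> (\<forall>k\<in>level_set A. weight A z k \<le> \<rho>)"
proof -
  obtain c M0 where c: "c > 0" "M0 > 0" and box': "\<And>M. M \<ge> M0 \<Longrightarrow> \<exists>Q. finite Q \<and> Q \<subseteq> Nstar d \<and>
      (\<forall>l\<in>Q. (a l)\<^sup>2 \<le> M \<and> (b l) ^ 4 * M powr E2 \<le> 1 / c) \<and> c * M powr E1 \<le> real (card Q)"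
    using box by blast
  \<comment> \<open>Collects the constants: \<open>(M / 2) powr (- E1) \<le> y\<close> is exactly
    what makes the final comparison yield \<open>\<rho>\<close>.\<close>
  define y where "y = \<rho>\<^sup>2 * c\<^sup>2 / (2 * 2 powr E2)"
  have y: "y > 0" using \<rho> c by (simp add: y_def)
  define M1 where "M1 = max M0 (y powr (- 1 / E1))"
  have M1: "M1 > 0" "M1 \<ge> M0" "M1 \<ge> y powr (- 1 / E1)" using c by (auto simp: M1_def)
  define r0 where "r0 = R / sqrt (2 * M1)"
  have r0: "r0 > 0" using R_pos M1 by (simp add: r0_def)
  have "weight A z k \<le> \<rho>" if r: "0 < r" "r \<le> r0" and sd: "saddle r A z" and k: "k \<in> level_set A" for r A z k
  proof -
    have A: "A > 0" and z: "z > 0" and s1: "(\<Sum>l\<in>level_set A. optimum A z l) = r\<^sup>2"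
      and s2: "(\<Sum>l\<in>level_set A. (a l)\<^sup>2 * optimum A z l) = R\<^sup>2"
      using sd by (auto simp: saddle_def)
    define M where "M = 1 / A"
    have M: "M > 0" using A by (simp add: M_def)
    have lvl: "(a l)\<^sup>2 \<le> M" if "l \<in> level_set A" for l using level_set_le[OF A] that by (auto simp: M_def)
    have "R\<^sup>2 \<le> (\<Sum>l\<in>level_set A. M * optimum A z l)"
      unfolding s2[symmetric] using lvl optimum_nonneg[OF sd] by (intro sum_mono mult_right_mono) auto
    also have "\<dots> = M * r\<^sup>2" by (simp only: sum_distrib_left[symmetric] s1)
    also have "\<dots> \<le> M * r0\<^sup>2" using r M by (intro mult_left_mono power_mono) auto
    also have "r0\<^sup>2 = R\<^sup>2 / (2 * M1)" using M1 by (simp add: r0_def power_divide)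
    finally have "R\<^sup>2 * (2 * M1) \<le> R\<^sup>2 * M" using M1 by (simp add: field_simps)
    hence MM: "M1 \<le> M / 2" using R_pos by simp
    hence "M0 \<le> M / 2" using M1 by simp
    from box'[OF this] obtain Q where Q: "finite Q" "Q \<subseteq> Nstar d"
      and Qa: "\<And>l. l \<in> Q \<Longrightarrow> (a l)\<^sup>2 \<le> M / 2" and Qb: "\<And>l. l \<in> Q \<Longrightarrow> (b l) ^ 4 * (M / 2) powr E2 \<le> 1 / c"
      and Qc: "c * (M / 2) powr E1 \<le> real (card Q)" by blast
    \<comment> \<open>The box is taken at level \<open>M / 2\<close> and not \<open>M\<close>, so
      that the factor \<open>1 - A * a^2\<close> stays at least \<open>1 / 2\<close> on it.\<close>
    have Ahalf: "A * (a l)\<^sup>2 \<le> 1 / 2" if "l \<in> Q" for l using Qa[OF that] A by (simp add: M_def field_simps)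
    have QK: "Q \<subseteq> level_set A"
    proof
      fix l assume "l \<in> Q"
      thus "l \<in> level_set A" using Ahalf[of l] Q by (auto simp: level_set_def)
    qed
    have opt2: "(b l) ^ 4 * (optimum A z l)\<^sup>2 = z\<^sup>2 * (1 - A * (a l)\<^sup>2)\<^sup>2 * (1 / (b l) ^ 4)" if l: "l \<in> level_set A" for l
    proof -
      have "b l \<noteq> 0" using l level_set_subset b_nz by auto
      hence "(b l) ^ 4 * (optimum A z l)\<^sup>2 = ((b l) ^ 4 * optimum A z l)\<^sup>2 * (1 / (b l) ^ 4)"
        by (simp add: power2_eq_square)
      thus ?thesis by (simp only: optimum_eq[OF l] power_mult_distrib)
    qed
    have "c * (M / 2) powr E1 * (z\<^sup>2 / 4 * (c * (M / 2) powr E2)) \<le> real (card Q) * (z\<^sup>2 / 4 * (c * (M / 2) powr E2))"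
      using Qc c by (intro mult_right_mono) auto
    also have "\<dots> = (\<Sum>l\<in>Q. z\<^sup>2 / 4 * (c * (M / 2) powr E2))" by simp
    also have "\<dots> \<le> (\<Sum>l\<in>Q. (b l) ^ 4 * (optimum A z l)\<^sup>2)"
    proof (intro sum_mono)
      fix l assume l: "l \<in> Q"
      have lK: "l \<in> level_set A" using l QK by auto
      have bl: "(b l) ^ 4 > 0" using l Q b_nz by (auto simp: zero_less_power_eq)
      have "c * (M / 2) powr E2 \<le> 1 / (b l) ^ 4" using Qb[OF l] bl c by (simp add: field_simps)
      moreover have "(1 / 2)\<^sup>2 \<le> (1 - A * (a l)\<^sup>2)\<^sup>2" using Ahalf[OF l] by (intro power_mono) auto
      hence "z\<^sup>2 * (1 / 2)\<^sup>2 \<le> z\<^sup>2 * (1 - A * (a l)\<^sup>2)\<^sup>2" by (intro mult_left_mono) auto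
      hence "z\<^sup>2 / 4 \<le> z\<^sup>2 * (1 - A * (a l)\<^sup>2)\<^sup>2" by (simp add: power_divide)
      ultimately show "z\<^sup>2 / 4 * (c * (M / 2) powr E2) \<le> (b l) ^ 4 * (optimum A z l)\<^sup>2"
        unfolding opt2[OF lK] using c by (intro mult_mono) auto
    qed
    also have "\<dots> \<le> optimal_value A z"
      unfolding optimal_value_def by (intro sum_mono2 finite_level_set[OF A] QK) auto
    finally have ov: "z\<^sup>2 * (c\<^sup>2 / 4 * (M / 2) powr E1 * (M / 2) powr E2) \<le> optimal_value A z"
      by (simp add: power2_eq_square mult_ac)
    have ovpos: "optimal_value A z > 0" by (rule optimal_value_pos[OF sd r(1)])
    have kI: "k \<in> Nstar d" using k level_set_subset by auto
    have b4: "(b k) ^ 4 > 0" using b_nz[OF kI] by (simp add: zero_less_power_eq)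
    have "((b k)\<^sup>2 * optimum A z k)\<^sup>2 = (b k) ^ 4 * (optimum A z k)\<^sup>2"
      by (simp add: power_mult_distrib flip: power_mult)
    also have "\<dots> \<le> z\<^sup>2 * 1 * (M powr E2)"
      unfolding opt2[OF k]
    proof (intro mult_mono)
      show "(1 - A * (a k)\<^sup>2)\<^sup>2 \<le> 1" using k A by (intro power_le_one) (auto simp: level_set_def)
      show "1 / (b k) ^ 4 \<le> M powr E2" using b_level[OF kI lvl[OF k]] b4 by (simp add: field_simps)
    qed auto
    finally have wn: "((b k)\<^sup>2 * optimum A z k)\<^sup>2 \<le> z\<^sup>2 * M powr E2" by simp
    have "(M / 2) powr (- E1) \<le> M1 powr (- E1)" using MM M1 E1_pos by (intro powr_mono2') auto
    also have "\<dots> \<le> (y powr (- 1 / E1)) powr (- E1)" using M1 y E1_pos by (intro powr_mono2') auto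
    also have "\<dots> = y" using E1_pos y by (simp add: powr_powr)
    finally have "1 \<le> y * (M / 2) powr E1" using M by (simp add: powr_minus field_simps)
    hence "M powr E2 * 1 \<le> M powr E2 * (y * (M / 2) powr E1)" by (intro mult_left_mono) auto
    also have "M powr E2 = 2 powr E2 * (M / 2) powr E2" using M by (simp add: powr_divide)
    also have "2 powr E2 * (M / 2) powr E2 * (y * (M / 2) powr E1) =
      2 * \<rho>\<^sup>2 * (c\<^sup>2 / 4 * (M / 2) powr E1 * (M / 2) powr E2)" by (simp add: y_def)
    finally have "z\<^sup>2 * M powr E2 \<le> z\<^sup>2 * (2 * \<rho>\<^sup>2 * (c\<^sup>2 / 4 * (M / 2) powr E1 * (M / 2) powr E2))"
      using M by (intro mult_left_mono) (auto simp: powr_divide)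
    also have "\<dots> \<le> 2 * \<rho>\<^sup>2 * optimal_value A z"
      using mult_left_mono[OF ov, of "2 * \<rho>\<^sup>2"] by (simp add: mult_ac)
    finally have "((b k)\<^sup>2 * optimum A z k)\<^sup>2 \<le> \<rho>\<^sup>2 * (2 * optimal_value A z)" using wn by simp
    also have "\<dots> = (\<rho> * sqrt (2 * optimal_value A z))\<^sup>2" using ovpos by (simp add: power_mult_distrib)
    finally have "(b k)\<^sup>2 * optimum A z k \<le> \<rho> * sqrt (2 * optimal_value A z)"
      by (rule power2_le_imp_le) (use \<rho> ovpos in auto)
    thus ?thesis unfolding weight_def using ovpos by (simp add: pos_divide_le_eq)
  qed
  thus ?thesis using r0 by blast
qed

lemma flat_weight:
  assumes sd: "saddle r A z" "r > 0" and le: "\<forall>k\<in>level_set A. weight A z k \<le> \<rho>"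
  shows "flat_weights (Nstar d) \<rho> (level_set A) (weight A z)"
  unfolding flat_weights_def
proof (intro conjI ballI)
  show "finite (level_set A)" using sd by (intro finite_level_set) (simp add: saddle_def)
  show "level_set A \<subseteq> Nstar d" by (rule level_set_subset)
  have ovpos: "optimal_value A z > 0" by (rule optimal_value_pos[OF sd])
  show "0 \<le> weight A z k" for k unfolding weight_def using ovpos optimum_nonneg[OF sd(1)] by simp
  show "k \<in> level_set A \<Longrightarrow> weight A z k \<le> \<rho>" for k using le by simp
  have "(weight A z k)\<^sup>2 = (b k) ^ 4 * (optimum A z k)\<^sup>2 / (2 * optimal_value A z)" for k
    unfolding weight_def using ovpos by (simp add: power_divide power_mult_distrib flip: power_mult)
  thus "(\<Sum>k\<in>level_set A. (weight A z k)\<^sup>2) = 1 / 2"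
    using ovpos by (simp add: sum_divide_distrib[symmetric] optimal_value_def[symmetric])
qed

lemma extremal_value_eq:
  assumes sd: "saddle r A z" "r > 0"
  shows "extremal \<epsilon> r = sqrt (optimal_value A z / (2 * \<epsilon> ^ 4))"
  unfolding extremal_value_def extremal_solution_square(3)[OF sd] by simp

text \<open>All that the tests need from the extremal problem. The bound over \<open>alts r\<close>
  gives the upper bound; the extremal sequence, with squared signal-to-noise ratios
  \<open>2 * u * w\<close> and free signs, gives the lower bound. \<open>K\<close> and
  \<open>w\<close> do not depend on \<open>\<epsilon>\<close>, only \<open>u\<close> does.\<close>

definition optimal_weights :: "real \<Rightarrow> multi_index set \<Rightarrow> sequence \<Rightarrow> bool" where
  "optimal_weights r K w \<longleftrightarrow>
    (\<forall>k\<in>Nstar d. test_filter d a b R r k = (if k \<in> K then w k else 0)) \<and>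
    (\<forall>\<epsilon>>0. 0 \<le> extremal \<epsilon> r \<and>
      (\<forall>\<theta>\<in>alts r. extremal \<epsilon> r \<le> (\<Sum>k\<in>K. w k * (b k * \<theta> k / \<epsilon>)\<^sup>2)) \<and>
      (\<exists>\<theta>. (\<forall>k\<in>K. (b k * \<theta> k / \<epsilon>)\<^sup>2 = 2 * extremal \<epsilon> r * w k) \<and> (\<forall>k\<in>Nstar d - K. \<theta> k = 0) \<and>
        (\<forall>\<theta>'. (\<forall>k\<in>Nstar d. (\<theta>' k)\<^sup>2 = (\<theta> k)\<^sup>2) \<longrightarrow> \<theta>' \<in> alts r)))"

lemma extremal_weights:
  assumes \<rho>: "\<rho> > 0"
  shows "\<exists>r0>0. \<forall>r. 0 < r \<longrightarrow> r \<le> r0 \<longrightarrow> (\<exists>K w. flat_weights (Nstar d) \<rho> K w \<and> optimal_weights r K w)"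
proof -
  obtain r1 where r1: "r1 > 0" "\<And>r A z. 0 < r \<Longrightarrow> r \<le> r1 \<Longrightarrow> saddle r A z \<Longrightarrow> \<forall>k\<in>level_set A. weight A z k \<le> \<rho>"
    using weight_small[OF \<rho>] by blast
  obtain l0 where l0: "l0 \<in> Nstar d" using a_unbounded by blast
  \<comment> \<open>The second bound gives \<open>(a l0)^2 * r^2 \<le> R^2 / 4\<close>, so that
    \<open>ex_saddle\<close> applies.\<close>
  define r0 where "r0 = min r1 (R / (2 * sqrt ((a l0)\<^sup>2)))"
  have al0: "(a l0)\<^sup>2 > 0" by (rule a_pos[OF l0])
  have r0: "r0 > 0" using r1 R_pos al0 by (simp add: r0_def)
  have "(\<exists>K w. flat_weights (Nstar d) \<rho> K w \<and> optimal_weights r K w)"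
    if r: "0 < r" "r \<le> r0" for r
  proof -
    have "r\<^sup>2 \<le> (R / (2 * sqrt ((a l0)\<^sup>2)))\<^sup>2" using r by (intro power_mono) (auto simp: r0_def)
    also have "\<dots> = R\<^sup>2 / (4 * (a l0)\<^sup>2)" by (simp add: power_divide power_mult_distrib)
    finally have "(a l0)\<^sup>2 * r\<^sup>2 \<le> R\<^sup>2 / 4" using al0 by (simp add: field_simps)
    moreover have "R\<^sup>2 > 0" using R_pos by simp
    ultimately have "(a l0)\<^sup>2 * r\<^sup>2 < R\<^sup>2" by linarith
    from ex_saddle[OF r(1) l0 this] obtain A z where sd: "saddle r A z" by blast
    have ovpos: "optimal_value A z > 0" by (rule optimal_value_pos[OF sd r(1)])
    define V where "V = optimal_value A z"
    have V: "V > 0" using ovpos by (simp add: V_def)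
    have fw: "flat_weights (Nstar d) \<rho> (level_set A) (weight A z)"
      using r r1(2)[OF r(1) _ sd] by (intro flat_weight[OF sd r(1)]) (simp add: r0_def)
    have tf: "\<forall>k\<in>Nstar d. test_filter d a b R r k = (if k \<in> level_set A then weight A z k else 0)"
      unfolding test_filter_def Let_def weight_def
      using extremal_solution_square(1,2)[OF sd r(1)] optimum_zero by simp
    have "0 \<le> extremal \<epsilon> r \<and>
      (\<forall>\<theta>\<in>alts r. extremal \<epsilon> r \<le> (\<Sum>k\<in>level_set A. weight A z k * (b k * \<theta> k / \<epsilon>)\<^sup>2)) \<and>
      (\<exists>\<theta>. (\<forall>k\<in>level_set A. (b k * \<theta> k / \<epsilon>)\<^sup>2 = 2 * extremal \<epsilon> r * weight A z k) \<and>
        (\<forall>k\<in>Nstar d - level_set A. \<theta> k = 0) \<and>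
        (\<forall>\<theta>'. (\<forall>k\<in>Nstar d. (\<theta>' k)\<^sup>2 = (\<theta> k)\<^sup>2) \<longrightarrow> \<theta>' \<in> alts r))" if \<epsilon>: "\<epsilon> > 0" for \<epsilon>
    proof (intro conjI ballI)
      have ev: "extremal \<epsilon> r = sqrt (V / (2 * \<epsilon> ^ 4))"
        unfolding V_def by (rule extremal_value_eq[OF sd r(1)])
      \<comment> \<open>Links the two normalisations: \<open>u\<close> is
        \<open>sqrt (V / (2 * \<epsilon>^4))\<close> while the weights are divided by
        \<open>sqrt (2 * V)\<close>.\<close>
      have "sqrt (2 * V) * sqrt (V / (2 * \<epsilon> ^ 4)) = sqrt ((V / \<epsilon>\<^sup>2)\<^sup>2)"
        unfolding real_sqrt_mult[symmetric]
        by (rule arg_cong[where f = sqrt]) (simp add: power2_eq_square eval_nat_numeral)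
      also have "\<dots> = V / \<epsilon>\<^sup>2" using V by (simp add: real_sqrt_abs)
      finally have ev2: "sqrt (2 * V) * extremal \<epsilon> r = V / \<epsilon>\<^sup>2" by (simp add: ev)
      have s2V: "sqrt (2 * V) > 0" using V by simp
      show "0 \<le> extremal \<epsilon> r" unfolding ev using V by simp
      {
        fix \<theta> assume th: "\<theta> \<in> alts r"
        have "V / \<epsilon>\<^sup>2 \<le> (\<Sum>k\<in>level_set A. (b k) ^ 4 * optimum A z k * (\<theta> k)\<^sup>2) / \<epsilon>\<^sup>2"
          unfolding V_def by (intro divide_right_mono saddle_variational[OF sd th r(1)]) simp
        also have "\<dots> = sqrt (2 * V) * (\<Sum>k\<in>level_set A. weight A z k * (b k * \<theta> k / \<epsilon>)\<^sup>2)"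
          unfolding sum_divide_distrib sum_distrib_left
        proof (intro sum.cong refl)
          fix k
          have "sqrt (2 * V) * weight A z k = (b k)\<^sup>2 * optimum A z k"
            using s2V by (simp add: weight_def V_def[symmetric])
          hence "sqrt (2 * V) * weight A z k * (b k * \<theta> k / \<epsilon>)\<^sup>2 = (b k)\<^sup>2 * optimum A z k * (b k * \<theta> k / \<epsilon>)\<^sup>2"
            by (simp only:)
          also have "\<dots> = (b k) ^ 4 * optimum A z k * (\<theta> k)\<^sup>2 / \<epsilon>\<^sup>2"
            by (simp add: power_mult_distrib power_divide eval_nat_numeral)
          finally show "(b k) ^ 4 * optimum A z k * (\<theta> k)\<^sup>2 / \<epsilon>\<^sup>2 = sqrt (2 * V) * (weight A z k * (b k * \<theta> k / \<epsilon>)\<^sup>2)"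
            by (simp only: mult.assoc)
        qed
        finally show "extremal \<epsilon> r \<le> (\<Sum>k\<in>level_set A. weight A z k * (b k * \<theta> k / \<epsilon>)\<^sup>2)"
          unfolding ev2[symmetric] using s2V by simp
      }
      define \<theta>0 where "\<theta>0 l = sqrt (optimum A z l)" for l
      have th0: "(\<theta>0 l)\<^sup>2 = optimum A z l" for l using optimum_nonneg[OF sd] by (simp add: \<theta>0_def)
      show "\<exists>\<theta>. (\<forall>k\<in>level_set A. (b k * \<theta> k / \<epsilon>)\<^sup>2 = 2 * extremal \<epsilon> r * weight A z k) \<and>
        (\<forall>k\<in>Nstar d - level_set A. \<theta> k = 0) \<and>
        (\<forall>\<theta>'. (\<forall>k\<in>Nstar d. (\<theta>' k)\<^sup>2 = (\<theta> k)\<^sup>2) \<longrightarrow> \<theta>' \<in> alts r)"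
      proof (intro exI[of _ \<theta>0] conjI ballI allI impI)
        fix k
        have "2 * extremal \<epsilon> r * weight A z k = 2 * (V / \<epsilon>\<^sup>2 / sqrt (2 * V)) * ((b k)\<^sup>2 * optimum A z k / sqrt (2 * V))"
          unfolding ev2[symmetric] weight_def V_def[symmetric] using s2V by simp
        also have "\<dots> = 2 * V * ((b k)\<^sup>2 * optimum A z k / \<epsilon>\<^sup>2) / (sqrt (2 * V) * sqrt (2 * V))" by simp
        also have "sqrt (2 * V) * sqrt (2 * V) = 2 * V" using V by simp
        also have "2 * V * ((b k)\<^sup>2 * optimum A z k / \<epsilon>\<^sup>2) / (2 * V) = (b k)\<^sup>2 * optimum A z k / \<epsilon>\<^sup>2" using V by simp
        also have "\<dots> = (b k * \<theta>0 k / \<epsilon>)\<^sup>2" by (simp add: th0 power_mult_distrib power_divide)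
        finally show "(b k * \<theta>0 k / \<epsilon>)\<^sup>2 = 2 * extremal \<epsilon> r * weight A z k" by simp
      next
        fix k assume "k \<in> Nstar d - level_set A"
        thus "\<theta>0 k = 0" by (simp add: \<theta>0_def optimum_zero)
      next
        fix \<theta>' assume "\<forall>k\<in>Nstar d. (\<theta>' k)\<^sup>2 = (\<theta>0 k)\<^sup>2"
        thus "\<theta>' \<in> alts r" by (intro optimum_attained(1)[OF sd r(1)]) (simp add: th0)
      qed
    qed
    with fw tf show ?thesis unfolding optimal_weights_def by blast
  qed
  thus ?thesis using r0 by blast
qed

lemma extremal_value_bounds:
  "\<exists>c>0. \<exists>C>0. \<exists>r0>0. \<forall>r \<epsilon>. 0 < r \<longrightarrow> r \<le> r0 \<longrightarrow> 0 < \<epsilon> \<longrightarrow>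
    c * (r powr (4 + 2 * (E1 + E2)) / \<epsilon> ^ 4) \<le> (extremal \<epsilon> r)\<^sup>2 \<and>
    (extremal \<epsilon> r)\<^sup>2 \<le> C * (r powr (4 + 2 * (E1 + E2)) / \<epsilon> ^ 4)"
proof -
  obtain C r0 where C: "C > 0" "r0 > 0" and ex: "\<And>r. 0 < r \<Longrightarrow> r \<le> r0 \<Longrightarrow>
    \<exists>\<theta>\<in>alts r. quart \<theta> \<le> C * (r ^ 4 * (R\<^sup>2 / r\<^sup>2) powr (- (E1 + E2)))"
    using ex_small_quartic by blast
  define p where "p = R powr (- (2 * (E1 + E2)))"
  define c where "c = 2 powr (- (E1 + E2)) / 4"
  have p: "p > 0" and c: "c > 0" using R_pos by (auto simp: p_def c_def)
  have eq: "r ^ 4 * (R\<^sup>2 / r\<^sup>2) powr (- (E1 + E2)) = p * r powr (4 + 2 * (E1 + E2))" if "r > 0" for r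
  proof -
    have "(R\<^sup>2 / r\<^sup>2) powr (- (E1 + E2)) = (R powr 2) powr (- (E1 + E2)) / (r powr 2) powr (- (E1 + E2))"
      using R_pos that by (simp add: powr_divide)
    also have "(R powr 2) powr (- (E1 + E2)) = p" by (simp add: powr_powr p_def)
    also have "(r powr 2) powr (- (E1 + E2)) = inverse (r powr (2 * (E1 + E2)))"
      by (simp add: powr_powr flip: powr_minus)
    also have "p / inverse (r powr (2 * (E1 + E2))) = p * r powr (2 * (E1 + E2))"
      by (simp add: divide_inverse)
    finally have "r ^ 4 * (R\<^sup>2 / r\<^sup>2) powr (- (E1 + E2)) = p * (r powr 4 * r powr (2 * (E1 + E2)))"
      using that by (simp add: powr_numeral)
    thus ?thesis by (simp add: powr_add)
  qed
  have "c * p / 2 * (r powr (4 + 2 * (E1 + E2)) / \<epsilon> ^ 4) \<le> (extremal \<epsilon> r)\<^sup>2 \<and>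
    (extremal \<epsilon> r)\<^sup>2 \<le> C * p / 2 * (r powr (4 + 2 * (E1 + E2)) / \<epsilon> ^ 4)"
    if r: "0 < r" "r \<le> r0" and \<epsilon>: "\<epsilon> > 0" for r \<epsilon>
  proof -
    define I where "I = (INF \<theta>\<in>alts r. quart \<theta>)"
    obtain \<theta> where \<theta>: "\<theta> \<in> alts r" "quart \<theta> \<le> C * (p * r powr (4 + 2 * (E1 + E2)))"
      using ex[OF r] unfolding eq[OF r(1)] by blast
    have q0: "0 \<le> quart \<theta>" for \<theta> unfolding quartic_def by (intro infsum_nonneg) simp
    have lo: "c * (p * r powr (4 + 2 * (E1 + E2))) \<le> I" unfolding I_def
    proof (rule cINF_greatest)
      fix \<theta> assume th: "\<theta> \<in> alts r"
      have "c * (p * r powr (4 + 2 * (E1 + E2))) = r ^ 4 / 4 * (2 * R\<^sup>2 / r\<^sup>2) powr (- (E1 + E2))"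
        unfolding eq[OF r(1), symmetric] c_def times_divide_eq_right[symmetric]
        by (subst powr_mult) auto
      thus "c * (p * r powr (4 + 2 * (E1 + E2))) \<le> quart \<theta>"
        using quartic_lower_bound[OF th r(1)] by simp
    qed (use \<theta> in auto)
    have "I \<le> quart \<theta>" unfolding I_def using \<theta> q0 by (intro cINF_lower bdd_belowI2[of _ 0]) auto
    hence hi: "I \<le> C * (p * r powr (4 + 2 * (E1 + E2)))" using \<theta> by simp
    have "0 \<le> c * (p * r powr (4 + 2 * (E1 + E2)))" using c p by simp
    hence I0: "I \<ge> 0" using lo by linarith
    have ev: "(extremal \<epsilon> r)\<^sup>2 = I / (2 * \<epsilon> ^ 4)"
      unfolding extremal_value_def I_def[symmetric] using I0 by simp
    show ?thesis unfolding ev using lo hi \<epsilon> by (simp add: field_simps)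
  qed
  thus ?thesis using c p C by (intro exI[of _ "c * p / 2"] conjI exI[of _ "C * p / 2"] exI[of _ r0]) auto
qed

end

section \<open>Separation rates\<close>

text \<open>Provides a factor \<open>g\<close> that diverges at \<open>0\<close>, yet slowly along
  points where the \<open>n\<close>-th property holds. The points \<open>X n\<close> may repeat, so
  \<open>g\<close> uses the least index; \<open>Suc\<close> keeps it positive, and elsewhere it is
  \<open>1 / \<epsilon>\<close>.\<close>

lemma frequently_diagonal_sequence:
  assumes freq: "\<And>n::nat. \<exists>\<^sub>F \<epsilon> in at_right (0::real). P n \<epsilon>"
  obtains X :: "nat \<Rightarrow> real" and g :: "real \<Rightarrow> real" where
    "\<And>n. P n (X n)" "filterlim X (at_right 0) sequentially" "filterlim g at_top (at_right 0)"
    "\<And>n. g (X n) \<le> real (Suc n)" "\<And>\<epsilon>. \<epsilon> > 0 \<Longrightarrow> g \<epsilon> > 0"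
proof -
  have "\<exists>x. 0 < x \<and> x < 1 / real (Suc n) \<and> P n x" for n
  proof -
    have "\<forall>\<^sub>F \<epsilon> in at_right (0::real). \<epsilon> \<in> {0<..<1 / real (Suc n)}"
      by (rule eventually_at_right_real) simp
    from frequently_ex[OF frequently_eventually_frequently[OF freq this]] show ?thesis by auto
  qed
  then obtain X where X: "\<And>n. 0 < X n" "\<And>n. X n < 1 / real (Suc n)" "\<And>n. P n (X n)" by metis
  have lim: "X \<longlonglongrightarrow> 0"
  proof (rule tendsto_sandwich[OF _ _ tendsto_const])
    show "(\<lambda>n. 1 / real (Suc n)) \<longlonglongrightarrow> 0"
      using LIMSEQ_inverse_real_of_nat by (simp add: inverse_eq_divide)
  qed (use X in \<open>auto intro!: always_eventually less_imp_le\<close>)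
  hence flim: "filterlim X (at_right 0) sequentially"
    using X(1) by (auto simp: filterlim_at less_imp_neq[OF X(1), symmetric] intro!: always_eventually)
  define g where "g \<epsilon> = (if \<exists>n. X n = \<epsilon> then real (Suc (LEAST n. X n = \<epsilon>)) else 1 / \<epsilon>)" for \<epsilon>
  have "filterlim g at_top (at_right 0)"
    unfolding filterlim_at_top
  proof
    fix Z :: real
    obtain N :: nat where N: "Z < real N" using reals_Archimedean2 by blast
    \<comment> \<open>Below \<open>\<mu>\<close> none of \<open>X 0\<close>, ..., \<open>X N\<close>
      occurs, so the least index there exceeds \<open>N\<close>.\<close>
    define \<mu> where "\<mu> = Min (insert (1 / (\<bar>Z\<bar> + 1)) (X ` {..N}))"
    have "\<mu> > 0" using X(1) by (simp add: \<mu>_def)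
    hence "\<forall>\<^sub>F \<epsilon> in at_right (0::real). \<epsilon> \<in> {0<..<\<mu>}" by (rule eventually_at_right_real)
    thus "\<forall>\<^sub>F \<epsilon> in at_right 0. Z \<le> g \<epsilon>"
    proof eventually_elim
      case (elim \<epsilon>)
      have small: "\<epsilon> < 1 / (\<bar>Z\<bar> + 1)" "\<And>n. n \<le> N \<Longrightarrow> \<epsilon> < X n" using elim by (auto simp: \<mu>_def)
      show ?case
      proof (cases "\<exists>n. X n = \<epsilon>")
        case True
        define n where "n = (LEAST n. X n = \<epsilon>)"
        have "X n = \<epsilon>" unfolding n_def using True by (rule LeastI_ex)
        hence "\<not> n \<le> N" using small(2)[of n] by auto
        thus ?thesis using True N by (simp add: g_def n_def[symmetric])
      next
        case False
        have "\<bar>Z\<bar> + 1 \<le> 1 / \<epsilon>" using small(1) elim by (simp add: field_simps)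
        thus ?thesis using False by (simp add: g_def)
      qed
    qed
  qed
  moreover have "g (X n) \<le> real (Suc n)" for n
  proof -
    have "(LEAST m. X m = X n) \<le> n" by (rule Least_le) simp
    thus ?thesis unfolding g_def by auto
  qed
  moreover have "g \<epsilon> > 0" if "\<epsilon> > 0" for \<epsilon> using that by (simp add: g_def)
  ultimately show ?thesis using that[of X g] X(3) flim by blast
qed

text \<open>For the converse: if \<open>rs\<close> were not bounded below by a multiple of
  \<open>f\<close>, the radius \<open>rs * g\<close> would dominate \<open>rs\<close> and yet be
  negligible against \<open>f\<close> along a sequence, so \<open>m\<close> would tend to
  \<open>0\<close> and be close to \<open>\<beta>\<close> there. For the other bound,
  \<open>rs / g\<close> is used in the same way.\<close>

lemma separation_rate_iff_same_order:
  fixes m :: "real \<Rightarrow> real \<Rightarrow> real" and f rs :: "real \<Rightarrow> real"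
  assumes f: "\<And>\<epsilon>. \<epsilon> > 0 \<Longrightarrow> f \<epsilon> > 0" and \<beta>: "\<beta> > 0"
    and below: "\<And>\<eta>. \<eta> > 0 \<Longrightarrow> \<exists>c>0. \<forall>\<^sub>F \<epsilon> in at_right 0. \<forall>r. 0 < r \<longrightarrow> r \<le> c * f \<epsilon> \<longrightarrow> \<bar>m \<epsilon> r - \<beta>\<bar> \<le> \<eta>"
    and above: "\<And>\<eta>. \<eta> > 0 \<Longrightarrow> \<exists>c>0. \<forall>\<^sub>F \<epsilon> in at_right 0. \<forall>r. c * f \<epsilon> \<le> r \<longrightarrow> \<bar>m \<epsilon> r\<bar> \<le> \<eta>"
  shows "((\<forall>\<^sub>F \<epsilon> in at_right 0. 0 < rs \<epsilon>) \<and>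
     (\<forall>r. (\<forall>\<epsilon>>0. 0 < r \<epsilon>) \<longrightarrow> ((\<lambda>\<epsilon>. r \<epsilon> / rs \<epsilon>) \<longlongrightarrow> 0) (at_right 0) \<longrightarrow>
        ((\<lambda>\<epsilon>. m \<epsilon> (r \<epsilon>)) \<longlongrightarrow> \<beta>) (at_right 0)) \<and>
     (\<forall>r. (\<forall>\<epsilon>>0. 0 < r \<epsilon>) \<longrightarrow> filterlim (\<lambda>\<epsilon>. r \<epsilon> / rs \<epsilon>) at_top (at_right 0) \<longrightarrow>
        ((\<lambda>\<epsilon>. m \<epsilon> (r \<epsilon>)) \<longlongrightarrow> 0) (at_right 0))) \<longleftrightarrow> same_order rs f"
    (is "?pos \<and> ?lo \<and> ?hi \<longleftrightarrow> _")
proof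
  have ev0: "\<forall>\<^sub>F \<epsilon> in at_right (0::real). \<epsilon> > 0" by (rule eventually_at_right_less)
  assume "same_order rs f"
  then obtain k0 k1 where k: "k0 > 0" "k1 > 0" and so: "\<forall>\<^sub>F \<epsilon> in at_right 0. k0 * f \<epsilon> \<le> rs \<epsilon> \<and> rs \<epsilon> \<le> k1 * f \<epsilon>"
    unfolding same_order_def by auto
  have pos: ?pos using so ev0
  proof eventually_elim
    case (elim \<epsilon>)
    have "0 < k0 * f \<epsilon>" using k f elim by simp
    thus ?case using elim by linarith
  qed
  moreover have ?lo
  proof (intro allI impI tendstoI)
    fix r and e :: real assume r: "\<forall>\<epsilon>>0. 0 < r \<epsilon>" and lim: "((\<lambda>\<epsilon>. r \<epsilon> / rs \<epsilon>) \<longlongrightarrow> 0) (at_right 0)" and e: "e > 0"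
    obtain c where c: "c > 0" "\<forall>\<^sub>F \<epsilon> in at_right 0. \<forall>r. 0 < r \<longrightarrow> r \<le> c * f \<epsilon> \<longrightarrow> \<bar>m \<epsilon> r - \<beta>\<bar> \<le> e / 2"
      using below[of "e / 2"] e by auto
    have "\<forall>\<^sub>F \<epsilon> in at_right 0. r \<epsilon> / rs \<epsilon> < c / k1" using order_tendstoD(2)[OF lim] c k by simp
    thus "\<forall>\<^sub>F \<epsilon> in at_right 0. dist (m \<epsilon> (r \<epsilon>)) \<beta> < e" using c(2) so pos ev0
    proof eventually_elim
      case (elim \<epsilon>)
      have "r \<epsilon> \<le> c / k1 * rs \<epsilon>" using elim by (simp add: pos_divide_less_eq)
      also have "\<dots> \<le> c / k1 * (k1 * f \<epsilon>)" using elim c k by (intro mult_left_mono) auto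
      also have "\<dots> = c * f \<epsilon>" using k by simp
      finally have "\<bar>m \<epsilon> (r \<epsilon>) - \<beta>\<bar> \<le> e / 2" using elim r by simp
      thus ?case using e by (simp add: dist_real_def)
    qed
  qed
  moreover have ?hi
  proof (intro allI impI tendstoI)
    fix r and e :: real assume r: "\<forall>\<epsilon>>0. 0 < r \<epsilon>" and lim: "filterlim (\<lambda>\<epsilon>. r \<epsilon> / rs \<epsilon>) at_top (at_right 0)" and e: "e > 0"
    obtain c where c: "c > 0" "\<forall>\<^sub>F \<epsilon> in at_right 0. \<forall>r. c * f \<epsilon> \<le> r \<longrightarrow> \<bar>m \<epsilon> r\<bar> \<le> e / 2"
      using above[of "e / 2"] e by auto
    have "\<forall>\<^sub>F \<epsilon> in at_right 0. c / k0 \<le> r \<epsilon> / rs \<epsilon>" using lim by (simp add: filterlim_at_top)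
    thus "\<forall>\<^sub>F \<epsilon> in at_right 0. dist (m \<epsilon> (r \<epsilon>)) 0 < e" using c(2) so pos
    proof eventually_elim
      case (elim \<epsilon>)
      have "c * f \<epsilon> = c / k0 * (k0 * f \<epsilon>)" using k by simp
      also have "\<dots> \<le> c / k0 * rs \<epsilon>" using elim c k by (intro mult_left_mono) auto
      also have "\<dots> \<le> r \<epsilon>" using elim by (simp add: pos_le_divide_eq)
      finally have "\<bar>m \<epsilon> (r \<epsilon>)\<bar> \<le> e / 2" using elim by simp
      thus ?case using e by (simp add: dist_real_def)
    qed
  qed
  ultimately show "?pos \<and> ?lo \<and> ?hi" by blast
next
  have ev0: "\<forall>\<^sub>F \<epsilon> in at_right (0::real). \<epsilon> > 0" by (rule eventually_at_right_less)
  assume asm: "?pos \<and> ?lo \<and> ?hi"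
  hence pos: ?pos and lo: ?lo and hi: ?hi by blast+
  have "\<exists>k0>0. \<forall>\<^sub>F \<epsilon> in at_right 0. k0 * f \<epsilon> \<le> rs \<epsilon>"
  proof (rule ccontr)
    assume neg: "\<not> ?thesis"
    \<comment> \<open>The square leaves a factor \<open>1 / (n + 1)\<close> after multiplication by
      \<open>g (X n) \<le> n + 1\<close>.\<close>
    have fr: "\<exists>\<^sub>F \<epsilon> in at_right 0. rs \<epsilon> < f \<epsilon> / (real (Suc n))\<^sup>2 \<and> (0 < rs \<epsilon> \<and> 0 < \<epsilon>)" for n
    proof -
      have "0 < 1 / (real (Suc n))\<^sup>2" by simp
      with neg have "\<exists>\<^sub>F \<epsilon> in at_right 0. \<not> 1 / (real (Suc n))\<^sup>2 * f \<epsilon> \<le> rs \<epsilon>"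
        unfolding not_eventually[symmetric] by blast
      from frequently_eventually_frequently[OF this eventually_conj[OF pos ev0]] show ?thesis by (simp add: not_le)
    qed
    obtain X g where X: "\<And>n. rs (X n) < f (X n) / (real (Suc n))\<^sup>2 \<and> (0 < rs (X n) \<and> 0 < X n)"
      "filterlim X (at_right 0) sequentially" "filterlim g at_top (at_right 0)"
      "\<And>n. g (X n) \<le> real (Suc n)" "\<And>\<epsilon>. \<epsilon> > 0 \<Longrightarrow> g \<epsilon> > 0"
      using frequently_diagonal_sequence[of "\<lambda>n \<epsilon>. rs \<epsilon> < f \<epsilon> / (real (Suc n))\<^sup>2 \<and> (0 < rs \<epsilon> \<and> 0 < \<epsilon>)", OF fr] by blast
    \<comment> \<open>\<open>rs\<close> is positive only for small noise levels, whereas a competing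
      radius has to be positive everywhere; hence the default \<open>1\<close>.\<close>
    define r where "r \<epsilon> = (if 0 < rs \<epsilon> then rs \<epsilon> * g \<epsilon> else 1)" for \<epsilon>
    have "\<forall>\<epsilon>>0. 0 < r \<epsilon>" using X(5) by (simp add: r_def)
    moreover have "filterlim (\<lambda>\<epsilon>. r \<epsilon> / rs \<epsilon>) at_top (at_right 0)"
      by (rule filterlim_cong[THEN iffD1, OF refl refl _ X(3)])
        (use pos in eventually_elim, simp add: r_def)
    ultimately have "((\<lambda>\<epsilon>. m \<epsilon> (r \<epsilon>)) \<longlongrightarrow> 0) (at_right 0)" using hi by blast
    hence "(\<lambda>n. m (X n) (r (X n))) \<longlonglongrightarrow> 0" using X(2) by (rule filterlim_compose)
    from tendstoD[OF this, of "\<beta> / 2"] \<beta>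
    have e1: "\<forall>\<^sub>F n in sequentially. \<bar>m (X n) (r (X n))\<bar> < \<beta> / 2" by simp
    obtain c where c: "c > 0" "\<forall>\<^sub>F \<epsilon> in at_right 0. \<forall>r. 0 < r \<longrightarrow> r \<le> c * f \<epsilon> \<longrightarrow> \<bar>m \<epsilon> r - \<beta>\<bar> \<le> \<beta> / 2"
      using below[of "\<beta> / 2"] \<beta> by auto
    have e2: "\<forall>\<^sub>F n in sequentially. \<forall>r. 0 < r \<longrightarrow> r \<le> c * f (X n) \<longrightarrow> \<bar>m (X n) r - \<beta>\<bar> \<le> \<beta> / 2"
      using X(2) c(2) unfolding filterlim_iff by blast
    obtain N :: nat where N: "1 / c < real N" using reals_Archimedean2 by blast
    have "\<forall>\<^sub>F n in sequentially. False"
      using e1 e2 eventually_ge_at_top[of N]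
    proof eventually_elim
      case (elim n)
      have fp: "0 < f (X n)" using f X(1) by blast
      have "r (X n) = rs (X n) * g (X n)" using X(1) by (simp add: r_def)
      also have "\<dots> \<le> f (X n) / (real (Suc n))\<^sup>2 * real (Suc n)"
        using X(1)[of n] X(4)[of n] X(5)[of "X n"] by (intro mult_mono) auto
      also have "\<dots> = 1 / real (Suc n) * f (X n)" by (simp add: power2_eq_square del: of_nat_Suc)
      also have "\<dots> \<le> c * f (X n)"
      proof (intro mult_right_mono)
        have "1 / c \<le> real (Suc n)" using N elim(3) by simp
        thus "1 / real (Suc n) \<le> c" using c(1) by (simp add: field_simps)
      qed (use fp in auto)
      finally have le: "r (X n) \<le> c * f (X n)" .
      have "0 < r (X n)" using X(1,5) by (simp add: r_def)
      with elim(1,2) le show False by fastforce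
    qed
    thus False by simp
  qed
  then obtain k0 where k0: "k0 > 0" "\<forall>\<^sub>F \<epsilon> in at_right 0. k0 * f \<epsilon> \<le> rs \<epsilon>" by blast
  have "\<exists>k1>0. \<forall>\<^sub>F \<epsilon> in at_right 0. rs \<epsilon> \<le> k1 * f \<epsilon>"
  proof (rule ccontr)
    assume neg: "\<not> ?thesis"
    have fr: "\<exists>\<^sub>F \<epsilon> in at_right 0. (real (Suc n))\<^sup>2 * f \<epsilon> < rs \<epsilon> \<and> (0 < rs \<epsilon> \<and> 0 < \<epsilon>)" for n
    proof -
      have "0 < (real (Suc n))\<^sup>2" by simp
      with neg have "\<exists>\<^sub>F \<epsilon> in at_right 0. \<not> rs \<epsilon> \<le> (real (Suc n))\<^sup>2 * f \<epsilon>"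
        unfolding not_eventually[symmetric] by blast
      from frequently_eventually_frequently[OF this eventually_conj[OF pos ev0]] show ?thesis by (simp only: not_le)
    qed
    obtain X g where X: "\<And>n. (real (Suc n))\<^sup>2 * f (X n) < rs (X n) \<and> (0 < rs (X n) \<and> 0 < X n)"
      "filterlim X (at_right 0) sequentially" "filterlim g at_top (at_right 0)"
      "\<And>n. g (X n) \<le> real (Suc n)" "\<And>\<epsilon>. \<epsilon> > 0 \<Longrightarrow> g \<epsilon> > 0"
      using frequently_diagonal_sequence[of "\<lambda>n \<epsilon>. (real (Suc n))\<^sup>2 * f \<epsilon> < rs \<epsilon> \<and> (0 < rs \<epsilon> \<and> 0 < \<epsilon>)", OF fr] by blast
    define r where "r \<epsilon> = (if 0 < rs \<epsilon> then rs \<epsilon> / g \<epsilon> else 1)" for \<epsilon>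
    have "\<forall>\<epsilon>>0. 0 < r \<epsilon>" using X(5) by (simp add: r_def)
    moreover have "((\<lambda>\<epsilon>. r \<epsilon> / rs \<epsilon>) \<longlongrightarrow> 0) (at_right 0)"
      by (rule filterlim_cong[THEN iffD1, OF refl refl _ tendsto_inverse_0_at_top[OF X(3)]])
        (use pos in eventually_elim, simp add: r_def inverse_eq_divide)
    ultimately have "((\<lambda>\<epsilon>. m \<epsilon> (r \<epsilon>)) \<longlongrightarrow> \<beta>) (at_right 0)" using lo by blast
    hence "(\<lambda>n. m (X n) (r (X n))) \<longlonglongrightarrow> \<beta>" using X(2) by (rule filterlim_compose)
    from tendstoD[OF this, of "\<beta> / 2"] \<beta>
    have e1: "\<forall>\<^sub>F n in sequentially. \<bar>m (X n) (r (X n)) - \<beta>\<bar> < \<beta> / 2" by (simp add: dist_real_def)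
    obtain c where c: "c > 0" "\<forall>\<^sub>F \<epsilon> in at_right 0. \<forall>r. c * f \<epsilon> \<le> r \<longrightarrow> \<bar>m \<epsilon> r\<bar> \<le> \<beta> / 2"
      using above[of "\<beta> / 2"] \<beta> by auto
    have e2: "\<forall>\<^sub>F n in sequentially. \<forall>r. c * f (X n) \<le> r \<longrightarrow> \<bar>m (X n) r\<bar> \<le> \<beta> / 2"
      using X(2) c(2) unfolding filterlim_iff by blast
    obtain N :: nat where N: "c < real N" using reals_Archimedean2 by blast
    have "\<forall>\<^sub>F n in sequentially. False"
      using e1 e2 eventually_ge_at_top[of N]
    proof eventually_elim
      case (elim n)
      have fp: "0 < f (X n)" using f X(1) by blast
      have "c * f (X n) \<le> real (Suc n) * f (X n)" using N elim(3) fp by (intro mult_right_mono) auto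
      also have "\<dots> = (real (Suc n))\<^sup>2 * f (X n) / real (Suc n)" by (simp add: power2_eq_square del: of_nat_Suc)
      also have "\<dots> \<le> rs (X n) / g (X n)"
        using X(1)[of n] X(4)[of n] X(5)[of "X n"] fp by (intro frac_le) auto
      also have "\<dots> = r (X n)" using X(1) by (simp add: r_def)
      finally have "\<bar>m (X n) (r (X n))\<bar> \<le> \<beta> / 2" using elim(2) by blast
      thus False using elim(1) by linarith
    qed
    thus False by simp
  qed
  then obtain k1 where k1: "k1 > 0" "\<forall>\<^sub>F \<epsilon> in at_right 0. rs \<epsilon> \<le> k1 * f \<epsilon>" by blast
  from eventually_conj[OF k0(2) k1(2)] k0(1) k1(1) show "same_order rs f"
    unfolding same_order_def by blast
qed


section \<open>Tests in the sequence model\<close>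

lemma noise_law_eq: "noise_law d = gauss (Nstar d)"
  by (simp add: noise_law_def)

lemma sets_obs_space: "sets (obs_space d) = sets (gauss (Nstar d))"
  by (simp only: obs_space_def sets_gauss)

lemma measurable_observation:
  "(\<lambda>\<xi>. \<lambda>l\<in>Nstar d. v l + \<epsilon> * \<xi> l) \<in> gauss (Nstar d) \<rightarrow>\<^sub>M obs_space d"
  unfolding obs_space_def by (intro measurable_restrict) measurable

lemma prob_space_obs_law: "prob_space (obs_law d b \<epsilon> \<theta>)"
  unfolding obs_law_def noise_law_eq
  by (rule prob_space.prob_space_distr[OF prob_space_gauss measurable_observation])

lemma obs_law_measure:
  assumes "Z \<in> sets (obs_space d)"
  shows "measure (obs_law d b \<epsilon> \<theta>) Z =
    measure (gauss (Nstar d)) {\<xi> \<in> space (gauss (Nstar d)). (\<lambda>l\<in>Nstar d. b l * \<theta> l + \<epsilon> * \<xi> l) \<in> Z}"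
  unfolding obs_law_def noise_law_eq
  by (subst measure_distr[OF measurable_observation assms])
    (rule arg_cong[where f = "measure _"], auto)

lemma test_sets:
  assumes "\<psi> \<in> obs_space d \<rightarrow>\<^sub>M count_space {0, 1::nat}"
  shows "{y \<in> space (obs_space d). \<psi> y = 0} \<in> sets (obs_space d)"
    and "{y \<in> space (obs_space d). \<psi> y = 1} = space (obs_space d) - {y \<in> space (obs_space d). \<psi> y = 0}"
proof -
  have "\<psi> -` {0} \<inter> space (obs_space d) \<in> sets (obs_space d)"
    by (rule measurable_sets[OF assms]) auto
  also have "\<psi> -` {0} \<inter> space (obs_space d) = {y \<in> space (obs_space d). \<psi> y = 0}" by auto
  finally show "{y \<in> space (obs_space d). \<psi> y = 0} \<in> sets (obs_space d)" .
  show "{y \<in> space (obs_space d). \<psi> y = 1} = space (obs_space d) - {y \<in> space (obs_space d). \<psi> y = 0}"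
    using measurable_space[OF assms] by fastforce
qed

abbreviation accept_prob :: "nat \<Rightarrow> sequence \<Rightarrow> real \<Rightarrow> sequence \<Rightarrow> (sequence \<Rightarrow> nat) \<Rightarrow> real" where
  "accept_prob d b \<epsilon> \<theta> \<psi> \<equiv> measure (obs_law d b \<epsilon> \<theta>) {y \<in> space (obs_space d). \<psi> y = 0}"

abbreviation reject_prob :: "nat \<Rightarrow> sequence \<Rightarrow> real \<Rightarrow> sequence \<Rightarrow> (sequence \<Rightarrow> nat) \<Rightarrow> real" where
  "reject_prob d b \<epsilon> \<theta> \<psi> \<equiv> measure (obs_law d b \<epsilon> \<theta>) {y \<in> space (obs_space d). \<psi> y = 1}"

lemma obs_law_test_1:
  assumes "\<psi> \<in> obs_space d \<rightarrow>\<^sub>M count_space {0, 1::nat}"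
  shows "reject_prob d b \<epsilon> \<theta> \<psi> =
    1 - accept_prob d b \<epsilon> \<theta> \<psi>"
proof -
  interpret prob_space "obs_law d b \<epsilon> \<theta>" by (rule prob_space_obs_law)
  have eq: "sets (obs_law d b \<epsilon> \<theta>) = sets (obs_space d)" "space (obs_law d b \<epsilon> \<theta>) = space (obs_space d)"
    by (simp_all add: obs_law_def)
  show ?thesis unfolding test_sets(2)[OF assms]
    using prob_compl[of "{y \<in> space (obs_space d). \<psi> y = 0}"] test_sets(1)[OF assms] unfolding eq by blast
qed

lemma second_kind_error_ge:
  assumes "\<theta> \<in> \<Theta>"
  shows "accept_prob d b \<epsilon> \<theta> \<psi> \<le> second_kind_error d b \<epsilon> \<Theta> \<psi>"
  unfolding second_kind_error_def
proof (rule cSup_upper)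
  show "bdd_above (insert 0 ((\<lambda>\<theta>. accept_prob d b \<epsilon> \<theta> \<psi>) ` \<Theta>))"
    using prob_space.prob_le_1[OF prob_space_obs_law] by (intro bdd_aboveI[of _ 1]) auto
qed (use assms in auto)

lemma second_kind_error_le:
  assumes "0 \<le> x" "\<And>\<theta>. \<theta> \<in> \<Theta> \<Longrightarrow> accept_prob d b \<epsilon> \<theta> \<psi> \<le> x"
  shows "second_kind_error d b \<epsilon> \<Theta> \<psi> \<le> x"
  unfolding second_kind_error_def by (rule cSup_least) (use assms in auto)

lemma second_kind_error_nonneg: "0 \<le> second_kind_error d b \<epsilon> \<Theta> \<psi>"
  unfolding second_kind_error_def
proof (rule cSup_upper)
  show "bdd_above (insert 0 ((\<lambda>\<theta>. accept_prob d b \<epsilon> \<theta> \<psi>) ` \<Theta>))"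
    using prob_space.prob_le_1[OF prob_space_obs_law] by (intro bdd_aboveI[of _ 1]) auto
qed simp

lemma second_kind_error_mono:
  assumes "\<Theta> \<subseteq> \<Theta>'" shows "second_kind_error d b \<epsilon> \<Theta> \<psi> \<le> second_kind_error d b \<epsilon> \<Theta>' \<psi>"
  by (rule second_kind_error_le[OF second_kind_error_nonneg], rule second_kind_error_ge) (use assms in auto)

lemma minimax_error_le:
  assumes "level_test d b \<epsilon> c \<psi>" shows "minimax_error d b \<epsilon> \<Theta> c \<le> second_kind_error d b \<epsilon> \<Theta> \<psi>"
  unfolding minimax_error_def
  by (rule cInf_lower) (use assms second_kind_error_nonneg in \<open>auto intro!: bdd_belowI[of _ 0]\<close>)

text \<open>For \<open>c \<ge> 0\<close> the test that never rejects is admissible, so the infimum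
  is over a nonempty set.\<close>

lemma minimax_error_ge:
  assumes "0 \<le> c" "\<And>\<psi>. level_test d b \<epsilon> c \<psi> \<Longrightarrow> x \<le> second_kind_error d b \<epsilon> \<Theta> \<psi>"
  shows "x \<le> minimax_error d b \<epsilon> \<Theta> c"
  unfolding minimax_error_def
proof (rule cInf_greatest)
  have "level_test d b \<epsilon> c (\<lambda>_. 0)" using assms(1) by (simp add: level_test_def)
  thus "{second_kind_error d b \<epsilon> \<Theta> \<psi> |\<psi>. level_test d b \<epsilon> c \<psi>} \<noteq> {}" by blast
qed (use assms in auto)

lemma minimax_error_nonneg: "0 \<le> c \<Longrightarrow> 0 \<le> minimax_error d b \<epsilon> \<Theta> c"
  by (rule minimax_error_ge) (auto simp: second_kind_error_nonneg)

lemma minimax_error_mono: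
  assumes "0 \<le> c" "\<Theta> \<subseteq> \<Theta>'" shows "minimax_error d b \<epsilon> \<Theta> c \<le> minimax_error d b \<epsilon> \<Theta>' c"
  by (rule minimax_error_ge[OF assms(1)])
    (rule order_trans[OF minimax_error_le second_kind_error_mono[OF assms(2)]])

lemma alternatives_antimono: "r \<le> r' \<Longrightarrow> alternatives d a R r' \<subseteq> alternatives d a R r"
  by (auto simp: alternatives_def)

section \<open>Errors of the threshold tests and a lower bound for arbitrary tests\<close>

context power_ellipsoid
begin

text \<open>The filter has finite support, so the statistic is a finite sum and measurable. Dividing
  the data by \<open>\<epsilon>\<close> turns the observation into standard Gaussian noise shifted
  by \<open>b * \<theta> / \<epsilon>\<close>.\<close>

lemma threshold_test_properties:
  assumes fw: "flat_weights (Nstar d) \<rho> K w"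
    and tf: "\<forall>k\<in>Nstar d. test_filter d a b R r k = (if k \<in> K then w k else 0)" and \<epsilon>: "\<epsilon> > 0"
  shows "threshold \<epsilon> r h \<in> obs_space d \<rightarrow>\<^sub>M count_space {0, 1}"
    and "accept_prob d b \<epsilon> \<theta> (threshold \<epsilon> r h) =
      measure (gauss (Nstar d)) {z \<in> space (gauss (Nstar d)). (\<Sum>k\<in>K. w k * ((z k + b k * \<theta> k / \<epsilon>)\<^sup>2 - 1)) \<le> h}"
proof -
  have K: "finite K" "K \<subseteq> Nstar d" using fw by (auto simp: flat_weights_def)
  have T: "test_statistic d a b R \<epsilon> r y = (\<Sum>k\<in>K. w k * ((y k / \<epsilon>)\<^sup>2 - 1))" for y
  proof -
    have "((\<lambda>k. test_filter d a b R r k * ((y k / \<epsilon>)\<^sup>2 - 1)) has_sum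
      (\<Sum>k\<in>K. test_filter d a b R r k * ((y k / \<epsilon>)\<^sup>2 - 1))) (Nstar d)"
      by (rule has_sum_finite_support[OF K]) (use tf in auto)
    hence "test_statistic d a b R \<epsilon> r y = (\<Sum>k\<in>K. test_filter d a b R r k * ((y k / \<epsilon>)\<^sup>2 - 1))"
      unfolding test_statistic_def by (rule infsumI)
    also have "\<dots> = (\<Sum>k\<in>K. w k * ((y k / \<epsilon>)\<^sup>2 - 1))"
      by (intro sum.cong refl) (use tf K in auto)
    finally show ?thesis .
  qed
  have KI: "k \<in> K \<Longrightarrow> k \<in> Nstar d" for k using K by auto
  have mT: "(\<lambda>y. test_statistic d a b R \<epsilon> r y) \<in> borel_measurable (obs_space d)"
    unfolding T obs_space_def using KI by measurable
  have Z1: "{y \<in> space (obs_space d). h < test_statistic d a b R \<epsilon> r y} \<in> sets (obs_space d)"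
    by (rule borel_measurable_less[OF borel_measurable_const mT])
  have Z0: "{y \<in> space (obs_space d). test_statistic d a b R \<epsilon> r y \<le> h} \<in> sets (obs_space d)"
    by (rule borel_measurable_le[OF mT borel_measurable_const])
  show "threshold \<epsilon> r h \<in> obs_space d \<rightarrow>\<^sub>M count_space {0, 1}"
  proof (rule measurableI)
    show "threshold \<epsilon> r h y \<in> space (count_space {0, 1})" for y
      by (simp add: threshold_test_def)
    fix S :: "nat set"
    have eq: "threshold \<epsilon> r h -` S \<inter> space (obs_space d) =
      (if 1 \<in> S then {y \<in> space (obs_space d). h < test_statistic d a b R \<epsilon> r y} else {}) \<union>
      (if 0 \<in> S then {y \<in> space (obs_space d). test_statistic d a b R \<epsilon> r y \<le> h} else {})"
      by (auto simp: threshold_test_def not_less of_bool_def split: if_splits)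
    have if_sets: "(if p then A else {}) \<in> sets (obs_space d)" if "A \<in> sets (obs_space d)" for p A
      using that by (cases p) (simp_all only: if_True if_False sets.empty_sets)
    show "threshold \<epsilon> r h -` S \<inter> space (obs_space d) \<in> sets (obs_space d)"
      unfolding eq by (intro sets.Un if_sets Z0 Z1)
  qed
  have eq0: "{y \<in> space (obs_space d). threshold \<epsilon> r h y = 0} =
    {y \<in> space (obs_space d). test_statistic d a b R \<epsilon> r y \<le> h}"
    by (auto simp: threshold_test_def not_less)
  show "accept_prob d b \<epsilon> \<theta> (threshold \<epsilon> r h) =
      measure (gauss (Nstar d)) {z \<in> space (gauss (Nstar d)). (\<Sum>k\<in>K. w k * ((z k + b k * \<theta> k / \<epsilon>)\<^sup>2 - 1)) \<le> h}"
    unfolding eq0 obs_law_measure[OF Z0]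
  proof (rule arg_cong[where f = "measure _"], rule Collect_cong, rule conj_cong[OF refl])
    fix z assume z: "z \<in> space (gauss (Nstar d))"
    have "test_statistic d a b R \<epsilon> r (\<lambda>l\<in>Nstar d. b l * \<theta> l + \<epsilon> * z l) = (\<Sum>k\<in>K. w k * ((z k + b k * \<theta> k / \<epsilon>)\<^sup>2 - 1))"
      unfolding T using \<epsilon> KI by (intro sum.cong refl) (simp add: add_divide_distrib add.commute)
    thus "((\<lambda>l\<in>Nstar d. b l * \<theta> l + \<epsilon> * z l) \<in> {y \<in> space (obs_space d). test_statistic d a b R \<epsilon> r y \<le> h}) =
      ((\<Sum>k\<in>K. w k * ((z k + b k * \<theta> k / \<epsilon>)\<^sup>2 - 1)) \<le> h)"
      using measurable_space[OF measurable_observation z] by simp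
  qed
qed

text \<open>The threshold \<open>h\<close> is left free within a bounded range, because an exact
  level constraint needs one slightly above the quantile. The bound over every class
  \<open>\<Theta>\<close> reflects that a shift never lowers the mean of the statistic; it serves
  radii that are too small for the weights to be adapted to them.\<close>

lemma threshold_test_errors:
  assumes "\<eta> > 0"
  shows "\<exists>r0>0. \<forall>r \<epsilon> h. 0 < r \<longrightarrow> r \<le> r0 \<longrightarrow> 0 < \<epsilon> \<longrightarrow> \<bar>h\<bar> \<le> B \<longrightarrow>
    threshold \<epsilon> r h \<in> obs_space d \<rightarrow>\<^sub>M count_space {0, 1} \<and>
    \<bar>reject_prob d b \<epsilon> (\<lambda>_. 0) (threshold \<epsilon> r h) - (1 - \<Phi> h)\<bar> \<le> \<eta> \<and>
    (\<forall>\<Theta>. error2 \<epsilon> \<Theta> (threshold \<epsilon> r h) \<le> \<Phi> h + \<eta>) \<and>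
    error2 \<epsilon> (alts r) (threshold \<epsilon> r h) \<le>
      \<Phi> (h - extremal \<epsilon> r) + \<eta>"
proof -
  obtain \<rho>1 where \<rho>1: "\<rho>1 > 0" "\<And>K w x. flat_weights (Nstar d) \<rho>1 K w \<Longrightarrow>
    \<bar>measure (gauss (Nstar d)) {z \<in> space (gauss (Nstar d)). (\<Sum>k\<in>K. w k * ((z k)\<^sup>2 - 1)) \<le> x} - \<Phi> x\<bar> \<le> \<eta>"
    using chi_square_clt[OF assms, of "Nstar d"] by blast
  obtain \<rho>2 where \<rho>2: "\<rho>2 > 0" "\<And>K w v h. flat_weights (Nstar d) \<rho>2 K w \<Longrightarrow> \<bar>h\<bar> \<le> B \<Longrightarrow>
    measure (gauss (Nstar d)) {z \<in> space (gauss (Nstar d)). (\<Sum>k\<in>K. w k * ((z k + v k)\<^sup>2 - 1)) \<le> h} \<le>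
      \<Phi> (h - (\<Sum>k\<in>K. w k * (v k)\<^sup>2)) + \<eta>"
    using shifted_chi_square_upper_bound[OF assms, of "Nstar d" B] by blast
  have "min \<rho>1 \<rho>2 > 0" using \<rho>1 \<rho>2 by simp
  from extremal_weights[OF this] obtain r0 where r0: "r0 > 0"
    and ex: "\<And>r. 0 < r \<Longrightarrow> r \<le> r0 \<Longrightarrow> \<exists>K w. flat_weights (Nstar d) (min \<rho>1 \<rho>2) K w \<and> optimal_weights r K w"
    by blast
  have "threshold \<epsilon> r h \<in> obs_space d \<rightarrow>\<^sub>M count_space {0, 1} \<and>
    \<bar>reject_prob d b \<epsilon> (\<lambda>_. 0) (threshold \<epsilon> r h) - (1 - \<Phi> h)\<bar> \<le> \<eta> \<and>
    (\<forall>\<Theta>. error2 \<epsilon> \<Theta> (threshold \<epsilon> r h) \<le> \<Phi> h + \<eta>) \<and>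
    error2 \<epsilon> (alts r) (threshold \<epsilon> r h) \<le>
      \<Phi> (h - extremal \<epsilon> r) + \<eta>"
    if r: "0 < r" "r \<le> r0" and \<epsilon>: "\<epsilon> > 0" and h: "\<bar>h\<bar> \<le> B" for r \<epsilon> h
  proof -
    obtain K w where fw: "flat_weights (Nstar d) (min \<rho>1 \<rho>2) K w"
      and ow: "optimal_weights r K w"
      using ex[OF r] by blast
    have tf: "\<forall>k\<in>Nstar d. test_filter d a b R r k = (if k \<in> K then w k else 0)"
      and ev: "\<And>\<theta>. \<theta> \<in> alts r \<Longrightarrow> extremal \<epsilon> r \<le> (\<Sum>k\<in>K. w k * (b k * \<theta> k / \<epsilon>)\<^sup>2)"
      using ow \<epsilon> unfolding optimal_weights_def by blast+
    have w0: "0 \<le> (\<Sum>k\<in>K. w k * (v k)\<^sup>2)" for v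
      using fw by (intro sum_nonneg) (auto simp: flat_weights_def)
    let ?\<psi> = "threshold \<epsilon> r h"
    note tp = threshold_test_properties[OF fw tf \<epsilon>, where h = h]
    have bound: "accept_prob d b \<epsilon> \<theta> ?\<psi> \<le>
      \<Phi> (h - (\<Sum>k\<in>K. w k * (b k * \<theta> k / \<epsilon>)\<^sup>2)) + \<eta>" for \<theta>
      unfolding tp(2) by (rule \<rho>2(2)[OF flat_weights_mono[OF fw] h]) simp
    have "\<bar>accept_prob d b \<epsilon> (\<lambda>_. 0) ?\<psi> - \<Phi> h\<bar> \<le> \<eta>"
      using \<rho>1(2)[OF flat_weights_mono[OF fw], of h] unfolding tp(2) by simp
    hence "\<bar>reject_prob d b \<epsilon> (\<lambda>_. 0) ?\<psi> - (1 - \<Phi> h)\<bar> \<le> \<eta>"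
      unfolding obs_law_test_1[OF tp(1)] by linarith
    moreover have "error2 \<epsilon> \<Theta> ?\<psi> \<le> \<Phi> h + \<eta>" for \<Theta>
    proof (rule second_kind_error_le)
      show "0 \<le> \<Phi> h + \<eta>" using Phi_nonneg[of h] assms by linarith
      show "accept_prob d b \<epsilon> \<theta> ?\<psi> \<le> \<Phi> h + \<eta>" for \<theta>
        using bound[of \<theta>] Phi_mono[of "h - (\<Sum>k\<in>K. w k * (b k * \<theta> k / \<epsilon>)\<^sup>2)" h] w0[of "\<lambda>k. b k * \<theta> k / \<epsilon>"]
        by linarith
    qed
    moreover have "error2 \<epsilon> (alts r) ?\<psi> \<le> \<Phi> (h - extremal \<epsilon> r) + \<eta>"
    proof (rule second_kind_error_le)
      show "0 \<le> \<Phi> (h - extremal \<epsilon> r) + \<eta>"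
        using Phi_nonneg[of "h - extremal \<epsilon> r"] assms by linarith
      fix \<theta> assume "\<theta> \<in> alts r"
      from ev[OF this] have "\<Phi> (h - (\<Sum>k\<in>K. w k * (b k * \<theta> k / \<epsilon>)\<^sup>2)) \<le> \<Phi> (h - extremal \<epsilon> r)"
        by (intro Phi_mono) simp
      thus "accept_prob d b \<epsilon> \<theta> ?\<psi> \<le> \<Phi> (h - extremal \<epsilon> r) + \<eta>"
        using bound[of \<theta>] by linarith
    qed
    ultimately show ?thesis using tp(1) by blast
  qed
  thus ?thesis using r0 by blast
qed

text \<open>The acceptance region is pulled back to the noise space, where the level constraint says
  that its probability is at least \<open>\<Phi> H - \<rho>\<close>. The symmetric mixture then
  yields a sign pattern, and flipping the signs of the extremal sequence accordingly stays inside
  the class.\<close>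

lemma second_kind_error_lower_bound:
  assumes "\<eta> > 0" "B \<ge> 0"
  shows "\<exists>\<rho>>0. \<exists>r0>0. \<forall>r \<epsilon> c \<psi>. 0 < r \<longrightarrow> r \<le> r0 \<longrightarrow> 0 < \<epsilon> \<longrightarrow> extremal \<epsilon> r \<le> B \<longrightarrow>
    c \<le> 1 - \<Phi> H + \<rho> \<longrightarrow> level_test d b \<epsilon> c \<psi> \<longrightarrow>
    \<Phi> (H - extremal \<epsilon> r) - \<eta> \<le> error2 \<epsilon> (alts r) \<psi>"
proof -
  let ?N = "gauss (Nstar d)"
  interpret N: prob_space ?N by (rule prob_space_gauss)
  obtain \<rho> where \<rho>: "\<rho> > 0" and mix: "\<And>K w v u A. flat_weights (Nstar d) \<rho> K w \<Longrightarrow> 0 \<le> u \<Longrightarrow> u \<le> B \<Longrightarrow>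
    (\<forall>k\<in>K. (v k)\<^sup>2 = 2 * u * w k) \<Longrightarrow> A \<in> sets ?N \<Longrightarrow> \<Phi> H - \<rho> \<le> measure ?N A \<Longrightarrow>
    ennreal (\<Phi> (H - u) - \<eta>) \<le>
      (\<integral>\<^sup>+x. ennreal (\<Prod>k\<in>K. exp (- (v k)\<^sup>2 / 2) * cosh (v k * x k)) * indicator A x \<partial>?N)"
    using symmetric_mixture_lower_bound[OF assms, of "Nstar d" H] by blast
  obtain r0 where r0: "r0 > 0"
    and ex: "\<And>r. 0 < r \<Longrightarrow> r \<le> r0 \<Longrightarrow> \<exists>K w. flat_weights (Nstar d) \<rho> K w \<and> optimal_weights r K w"
    using extremal_weights[OF \<rho>] by blast
  have "\<Phi> (H - extremal \<epsilon> r) - \<eta> \<le> error2 \<epsilon> (alts r) \<psi>"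
    if r: "0 < r" "r \<le> r0" and \<epsilon>: "0 < \<epsilon>" and uB: "extremal \<epsilon> r \<le> B"
      and c: "c \<le> 1 - \<Phi> H + \<rho>" and lt: "level_test d b \<epsilon> c \<psi>" for r \<epsilon> c \<psi>
  proof -
    define u where "u = extremal \<epsilon> r"
    obtain K w where fw: "flat_weights (Nstar d) \<rho> K w" and ow: "optimal_weights r K w"
      using ex[OF r] by blast
    obtain \<theta> where u0: "0 \<le> u"
      and th: "\<forall>k\<in>K. (b k * \<theta> k / \<epsilon>)\<^sup>2 = 2 * u * w k" "\<forall>k\<in>Nstar d - K. \<theta> k = 0"
      and alt: "\<And>\<theta>'. (\<forall>k\<in>Nstar d. (\<theta>' k)\<^sup>2 = (\<theta> k)\<^sup>2) \<Longrightarrow> \<theta>' \<in> alts r"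
      using ow \<epsilon> unfolding optimal_weights_def u_def by blast
    have K: "finite K" "K \<subseteq> Nstar d" using fw by (auto simp: flat_weights_def)
    have m\<psi>: "\<psi> \<in> obs_space d \<rightarrow>\<^sub>M count_space {0, 1}"
      and lev: "reject_prob d b \<epsilon> (\<lambda>_. 0) \<psi> \<le> c"
      using lt by (auto simp: level_test_def)
    define Z where "Z = {y \<in> space (obs_space d). \<psi> y = 0}"
    have Z: "Z \<in> sets (obs_space d)" unfolding Z_def by (rule test_sets(1)[OF m\<psi>])
    define A where "A = {x \<in> space ?N. (\<lambda>l\<in>Nstar d. b l * 0 + \<epsilon> * x l) \<in> Z}"
    have "(\<lambda>\<xi>. \<lambda>l\<in>Nstar d. b l * 0 + \<epsilon> * \<xi> l) -` Z \<inter> space ?N \<in> sets ?N"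
      by (rule measurable_sets[OF measurable_observation Z])
    also have "(\<lambda>\<xi>. \<lambda>l\<in>Nstar d. b l * 0 + \<epsilon> * \<xi> l) -` Z \<inter> space ?N = A" by (auto simp: A_def)
    finally have A: "A \<in> sets ?N" .
    have "measure ?N A = measure (obs_law d b \<epsilon> (\<lambda>_. 0)) Z" unfolding A_def obs_law_measure[OF Z] ..
    hence PA: "\<Phi> H - \<rho> \<le> measure ?N A"
      using lev c unfolding obs_law_test_1[OF m\<psi>] Z_def[symmetric] by linarith
    define v where "v k = b k * \<theta> k / \<epsilon>" for k
    obtain \<sigma> where \<sigma>: "\<sigma> \<in> K \<rightarrow>\<^sub>E {-1, 1::real}" and le:
      "(\<integral>\<^sup>+x. ennreal (\<Prod>k\<in>K. exp (- (v k)\<^sup>2 / 2) * cosh (v k * x k)) * indicator A x \<partial>?N) \<le>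
      emeasure ?N {x \<in> space ?N. (\<lambda>i\<in>Nstar d. x i + (if i \<in> K then \<sigma> i * v i else 0)) \<in> A}"
      using gauss_symmetric_mixture[OF K A, of v] by blast
    define \<theta>' where "\<theta>' k = (if k \<in> K then \<sigma> k * \<theta> k else 0)" for k
    have "\<theta>' \<in> alts r"
    proof (rule alt, rule ballI)
      fix k assume k: "k \<in> Nstar d"
      show "(\<theta>' k)\<^sup>2 = (\<theta> k)\<^sup>2"
      proof (cases "k \<in> K")
        case True
        hence "\<sigma> k = -1 \<or> \<sigma> k = 1" using \<sigma> by (auto simp: PiE_iff)
        thus ?thesis using True by (auto simp: \<theta>'_def)
      next
        case False
        thus ?thesis using th(2) k by (simp add: \<theta>'_def)
      qed
    qed
    from second_kind_error_ge[OF this]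
    have ske: "measure (obs_law d b \<epsilon> \<theta>') Z \<le> error2 \<epsilon> (alts r) \<psi>"
      unfolding Z_def .
    \<comment> \<open>The null observation of the noise shifted by \<open>\<sigma> * v\<close> is
      the observation of \<open>\<theta>'\<close>, because
      \<open>\<epsilon> * v k = b k * \<theta> k\<close>.\<close>
    have "{x \<in> space ?N. (\<lambda>i\<in>Nstar d. x i + (if i \<in> K then \<sigma> i * v i else 0)) \<in> A} \<subseteq>
      {x \<in> space ?N. (\<lambda>l\<in>Nstar d. b l * \<theta>' l + \<epsilon> * x l) \<in> Z}"
    proof (rule Collect_mono, rule impI, elim conjE, rule conjI)
      fix x assume xA: "(\<lambda>i\<in>Nstar d. x i + (if i \<in> K then \<sigma> i * v i else 0)) \<in> A"
      have "(\<lambda>l\<in>Nstar d. b l * 0 + \<epsilon> * (\<lambda>i\<in>Nstar d. x i + (if i \<in> K then \<sigma> i * v i else 0)) l) =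
        (\<lambda>l\<in>Nstar d. b l * \<theta>' l + \<epsilon> * x l)"
        using \<epsilon> by (intro restrict_ext) (simp add: \<theta>'_def v_def algebra_simps)
      thus "(\<lambda>l\<in>Nstar d. b l * \<theta>' l + \<epsilon> * x l) \<in> Z" using xA unfolding A_def by simp
    qed
    moreover have "{x \<in> space ?N. (\<lambda>l\<in>Nstar d. b l * \<theta>' l + \<epsilon> * x l) \<in> Z} \<in> sets ?N"
    proof -
      have "(\<lambda>\<xi>. \<lambda>l\<in>Nstar d. b l * \<theta>' l + \<epsilon> * \<xi> l) -` Z \<inter> space ?N \<in> sets ?N"
        by (rule measurable_sets[OF measurable_observation Z])
      also have "(\<lambda>\<xi>. \<lambda>l\<in>Nstar d. b l * \<theta>' l + \<epsilon> * \<xi> l) -` Z \<inter> space ?N =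
        {x \<in> space ?N. (\<lambda>l\<in>Nstar d. b l * \<theta>' l + \<epsilon> * x l) \<in> Z}" by auto
      finally show ?thesis .
    qed
    ultimately have "emeasure ?N {x \<in> space ?N. (\<lambda>i\<in>Nstar d. x i + (if i \<in> K then \<sigma> i * v i else 0)) \<in> A} \<le>
      ennreal (measure (obs_law d b \<epsilon> \<theta>') Z)"
      unfolding obs_law_measure[OF Z] N.emeasure_eq_measure[symmetric] by (rule emeasure_mono)
    moreover have "ennreal (\<Phi> (H - u) - \<eta>) \<le>
      (\<integral>\<^sup>+x. ennreal (\<Prod>k\<in>K. exp (- (v k)\<^sup>2 / 2) * cosh (v k * x k)) * indicator A x \<partial>?N)"
      by (rule mix[OF fw u0 _ _ A PA]) (use uB th in \<open>auto simp: u_def v_def\<close>)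
    ultimately have "ennreal (\<Phi> (H - u) - \<eta>) \<le> ennreal (measure (obs_law d b \<epsilon> \<theta>') Z)" using le by order
    hence "\<Phi> (H - u) - \<eta> \<le> measure (obs_law d b \<epsilon> \<theta>') Z"
      using measure_nonneg[of "obs_law d b \<epsilon> \<theta>'" Z] by (auto simp: ennreal_le_iff2)
    thus ?thesis using ske unfolding u_def by linarith
  qed
  thus ?thesis using \<rho> r0 by blast
qed

end

section \<open>Sharp asymptotics and the separation rate\<close>

context power_ellipsoid
begin

definition radius_exponent :: real where
  "radius_exponent = 4 + 2 * (E1 + E2)"

text \<open>The radius at which \<open>r powr radius_exponent / \<epsilon>^4\<close>, the order of
  the squared extremal value, equals \<open>1\<close>.\<close>

definition rate :: "real \<Rightarrow> real" where
  "rate \<epsilon> = \<epsilon> powr (4 / radius_exponent)"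

lemma radius_exponent_pos: "radius_exponent > 0"
  using E1_pos E2_nonneg by (simp add: radius_exponent_def)

lemma rate_pos: "\<epsilon> > 0 \<Longrightarrow> rate \<epsilon> > 0"
  by (simp add: rate_def)

lemma rate_powr_radius_exponent: "C > 0 \<Longrightarrow> \<epsilon> > 0 \<Longrightarrow> (C * rate \<epsilon>) powr radius_exponent = C powr radius_exponent * \<epsilon> ^ 4"
  using radius_exponent_pos by (simp add: rate_def powr_mult powr_powr powr_numeral)

lemma eventually_rate_le:
  assumes C: "C > 0" and r0: "r0 > 0"
  shows "\<forall>\<^sub>F \<epsilon> in at_right 0. 0 < \<epsilon> \<and> 0 < C * rate \<epsilon> \<and> C * rate \<epsilon> \<le> r0"
proof -
  define x where "x = (r0 / C) powr (radius_exponent / 4)"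
  have "x > 0" using C r0 by (simp add: x_def)
  hence "\<forall>\<^sub>F \<epsilon> in at_right (0::real). \<epsilon> \<in> {0<..<x}" by (rule eventually_at_right_real)
  thus ?thesis
  proof eventually_elim
    case (elim \<epsilon>)
    have "rate \<epsilon> \<le> x powr (4 / radius_exponent)"
      unfolding rate_def using elim radius_exponent_pos by (intro powr_mono2) auto
    also have "\<dots> = r0 / C" using C r0 radius_exponent_pos by (simp add: x_def powr_powr)
    finally show ?case using C elim rate_pos[of \<epsilon>] by (simp add: field_simps)
  qed
qed

text \<open>The constants \<open>c1\<close> and \<open>c2\<close> are chosen before
  \<open>C\<close>, so the extremal value can be made arbitrarily small or large through
  \<open>C\<close>.\<close>

lemma extremal_value_rate:
  "\<exists>c1>0. \<exists>c2>0. \<forall>C>0. \<forall>\<^sub>F \<epsilon> in at_right 0.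
    sqrt (c1 * C powr radius_exponent) \<le> extremal \<epsilon> (C * rate \<epsilon>) \<and>
    extremal \<epsilon> (C * rate \<epsilon>) \<le> sqrt (c2 * C powr radius_exponent)"
proof -
  obtain c1 c2 r0 where c: "c1 > 0" "c2 > 0" "r0 > 0" and
    b: "\<And>r \<epsilon>. 0 < r \<Longrightarrow> r \<le> r0 \<Longrightarrow> 0 < \<epsilon> \<Longrightarrow>
      c1 * (r powr radius_exponent / \<epsilon> ^ 4) \<le> (extremal \<epsilon> r)\<^sup>2 \<and>
      (extremal \<epsilon> r)\<^sup>2 \<le> c2 * (r powr radius_exponent / \<epsilon> ^ 4)"
    using extremal_value_bounds unfolding radius_exponent_def by blast
  obtain r1 where r1: "r1 > 0" and
    ex: "\<And>r. 0 < r \<Longrightarrow> r \<le> r1 \<Longrightarrow> \<exists>K w. flat_weights (Nstar d) 1 K w \<and> optimal_weights r K w"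
    using extremal_weights[of 1] by auto
  have "\<forall>\<^sub>F \<epsilon> in at_right 0.
    sqrt (c1 * C powr radius_exponent) \<le> extremal \<epsilon> (C * rate \<epsilon>) \<and>
    extremal \<epsilon> (C * rate \<epsilon>) \<le> sqrt (c2 * C powr radius_exponent)" if C: "C > 0" for C
    using eventually_rate_le[OF C c(3)] eventually_rate_le[OF C r1]
  proof eventually_elim
    case (elim \<epsilon>)
    let ?u = "extremal \<epsilon> (C * rate \<epsilon>)"
    have "(C * rate \<epsilon>) powr radius_exponent / \<epsilon> ^ 4 = C powr radius_exponent"
      using elim by (simp add: rate_powr_radius_exponent[OF C])
    with b[of "C * rate \<epsilon>" \<epsilon>] elim have "c1 * C powr radius_exponent \<le> ?u\<^sup>2" "?u\<^sup>2 \<le> c2 * C powr radius_exponent" by auto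
    moreover have "0 \<le> ?u" using ex[of "C * rate \<epsilon>"] elim unfolding optimal_weights_def by blast
    ultimately show ?case by (auto intro: real_le_lsqrt real_le_rsqrt)
  qed
  thus ?thesis using c by blast
qed

text \<open>The test with threshold \<open>H\<close> has level \<open>\<alpha>\<close> only in the
  limit, while \<open>minimax\<close> demands the level
  \<open>\<alpha> + \<delta> \<epsilon>\<close> exactly. The upper bound therefore uses a slightly
  larger threshold. The last clause, valid for every class, later handles radii below
  \<open>C * rate \<epsilon>\<close>.\<close>

lemma sharp_asymptotics:
  assumes \<alpha>: "0 < \<alpha>" "\<alpha> < 1" and \<delta>: "(\<delta> \<longlongrightarrow> 0) (at_right 0)" and C: "C > 0" and \<eta>: "\<eta> > 0"
  defines "H \<equiv> upper_quantile \<alpha>"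
  shows "\<forall>\<^sub>F \<epsilon> in at_right 0. 0 \<le> \<alpha> + \<delta> \<epsilon> \<and>
    \<bar>minimax \<epsilon> (alts (C * rate \<epsilon>)) (\<alpha> + \<delta> \<epsilon>)
      - \<Phi> (H - extremal \<epsilon> (C * rate \<epsilon>))\<bar> \<le> \<eta> \<and>
    \<bar>error2 \<epsilon> (alts (C * rate \<epsilon>)) (threshold \<epsilon> (C * rate \<epsilon>) H)
      - \<Phi> (H - extremal \<epsilon> (C * rate \<epsilon>))\<bar> \<le> \<eta> \<and>
    threshold \<epsilon> (C * rate \<epsilon>) H \<in> obs_space d \<rightarrow>\<^sub>M count_space {0, 1} \<and>
    \<bar>reject_prob d b \<epsilon> (\<lambda>_. 0) (threshold \<epsilon> (C * rate \<epsilon>) H) - \<alpha>\<bar> \<le> \<eta> \<and>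
    (\<forall>\<Theta>. minimax \<epsilon> \<Theta> (\<alpha> + \<delta> \<epsilon>) \<le> 1 - \<alpha> + \<eta>)"
proof -
  have PH: "\<Phi> H = 1 - \<alpha>" unfolding H_def by (rule Phi_upper_quantile[OF \<alpha>])
  obtain Bu where Bu: "Bu \<ge> 0" "\<forall>\<^sub>F \<epsilon> in at_right 0. extremal \<epsilon> (C * rate \<epsilon>) \<le> Bu"
  proof -
    obtain c1 c2 where c2: "c2 > 0" and ev: "\<forall>C>0. \<forall>\<^sub>F \<epsilon> in at_right 0.
      sqrt (c1 * C powr radius_exponent) \<le> extremal \<epsilon> (C * rate \<epsilon>) \<and>
      extremal \<epsilon> (C * rate \<epsilon>) \<le> sqrt (c2 * C powr radius_exponent)"
      using extremal_value_rate by blast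
    have "\<forall>\<^sub>F \<epsilon> in at_right 0. extremal \<epsilon> (C * rate \<epsilon>) \<le> sqrt (c2 * C powr radius_exponent)"
      by (rule eventually_mono[OF ev[rule_format, OF C]]) simp
    from that[OF _ this] c2 show ?thesis by simp
  qed
  obtain \<rho> r1 where \<rho>: "\<rho> > 0" "r1 > 0" and lower: "\<And>r \<epsilon> c \<psi>. 0 < r \<Longrightarrow> r \<le> r1 \<Longrightarrow> 0 < \<epsilon> \<Longrightarrow>
    extremal \<epsilon> r \<le> Bu \<Longrightarrow> c \<le> 1 - \<Phi> H + \<rho> \<Longrightarrow> level_test d b \<epsilon> c \<psi> \<Longrightarrow>
    \<Phi> (H - extremal \<epsilon> r) - \<eta> \<le> error2 \<epsilon> (alts r) \<psi>"
    using second_kind_error_lower_bound[OF \<eta> Bu(1), of H] by blast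
  \<comment> \<open>Raising the threshold lowers the null rejection probability by
    \<open>\<gamma>\<close> in the limit, which absorbs both \<open>\<delta> \<epsilon>\<close> and
    the error of the normal approximation, while the second-kind error grows by at most
    \<open>\<eta> / 2\<close>.\<close>
  define h where "h = H + \<eta> / 2"
  define \<gamma> where "\<gamma> = \<Phi> h - \<Phi> H"
  have \<gamma>: "\<gamma> > 0" using Phi_strict_mono[of H h] \<eta> by (simp add: \<gamma>_def h_def)
  define \<zeta> where "\<zeta> = Min {\<gamma> / 2, \<eta> / 2, \<rho>}"
  have \<zeta>: "\<zeta> > 0" "\<zeta> \<le> \<gamma> / 2" "\<zeta> \<le> \<eta> / 2" "\<zeta> \<le> \<rho>" using \<gamma> \<eta> \<rho> by (auto simp: \<zeta>_def)
  obtain r2 where r2: "r2 > 0" and errors: "\<And>r \<epsilon> k. 0 < r \<Longrightarrow> r \<le> r2 \<Longrightarrow> 0 < \<epsilon> \<Longrightarrow> \<bar>k\<bar> \<le> \<bar>H\<bar> + \<eta> / 2 \<Longrightarrow>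
    threshold \<epsilon> r k \<in> obs_space d \<rightarrow>\<^sub>M count_space {0, 1} \<and>
    \<bar>reject_prob d b \<epsilon> (\<lambda>_. 0) (threshold \<epsilon> r k) - (1 - \<Phi> k)\<bar> \<le> \<zeta> \<and>
    (\<forall>\<Theta>. error2 \<epsilon> \<Theta> (threshold \<epsilon> r k) \<le> \<Phi> k + \<zeta>) \<and>
    error2 \<epsilon> (alts r) (threshold \<epsilon> r k) \<le>
      \<Phi> (k - extremal \<epsilon> r) + \<zeta>"
    using threshold_test_errors[OF \<zeta>(1), of "\<bar>H\<bar> + \<eta> / 2"] by blast
  have "0 < Min {\<rho>, \<gamma> / 2, \<alpha>}" using \<rho> \<gamma> \<alpha> by simp
  from tendstoD[OF \<delta> this] have "\<forall>\<^sub>F \<epsilon> in at_right 0. \<bar>\<delta> \<epsilon>\<bar> < Min {\<rho>, \<gamma> / 2, \<alpha>}" by simp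
  with Bu(2) eventually_rate_le[OF C \<rho>(2)] eventually_rate_le[OF C r2] show ?thesis
  proof eventually_elim
    case (elim \<epsilon>)
    define r where "r = C * rate \<epsilon>"
    define u where "u = extremal \<epsilon> r"
    have r: "0 < \<epsilon>" "0 < r" "r \<le> r1" "r \<le> r2" and uB: "u \<le> Bu" using elim by (auto simp: r_def u_def)
    have d: "\<bar>\<delta> \<epsilon>\<bar> < \<rho>" "\<bar>\<delta> \<epsilon>\<bar> < \<gamma> / 2" "\<bar>\<delta> \<epsilon>\<bar> < \<alpha>" using elim by auto
    have c0: "0 \<le> \<alpha> + \<delta> \<epsilon>" using d by linarith
    have dl: "- (\<gamma> / 2) < \<delta> \<epsilon>" using d(2) by (simp only: abs_less_iff) linarith
    have "\<Phi> h = 1 - \<alpha> + \<gamma>" using PH by (simp add: \<gamma>_def)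
    have hB: "\<bar>h\<bar> \<le> \<bar>H\<bar> + \<eta> / 2" "\<bar>H\<bar> \<le> \<bar>H\<bar> + \<eta> / 2" using \<eta> by (auto simp: h_def)
    note eh = errors[OF r(2,4,1) hB(1)]
    note eH = errors[OF r(2,4,1) hB(2)]
    have Lh: "\<Phi> (h - x) \<le> \<Phi> (H - x) + \<eta> / 2" for x
      using Phi_Lipschitz_le[of "H - x" "h - x"] \<eta> by (simp add: h_def)
    have "level_test d b \<epsilon> (\<alpha> + \<delta> \<epsilon>) (threshold \<epsilon> r h)"
      unfolding level_test_def
    proof
      show "threshold \<epsilon> r h \<in> obs_space d \<rightarrow>\<^sub>M count_space {0, 1}" using eh by blast
      have "reject_prob d b \<epsilon> (\<lambda>_. 0) (threshold \<epsilon> r h) \<le> 1 - \<Phi> h + \<zeta>"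
        using eh by linarith
      thus "reject_prob d b \<epsilon> (\<lambda>_. 0) (threshold \<epsilon> r h) \<le> \<alpha> + \<delta> \<epsilon>"
        using \<zeta>(2) dl \<open>\<Phi> h = 1 - \<alpha> + \<gamma>\<close> by simp
    qed
    note mm = minimax_error_le[OF this]
    have all: "minimax \<epsilon> \<Theta> (\<alpha> + \<delta> \<epsilon>) \<le> 1 - \<alpha> + \<eta>" for \<Theta>
    proof -
      have "error2 \<epsilon> \<Theta> (threshold \<epsilon> r h) \<le> \<Phi> h + \<zeta>" using eh by blast
      thus ?thesis using mm[of \<Theta>] Lh[of 0] PH \<zeta>(3) by simp
    qed
    have up: "minimax \<epsilon> (alts r) (\<alpha> + \<delta> \<epsilon>) \<le> \<Phi> (H - u) + \<eta>"
    proof -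
      have "error2 \<epsilon> (alts r) (threshold \<epsilon> r h) \<le> \<Phi> (h - u) + \<zeta>"
        using eh unfolding u_def by blast
      thus ?thesis using mm[of "alts r"] Lh[of u] \<zeta>(3) by linarith
    qed
    have lo: "\<Phi> (H - u) - \<eta> \<le> minimax \<epsilon> (alts r) (\<alpha> + \<delta> \<epsilon>)"
    proof (rule minimax_error_ge[OF c0])
      fix \<psi> assume "level_test d b \<epsilon> (\<alpha> + \<delta> \<epsilon>) \<psi>"
      moreover have "\<alpha> + \<delta> \<epsilon> \<le> 1 - \<Phi> H + \<rho>" using d(1) PH by linarith
      ultimately show "\<Phi> (H - u) - \<eta> \<le> error2 \<epsilon> (alts r) \<psi>"
        using lower[OF r(2,3,1)] uB unfolding u_def by blast
    qed
    define p where "p = reject_prob d b \<epsilon> (\<lambda>_. 0) (threshold \<epsilon> r H)"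
    have p: "\<bar>p - \<alpha>\<bar> \<le> \<zeta>" using eH PH unfolding p_def by simp
    have mH: "threshold \<epsilon> r H \<in> obs_space d \<rightarrow>\<^sub>M count_space {0, 1}" using eH by blast
    \<comment> \<open>The lower bound is applied to the test with threshold \<open>H\<close> at its
      own size \<open>p\<close>, which is within \<open>\<rho>\<close> of
      \<open>\<alpha>\<close>.\<close>
    have "level_test d b \<epsilon> p (threshold \<epsilon> r H)"
      unfolding level_test_def p_def using mH by blast
    moreover have "p \<le> 1 - \<Phi> H + \<rho>" using p PH \<zeta>(4) by linarith
    ultimately have loH: "\<Phi> (H - u) - \<eta> \<le> error2 \<epsilon> (alts r) (threshold \<epsilon> r H)"
      using lower[OF r(2,3,1)] uB unfolding u_def by blast
    have "error2 \<epsilon> (alts r) (threshold \<epsilon> r H) \<le> \<Phi> (H - u) + \<zeta>"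
      using eH unfolding u_def by blast
    hence "\<bar>error2 \<epsilon> (alts r) (threshold \<epsilon> r H) - \<Phi> (H - u)\<bar> \<le> \<eta>"
      using loH \<zeta>(3) \<eta> by (intro abs_leI) linarith+
    moreover have "\<bar>minimax \<epsilon> (alts r) (\<alpha> + \<delta> \<epsilon>) - \<Phi> (H - u)\<bar> \<le> \<eta>"
      using up lo by (intro abs_leI) linarith+
    moreover have "\<bar>p - \<alpha>\<bar> \<le> \<eta>" using p \<zeta>(3) \<eta> by linarith
    ultimately show ?case using c0 mH all unfolding p_def r_def u_def by blast
  qed
qed

lemma separation_rate:
  assumes \<alpha>: "0 < \<alpha>" "\<alpha> < 1" and \<delta>: "(\<delta> \<longlongrightarrow> 0) (at_right 0)"
  shows "minimax_separation_rate d a b R \<alpha> \<delta> rs \<longleftrightarrow> same_order rs rate"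
  unfolding minimax_separation_rate_def
proof (rule separation_rate_iff_same_order[where m = "\<lambda>\<epsilon> r. minimax \<epsilon> (alts r) (\<alpha> + \<delta> \<epsilon>)"])
  define H where "H = upper_quantile \<alpha>"
  have PH: "\<Phi> H = 1 - \<alpha>" unfolding H_def by (rule Phi_upper_quantile[OF \<alpha>])
  obtain c1 c2 where c: "c1 > 0" "c2 > 0" and ev: "\<And>C. C > 0 \<Longrightarrow> \<forall>\<^sub>F \<epsilon> in at_right 0.
    sqrt (c1 * C powr radius_exponent) \<le> extremal \<epsilon> (C * rate \<epsilon>) \<and>
    extremal \<epsilon> (C * rate \<epsilon>) \<le> sqrt (c2 * C powr radius_exponent)"
    using extremal_value_rate by blast
  have choose: "\<exists>C>0. sqrt (k * C powr radius_exponent) = x" if "k > 0" "x > 0" for k x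
  proof (intro exI conjI)
    show "(x\<^sup>2 / k) powr (1 / radius_exponent) > 0" using that by simp
    show "sqrt (k * ((x\<^sup>2 / k) powr (1 / radius_exponent)) powr radius_exponent) = x"
      using that radius_exponent_pos by (simp add: powr_powr)
  qed
  show "\<epsilon> > 0 \<Longrightarrow> rate \<epsilon> > 0" for \<epsilon> by (rule rate_pos)
  show "1 - \<alpha> > 0" using \<alpha> by simp
  fix \<eta> :: real assume \<eta>: "\<eta> > 0"
  show "\<exists>c>0. \<forall>\<^sub>F \<epsilon> in at_right 0. \<forall>r. 0 < r \<longrightarrow> r \<le> c * rate \<epsilon> \<longrightarrow>
    \<bar>minimax \<epsilon> (alts r) (\<alpha> + \<delta> \<epsilon>) - (1 - \<alpha>)\<bar> \<le> \<eta>"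
  proof -
    \<comment> \<open>A small \<open>C\<close> keeps the extremal value below
      \<open>\<eta> / 2\<close>, so that \<open>\<Phi> (H - u)\<close> stays within
      \<open>\<eta> / 2\<close> of \<open>\<Phi> H = 1 - \<alpha>\<close>.\<close>
    obtain C where C: "C > 0" "sqrt (c2 * C powr radius_exponent) = \<eta> / 2" using choose[OF c(2), of "\<eta> / 2"] \<eta> by auto
    have "\<forall>\<^sub>F \<epsilon> in at_right 0. \<forall>r. 0 < r \<longrightarrow> r \<le> C * rate \<epsilon> \<longrightarrow>
      \<bar>minimax \<epsilon> (alts r) (\<alpha> + \<delta> \<epsilon>) - (1 - \<alpha>)\<bar> \<le> \<eta>"
      using ev[OF C(1)] sharp_asymptotics[OF \<alpha> \<delta> C(1) half_gt_zero[OF \<eta>]]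
    proof eventually_elim
      case (elim \<epsilon>)
      let ?u = "extremal \<epsilon> (C * rate \<epsilon>)"
      show ?case
      proof (intro allI impI abs_leI)
        fix r assume "0 < r" "r \<le> C * rate \<epsilon>"
        have "minimax \<epsilon> (alts r) (\<alpha> + \<delta> \<epsilon>) \<le> 1 - \<alpha> + \<eta> / 2" using elim by blast
        thus "minimax \<epsilon> (alts r) (\<alpha> + \<delta> \<epsilon>) - (1 - \<alpha>) \<le> \<eta>" using \<eta> by linarith
        have "minimax \<epsilon> (alts (C * rate \<epsilon>)) (\<alpha> + \<delta> \<epsilon>) \<le>
          minimax \<epsilon> (alts r) (\<alpha> + \<delta> \<epsilon>)"
          using elim \<open>r \<le> C * rate \<epsilon>\<close> by (intro minimax_error_mono alternatives_antimono) auto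
        moreover have "\<bar>minimax \<epsilon> (alts (C * rate \<epsilon>)) (\<alpha> + \<delta> \<epsilon>) - \<Phi> (H - ?u)\<bar> \<le> \<eta> / 2"
          using elim unfolding H_def by blast
        moreover have "\<bar>\<Phi> H - \<Phi> (H - ?u)\<bar> \<le> \<bar>?u\<bar>" using Phi_Lipschitz[of H "H - ?u"] by simp
        moreover have "0 \<le> sqrt (c1 * C powr radius_exponent)" using c by simp
        hence "\<bar>?u\<bar> \<le> \<eta> / 2" using elim C(2) by linarith
        ultimately show "- (minimax \<epsilon> (alts r) (\<alpha> + \<delta> \<epsilon>) - (1 - \<alpha>)) \<le> \<eta>"
          using PH by linarith
      qed
    qed
    thus ?thesis using C(1) by blast
  qed
  show "\<exists>c>0. \<forall>\<^sub>F \<epsilon> in at_right 0. \<forall>r. c * rate \<epsilon> \<le> r \<longrightarrow>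
    \<bar>minimax \<epsilon> (alts r) (\<alpha> + \<delta> \<epsilon>)\<bar> \<le> \<eta>"
  proof -
    obtain x0 where x0: "\<Phi> x0 < \<eta> / 2"
      using order_tendstoD(2)[OF Phi_at_bot half_gt_zero[OF \<eta>]] by (auto simp: eventually_at_bot_linorder)
    \<comment> \<open>A large \<open>C\<close> pushes \<open>H - u\<close> below \<open>x0\<close>,
      where \<open>\<Phi>\<close> is already less than \<open>\<eta> / 2\<close>.\<close>
    obtain C where C: "C > 0" "sqrt (c1 * C powr radius_exponent) = \<bar>H - x0\<bar> + 1"
      using choose[OF c(1), of "\<bar>H - x0\<bar> + 1"] by (auto simp: add_nonneg_pos)
    have "\<forall>\<^sub>F \<epsilon> in at_right 0. \<forall>r. C * rate \<epsilon> \<le> r \<longrightarrow>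
      \<bar>minimax \<epsilon> (alts r) (\<alpha> + \<delta> \<epsilon>)\<bar> \<le> \<eta>"
      using ev[OF C(1)] sharp_asymptotics[OF \<alpha> \<delta> C(1) half_gt_zero[OF \<eta>]]
    proof eventually_elim
      case (elim \<epsilon>)
      let ?u = "extremal \<epsilon> (C * rate \<epsilon>)"
      show ?case
      proof (intro allI impI)
        fix r assume r: "C * rate \<epsilon> \<le> r"
        have c0: "0 \<le> \<alpha> + \<delta> \<epsilon>" using elim by blast
        have "minimax \<epsilon> (alts r) (\<alpha> + \<delta> \<epsilon>) \<le>
          minimax \<epsilon> (alts (C * rate \<epsilon>)) (\<alpha> + \<delta> \<epsilon>)"
          by (rule minimax_error_mono[OF c0 alternatives_antimono[OF r]])
        moreover have "\<bar>minimax \<epsilon> (alts (C * rate \<epsilon>)) (\<alpha> + \<delta> \<epsilon>) - \<Phi> (H - ?u)\<bar> \<le> \<eta> / 2"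
          using elim unfolding H_def by blast
        moreover have "H - ?u \<le> x0" using elim C(2) by linarith
        hence "\<Phi> (H - ?u) \<le> \<Phi> x0" by (rule Phi_mono)
        moreover have "0 \<le> minimax \<epsilon> (alts r) (\<alpha> + \<delta> \<epsilon>)"
          by (rule minimax_error_nonneg[OF c0])
        ultimately show "\<bar>minimax \<epsilon> (alts r) (\<alpha> + \<delta> \<epsilon>)\<bar> \<le> \<eta>" using x0 by linarith
      qed
    qed
    thus ?thesis using C(1) by blast
  qed
qed

lemma sharp_asymptotics_limits:
  assumes \<alpha>: "0 < \<alpha>" "\<alpha> < 1" and \<delta>: "(\<delta> \<longlongrightarrow> 0) (at_right 0)" and C: "C > 0"
    and r: "\<forall>\<epsilon>>0. r \<epsilon> = C * rate \<epsilon>"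
  shows "(\<lambda>\<epsilon>. extremal \<epsilon> (r \<epsilon>)) \<in> O[at_right 0](\<lambda>_. 1)"
    and "asymptotic_level_test d b \<alpha> (\<lambda>\<epsilon>. threshold \<epsilon> (r \<epsilon>) (upper_quantile \<alpha>))"
    and "((\<lambda>\<epsilon>. error2 \<epsilon> (alts (r \<epsilon>))
                (threshold \<epsilon> (r \<epsilon>) (upper_quantile \<alpha>))
              - minimax \<epsilon> (alts (r \<epsilon>)) (\<alpha> + \<delta> \<epsilon>)) \<longlongrightarrow> 0) (at_right 0)"
    and "((\<lambda>\<epsilon>. minimax \<epsilon> (alts (r \<epsilon>)) (\<alpha> + \<delta> \<epsilon>)
              - \<Phi> (upper_quantile \<alpha> - extremal \<epsilon> (r \<epsilon>))) \<longlongrightarrow> 0) (at_right 0)"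
proof -
  have ev0: "\<forall>\<^sub>F \<epsilon> in at_right (0::real). \<epsilon> > 0" by (rule eventually_at_right_less)
  have req: "\<forall>\<^sub>F \<epsilon> in at_right 0. r \<epsilon> = C * rate \<epsilon>" using ev0 r by (auto elim: eventually_mono)
  obtain c1 c2 where c: "c1 > 0" "c2 > 0" and ev: "\<forall>\<^sub>F \<epsilon> in at_right 0.
    sqrt (c1 * C powr radius_exponent) \<le> extremal \<epsilon> (C * rate \<epsilon>) \<and>
    extremal \<epsilon> (C * rate \<epsilon>) \<le> sqrt (c2 * C powr radius_exponent)"
    using extremal_value_rate C by blast
  show "(\<lambda>\<epsilon>. extremal \<epsilon> (r \<epsilon>)) \<in> O[at_right 0](\<lambda>_. 1)"
  proof (rule bigoI[of _ "sqrt (c2 * C powr radius_exponent)"])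
    show "\<forall>\<^sub>F \<epsilon> in at_right 0. norm (extremal \<epsilon> (r \<epsilon>)) \<le> sqrt (c2 * C powr radius_exponent) * norm (1::real)"
      using ev req
    proof eventually_elim
      case (elim \<epsilon>)
      have "0 \<le> sqrt (c1 * C powr radius_exponent)" using c by simp
      hence "0 \<le> extremal \<epsilon> (C * rate \<epsilon>)" using elim by linarith
      thus ?case using elim by simp
    qed
  qed
  note sharp = sharp_asymptotics[OF \<alpha> \<delta> C]
  define p where "p \<epsilon> = measure (obs_law d b \<epsilon> (\<lambda>_. 0))
    {y \<in> space (obs_space d). threshold \<epsilon> (r \<epsilon>) (upper_quantile \<alpha>) y = 1}" for \<epsilon>
  show "asymptotic_level_test d b \<alpha> (\<lambda>\<epsilon>. threshold \<epsilon> (r \<epsilon>) (upper_quantile \<alpha>))"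
    unfolding asymptotic_level_test_def
  proof (intro exI conjI)
    \<comment> \<open>The witness for the vanishing level correction is the deviation of the actual
      size from \<open>\<alpha>\<close>, so the level condition holds with equality.\<close>
    show "((\<lambda>\<epsilon>. p \<epsilon> - \<alpha>) \<longlongrightarrow> 0) (at_right 0)"
    proof (rule tendstoI)
      fix e :: real assume e: "e > 0"
      show "\<forall>\<^sub>F \<epsilon> in at_right 0. dist (p \<epsilon> - \<alpha>) 0 < e"
        using sharp[OF half_gt_zero[OF e]] req
      proof eventually_elim
        case (elim \<epsilon>)
        hence "\<bar>p \<epsilon> - \<alpha>\<bar> \<le> e / 2" unfolding p_def by simp
        thus ?case using e by simp
      qed
    qed
    show "\<forall>\<^sub>F \<epsilon> in at_right 0. level_test d b \<epsilon> (\<alpha> + (p \<epsilon> - \<alpha>)) (threshold \<epsilon> (r \<epsilon>) (upper_quantile \<alpha>))"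
      using sharp[OF zero_less_one] req by eventually_elim (simp add: level_test_def p_def)
  qed
  show "((\<lambda>\<epsilon>. error2 \<epsilon> (alts (r \<epsilon>))
                (threshold \<epsilon> (r \<epsilon>) (upper_quantile \<alpha>))
              - minimax \<epsilon> (alts (r \<epsilon>)) (\<alpha> + \<delta> \<epsilon>)) \<longlongrightarrow> 0) (at_right 0)"
  proof (rule tendstoI)
    fix e :: real assume e: "e > 0"
    hence "e / 3 > 0" by simp
    from sharp[OF this] req
    show "\<forall>\<^sub>F \<epsilon> in at_right 0. dist (error2 \<epsilon> (alts (r \<epsilon>))
                (threshold \<epsilon> (r \<epsilon>) (upper_quantile \<alpha>))
              - minimax \<epsilon> (alts (r \<epsilon>)) (\<alpha> + \<delta> \<epsilon>)) 0 < e"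
    proof eventually_elim
      case (elim \<epsilon>)
      have "\<bar>x - y\<bar> < e" if "\<bar>y - z\<bar> \<le> e / 3" "\<bar>x - z\<bar> \<le> e / 3" for x y z using that e by linarith
      thus ?case using elim by (simp only: dist_real_def diff_0_right) blast
    qed
  qed
  show "((\<lambda>\<epsilon>. minimax \<epsilon> (alts (r \<epsilon>)) (\<alpha> + \<delta> \<epsilon>)
              - \<Phi> (upper_quantile \<alpha> - extremal \<epsilon> (r \<epsilon>))) \<longlongrightarrow> 0) (at_right 0)"
  proof (rule tendstoI)
    fix e :: real assume e: "e > 0"
    show "\<forall>\<^sub>F \<epsilon> in at_right 0. dist (minimax \<epsilon> (alts (r \<epsilon>)) (\<alpha> + \<delta> \<epsilon>)
              - \<Phi> (upper_quantile \<alpha> - extremal \<epsilon> (r \<epsilon>))) 0 < e"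
      using sharp[OF half_gt_zero[OF e]] req
    proof eventually_elim
      case (elim \<epsilon>)
      have "\<bar>x\<bar> < e" if "\<bar>x\<bar> \<le> e / 2" for x using that e by linarith
      thus ?case using elim by (simp only: dist_real_def diff_0_right)
    qed
  qed
qed

end

theorem proposition5:
  fixes d :: nat and R \<alpha> :: real and t s :: "nat \<Rightarrow> real"
    and a b :: "(nat \<Rightarrow> nat) \<Rightarrow> real" and \<delta> :: "real \<Rightarrow> real" and \<kappa> :: real
  assumes "d \<ge> 1" and "R > 0" and "0 < \<alpha>" and "\<alpha> < 1"
    and "\<And>j. j \<in> {1..d} \<Longrightarrow> t j \<ge> 0"
    and "\<And>j. j \<in> {1..d} \<Longrightarrow> s j > 0"
    and "\<And>l. l \<in> Nstar d \<Longrightarrow> (b l)\<^sup>2 = (\<Prod>j=1..d. real (l j) powr (- 2 * t j))"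
    and "\<And>l. l \<in> Nstar d \<Longrightarrow> (a l)\<^sup>2 = (\<Sum>j=1..d. real (l j) powr (2 * s j))"
    and "(\<delta> \<longlongrightarrow> 0) (at_right 0)"
    and "\<kappa> = 4 / (4 + (\<Sum>j=1..d. (1 + 4 * t j) / s j))"
  shows "(\<forall>rs. minimax_separation_rate d a b R \<alpha> \<delta> rs \<longleftrightarrow> same_order rs (\<lambda>\<epsilon>. \<epsilon> powr \<kappa>)) \<and>
    (\<forall>C>0. \<forall>r. (\<forall>\<epsilon>>0. r \<epsilon> = C * \<epsilon> powr \<kappa>) \<longrightarrow>
       (\<lambda>\<epsilon>. extremal_value d a b R \<epsilon> (r \<epsilon>)) \<in> O[at_right 0](\<lambda>_. 1) \<and>
       asymptotic_level_test d b \<alpha>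
         (\<lambda>\<epsilon>. threshold_test d a b R \<epsilon> (r \<epsilon>) (upper_quantile \<alpha>)) \<and>
       ((\<lambda>\<epsilon>. second_kind_error d b \<epsilon> (alternatives d a R (r \<epsilon>))
                (threshold_test d a b R \<epsilon> (r \<epsilon>) (upper_quantile \<alpha>))
              - minimax_error d b \<epsilon> (alternatives d a R (r \<epsilon>)) (\<alpha> + \<delta> \<epsilon>))
          \<longlongrightarrow> 0) (at_right 0) \<and>
       ((\<lambda>\<epsilon>. minimax_error d b \<epsilon> (alternatives d a R (r \<epsilon>)) (\<alpha> + \<delta> \<epsilon>)
              - \<Phi> (upper_quantile \<alpha> - extremal_value d a b R \<epsilon> (r \<epsilon>)))
          \<longlongrightarrow> 0) (at_right 0))"
proof -
  interpret power_ellipsoid d a b R "\<Sum>j=1..d. 1 / (2 * s j)" "\<Sum>j=1..d. 2 * t j / s j"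
    by (rule power_ellipsoid_powr[OF assms(1,2,5-8)])
  have "2 * ((\<Sum>j=1..d. 1 / (2 * s j)) + (\<Sum>j=1..d. 2 * t j / s j)) = (\<Sum>j=1..d. (1 + 4 * t j) / s j)"
    unfolding sum.distrib[symmetric] sum_distrib_left
  proof (intro sum.cong refl)
    fix j assume "j \<in> {1..d}"
    hence "s j > 0" by (rule assms(6))
    thus "2 * (1 / (2 * s j) + 2 * t j / s j) = (1 + 4 * t j) / s j" by (simp add: field_simps)
  qed
  hence "\<kappa> = 4 / radius_exponent" unfolding assms(10) radius_exponent_def by (simp only:)
  hence rate_eq: "rate = (\<lambda>\<epsilon>. \<epsilon> powr \<kappa>)" by (intro ext) (simp only: rate_def)
  show ?thesis
    using separation_rate[OF assms(3,4,9)] sharp_asymptotics_limits[OF assms(3,4,9)]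
    unfolding rate_eq by blast
qed

end
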